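(* Let $\mathrm s\le\mathds 1$ and let the $\mathfrak g_{<0}$-valued function $V$ satisfy $$\nabla_{t_j,V}V=\left(e^{\mathrm{ad}_V}\Lambda_j\right)_{<0}\ (j\in J_+)\qquad\text{and}\qquad\nabla_{\beta_k,V}V=-(B_k)_{<0},$$ where $k\ge-1$ if $rh^{\mathrm s}=1$ (Case (I)) and $k\ge0$ if $rh^{\mathrm s}>1$ (Case (II)), and $B_k=e^{\mathrm{ad}_V}e^{-\mathrm{ad}_\Xi}d_k^{\mathds 1}-d_k^{\mathrm s}$ with $\Xi=\sum_{j\in J_+}t_j\Lambda_j$. Then for all $j\in J_+$ and all $k\ge-1$ in Case (I), respectively all $k\ge0$ in Case (II), $$\frac{\partial B_k}{\partial t_j}=\left[-\left(e^{\mathrm{ad}_V}\Lambda_j\right)_{\ge0},\,B_k+d_k^{\mathrm s}\right],$$ $$\frac{\partial}{\partial t_j}\frac{\partial}{\partial\beta_k}V=\frac{\partial}{\partial\beta_k}\frac{\partial}{\partial t_j}V,$$ i.e. the flows $\partial/\partial\beta_k$ and $\partial/\partial t_j$ defined by these equations commute.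
   Context: Affine algebra. $A=(a_{ij})_{0\le i,j\le\ell}$ is a generalized Cartan matrix of affine type $X_{\ell'}^{(r)}$ ($r\in\{1,2,3\}$), with Kac labels $k_i$ and dual Kac labels $k_i^\vee$. $\mathfrak g(A)$ is the complex affine Kac-Moody algebra with Chevalley generators $e_i,f_i$, simple coroots $\alpha_i^\vee=[e_i,f_i]$, Cartan subalgebra $\mathfrak h=\bigoplus_i\mathbb C\alpha_i^\vee\oplus\mathbb C d$, $[d,e_i]=e_i$, $[d,f_i]=-f_i$; $\mathfrak g=[\mathfrak g(A),\mathfrak g(A)]$; $c=\sum_i k_i^\vee\alpha_i^\vee$. $(\cdot\mid\cdot)$ is the invariant symmetric bilinear form with $(\alpha_i^\vee\mid\alpha_j^\vee)=a_{ij}k_j/k_j^\vee$, $(d\mid\alpha_j^\vee)=k_j/k_j^\vee$, $(d\mid d)=0$. $h=\sum_i k_i$; $\mathfrak g^k=\{X\in\mathfrak g\mid[d,X]=kX\}$. With $\Lambda=\sum_i e_i$, $\mathcal H=\{X\in\mathfrak g\mid[\Lambda,X]\in\mathbb Cc\}$ has a basis consisting of $c$ and $\Lambda_j\in\mathfrak g^j$ ($j\in J$, the (multi)set of exponents, $J=J+rh\mathbb Z$), $[\Lambda_i,\Lambda_j]=i\delta_{i,-j}c$; $J_+$ denotes positive exponents. Gradations. For a nonzero vector $\mathrm s=(s_0,\dots,s_\ell)$ of nonnegative integers, $d^{\mathrm s}\in\mathfrak h$ is defined by $(d^{\mathrm s}\mid\alpha_i^\vee)=k_is_i/k_i^\vee$,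 $(d^{\mathrm s}\mid d^{\mathrm s})=0$; $h^{\mathrm s}=\sum_i k_is_i$; $\mathfrak g_k=\{X\in\mathfrak g\mid[d^{\mathrm s},X]=kX\}$. $\mathds 1=(1,\dots,1)$, $\mathrm s^0=(1,0,\dots,0)$; $\mathrm s\le\mathds 1$ means $s_i\in\{0,1\}$. Subscripts $<0,\ge0$ denote projections for $\mathfrak g=\mathfrak g_{<0}\oplus\mathfrak g_{\ge0}$ (gradation $\mathrm s$). Virasoro elements. Let $\mathcal G$ be the simple Lie algebra of type $X_{\ell'}$ with normalized invariant form $(\cdot\mid\cdot)_{\mathcal G}$ and a diagram automorphism $\sigma$ of order $r$ ($\sigma=\mathrm{id}$ if $r=1$). Let $E_i,F_i,H_i=[E_i,F_i]$ ($0\le i\le\ell$) be fixed elements of $\mathcal G$, independent of $\mathrm s$, such that $[E_i,F_j]=\delta_{ij}H_i$, $[H_i,H_j]=0$, $[H_i,E_j]=a_{ij}E_j$, $[H_i,F_j]=-a_{ij}F_j$, $\sum_ik_i^\vee H_i=0$, the $E_i$ generate $\mathcal G$ and so do the $F_i$; concretely, with $\varepsilon=0$ if $A$ is not of type $A_{2\ell}^{(2)}$ and $\varepsilon$ the unique index with $k_\varepsilon=1$ if it is, the $E_i,F_i,H_i$ with $i\ne\varepsilon$ are Chevalley generators of the $\sigma$-fixed subalgebra of $\mathcal G$, and $E_\varepsilon$, $F_\varepsilon$ lie in the eigenspaces of $\sigma$ with eigenvalues $e^{2\pi\sqrt{-1}/r}$, $e^{-2\pi\sqrt{-1}/r}$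 respectively. For these elements, with the $\mathbb Z/rh^{\mathrm s}\mathbb Z$-gradation of $\mathcal G$ given by $\deg E_i=-\deg F_i=s_i$, there is an isomorphism $R^{\mathrm s}:\bigoplus_k z^k\otimes\mathcal G_{k\bmod rh^{\mathrm s}}\oplus\mathbb Cc'\to\mathfrak g$, $X(k):=z^k\otimes X$, $E_i(s_i)\mapsto e_i$, $F_i(-s_i)\mapsto f_i$, $H_i(0)+\frac{k_is_i}{k_i^\vee h^{\mathrm s}}c'\mapsto\alpha_i^\vee$, $c'\mapsto c$, the bracket on the left being $[X(k),Y(l)]=[X,Y](k+l)+\delta_{k,-l}\frac k{rh^{\mathrm s}}(X\mid Y)_{\mathcal G}c'$. $d_k^{\mathrm s}$ denotes the derivation $-\frac1{rh^{\mathrm s}}z^{rh^{\mathrm s}k+1}\frac{\mathrm d}{\mathrm dz}$ transported by $R^{\mathrm s}$; $[d_k^{\mathrm s},d_l^{\mathrm s}]=(k-l)d_{k+l}^{\mathrm s}$. For different $\mathrm s$ these are regarded as elements of one Lie algebra $\mathfrak d^{\mathrm s^0}\ltimes\mathfrak g$, $\mathfrak d^{\mathrm s^0}=\bigoplus_k\mathbb Cd_k^{\mathrm s^0}$, through $$d_0^{\mathrm s}=d_0^{\mathrm s^0}-\rho^{\mathrm s}+\tfrac r2(\rho^{\mathrm s}\mid\rho^{\mathrm s})c,\qquad d_k^{\mathrm s}=d_k^{\mathrm s^0}-\sum_{i=1}^\ell r_iR^{\mathrm s^0}(H_i(rk_0k))\ (k\ne0),$$ where $\rho^{\mathrm s}=\sum_{i=1}^\ell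 r_i\alpha_i^\vee$, $(r_1,\dots,r_\ell)=\frac1{rh^{\mathrm s}}(s_1,\dots,s_\ell)\mathring A^{-1}$, $\mathring A=(a_{ij})_{1\le i,j\le\ell}$. Thus $d_k^{\mathrm s}-d_k^{\mathrm s'}\in\mathfrak g$ and $B_k$ is $\mathfrak g$-valued. The $\Lambda_j$ are normalized so that also $[d_k^{\mathds 1},\Lambda_j]=-\frac j{rh}\Lambda_{j+rhk}$. Flows. For a parameter $\beta$, $\nabla_{\beta,V}V=\sum_{m\ge0}\frac1{(m+1)!}(\mathrm{ad}_V)^m\frac{\partial V}{\partial\beta}$. Each equation determines the derivative of $V$ recursively as a polynomial expression in the components of $V$ (and, for $\beta_k$, in the times $t_j$); $\partial/\partial\beta_k$ acts trivially on the $t_j$. Infinite sums in the negative direction of the principal gradation are allowed, and sums over the times are understood as formal power series in $\mathbf t$ (or with only finitely many $t_j$ nonzero). *)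

theory Defs
  imports
    "HOL-Analysis.Analysis"
    "HOL-Library.Poly_Mapping"
    "HOL-Library.Function_Algebras"
begin

section \<open>Complex Lie algebras\<close>

class complex_lie_algebra = ab_group_add +
  fixes scaleC :: "complex \<Rightarrow> 'a \<Rightarrow> 'a"  (infixr "*\<^sub>C" 75)
    and lie :: "'a \<Rightarrow> 'a \<Rightarrow> 'a"
  assumes scaleC_add_right: "a *\<^sub>C (x + y) = a *\<^sub>C x + a *\<^sub>C y"
    and scaleC_add_left: "(a + b) *\<^sub>C x = a *\<^sub>C x + b *\<^sub>C x"
    and scaleC_scaleC: "a *\<^sub>C b *\<^sub>C x = (a * b) *\<^sub>C x"
    and scaleC_one: "1 *\<^sub>C x = x"
    and lie_add_left: "lie (x + y) z = lie x z + lie y z"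
    and lie_add_right: "lie x (y + z) = lie x y + lie x z"
    and lie_scale_left: "lie (a *\<^sub>C x) y = a *\<^sub>C lie x y"
    and lie_scale_right: "lie x (a *\<^sub>C y) = a *\<^sub>C lie x y"
    and lie_self: "lie x x = 0"
    and jacobi: "lie x (lie y z) + lie y (lie z x) + lie z (lie x y) = 0"

global_interpretation complex_vector:
  vector_space "scaleC :: complex \<Rightarrow> 'a \<Rightarrow> 'a::complex_lie_algebra"
  by unfold_locales
    (simp_all add: scaleC_add_right scaleC_add_left scaleC_scaleC scaleC_one)

definition linear_functional :: "('a::complex_lie_algebra \<Rightarrow> complex) \<Rightarrow> bool" where
  "linear_functional \<phi> \<longleftrightarrow> Vector_Spaces.linear scaleC (*) \<phi>"

definition independent_family :: "'i set \<Rightarrow> ('i \<Rightarrow> 'a::complex_lie_algebra) \<Rightarrow> bool" where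
  "independent_family I v \<longleftrightarrow> inj_on v I \<and> complex_vector.independent (v ` I)"

definition lie_subalgebra :: "'a::complex_lie_algebra set \<Rightarrow> bool" where
  "lie_subalgebra L \<longleftrightarrow> complex_vector.subspace L \<and> (\<forall>x\<in>L. \<forall>y\<in>L. lie x y \<in> L)"

definition lie_ideal :: "'a::complex_lie_algebra set \<Rightarrow> 'a set \<Rightarrow> bool" where
  "lie_ideal K L \<longleftrightarrow> complex_vector.subspace K \<and> K \<subseteq> L \<and> (\<forall>x\<in>L. \<forall>y\<in>K. lie x y \<in> K)"

definition derived_algebra :: "'a::complex_lie_algebra set \<Rightarrow> 'a set" where
  "derived_algebra L = complex_vector.span {lie x y |x y. x \<in> L \<and> y \<in> L}"

definition invariant_form :: "'a::complex_lie_algebra set \<Rightarrow> ('a \<Rightarrow> 'a \<Rightarrow> complex) \<Rightarrow> bool" where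
  "invariant_form L b \<longleftrightarrow>
     (\<forall>x\<in>L. \<forall>y\<in>L. b x y = b y x) \<and>
     (\<forall>x\<in>L. \<forall>y\<in>L. \<forall>z\<in>L. b (x + y) z = b x z + b y z) \<and>
     (\<forall>c. \<forall>x\<in>L. \<forall>y\<in>L. b (c *\<^sub>C x) y = c * b x y) \<and>
     (\<forall>x\<in>L. \<forall>y\<in>L. \<forall>z\<in>L. b (lie x y) z = b x (lie y z))"

text \<open>The whole type, as a Lie algebra, is simple of finite dimension.\<close>

definition simple_fin_dim :: "'a::complex_lie_algebra itself \<Rightarrow> bool" where
  "simple_fin_dim _ \<longleftrightarrow>
     (\<exists>S::'a set. finite S \<and> complex_vector.span S = UNIV) \<and>
     (\<exists>x y::'a. lie x y \<noteq> 0) \<and>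
     (\<forall>K::'a set. lie_ideal K UNIV \<longrightarrow> K = {0} \<or> K = UNIV)"

definition chevalley_relations ::
  "nat set \<Rightarrow> (nat \<Rightarrow> nat \<Rightarrow> int) \<Rightarrow> (nat \<Rightarrow> 'a::complex_lie_algebra) \<Rightarrow> (nat \<Rightarrow> 'a) \<Rightarrow> bool" where
  "chevalley_relations I a e f \<longleftrightarrow> (\<forall>i\<in>I. \<forall>j\<in>I.
     (i \<noteq> j \<longrightarrow> lie (e i) (f j) = 0) \<and>
     lie (lie (e i) (f i)) (lie (e j) (f j)) = 0 \<and>
     lie (lie (e i) (f i)) (e j) = of_int (a i j) *\<^sub>C e j \<and>
     lie (lie (e i) (f i)) (f j) = - (of_int (a i j) *\<^sub>C f j))"

text \<open>\<open>L\<close> is the Kac--Moody algebra with Chevalley generators \<open>e\<close>, \<open>f\<close> and Cartan subalgebra \<open>H\<close>: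
  as in Kac's book, the algebra given by the Chevalley relations is divided by its largest ideal
  meeting \<open>H\<close> trivially, that is, \<open>L\<close> has no nonzero ideal of this kind. The action of \<open>H\<close> on the
  generators is to be specified separately when \<open>H\<close> is larger than the span of the coroots.\<close>

definition kac_moody ::
  "nat set \<Rightarrow> (nat \<Rightarrow> nat \<Rightarrow> int) \<Rightarrow> (nat \<Rightarrow> 'a::complex_lie_algebra) \<Rightarrow> (nat \<Rightarrow> 'a) \<Rightarrow> 'a set \<Rightarrow> 'a set \<Rightarrow> bool" where
  "kac_moody I a e f H L \<longleftrightarrow>
     chevalley_relations I a e f \<and>
     independent_family I (\<lambda>i. lie (e i) (f i)) \<and>
     complex_vector.subspace H \<and> (\<lambda>i. lie (e i) (f i)) ` I \<subseteq> H \<and>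
     (\<forall>x\<in>H. \<forall>y\<in>H. lie x y = 0) \<and>
     L = lie_subalgebra hull (e ` I \<union> f ` I \<union> H) \<and>
     (\<forall>K. lie_ideal K L \<and> K \<inter> H = {0} \<longrightarrow> K = {0})"

definition chevalley_generators ::
  "nat set \<Rightarrow> (nat \<Rightarrow> nat \<Rightarrow> int) \<Rightarrow> (nat \<Rightarrow> 'a::complex_lie_algebra) \<Rightarrow> (nat \<Rightarrow> 'a) \<Rightarrow> 'a set \<Rightarrow> bool" where
  "chevalley_generators I a e f L \<longleftrightarrow>
     kac_moody I a e f (complex_vector.span ((\<lambda>i. lie (e i) (f i)) ` I)) L"


section \<open>Cartan matrices\<close>

datatype cartan_type =
  type_A nat | type_B nat | type_C nat | type_D nat | type_E nat | type_F4 | type_G2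

fun type_rank :: "cartan_type \<Rightarrow> nat" where
  "type_rank (type_A n) = n"
| "type_rank (type_B n) = n"
| "type_rank (type_C n) = n"
| "type_rank (type_D n) = n"
| "type_rank (type_E n) = n"
| "type_rank type_F4 = 4"
| "type_rank type_G2 = 2"

text \<open>A bond \<open>(i, j, p, q)\<close> stands for the entries \<open>a i j = - p\<close> and \<open>a j i = - q\<close>.
  All diagrams are labelled as in the tables of Kac's book.\<close>

type_synonym bond = "nat \<times> nat \<times> int \<times> int"

definition dynkin_matrix :: "bond list \<Rightarrow> nat \<Rightarrow> nat \<Rightarrow> int" where
  "dynkin_matrix bs i j = (if i = j then 2 else
     - (\<Sum>(u, v, p, q)\<leftarrow>bs. if (i, j) = (u, v) then p else if (i, j) = (v, u) then q else 0))"

definition simple_chain :: "nat \<Rightarrow> nat \<Rightarrow> bond list" where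
  "simple_chain m n = map (\<lambda>i. (i, Suc i, 1, 1)) [m..<n]"

fun finite_bonds :: "cartan_type \<Rightarrow> bond list" where
  "finite_bonds (type_A n) = simple_chain 1 n"
| "finite_bonds (type_B n) = simple_chain 1 (n - 1) @ [(n - 1, n, 1, 2)]"
| "finite_bonds (type_C n) = simple_chain 1 (n - 1) @ [(n - 1, n, 2, 1)]"
| "finite_bonds (type_D n) = simple_chain 1 (n - 1) @ [(n - 2, n, 1, 1)]"
| "finite_bonds (type_E n) = simple_chain 1 (n - 1) @ [(if n = 8 then 5 else 3, n, 1, 1)]"
| "finite_bonds type_F4 = [(1, 2, 1, 1), (2, 3, 1, 2), (3, 4, 1, 1)]"
| "finite_bonds type_G2 = [(1, 2, 1, 3)]"

text \<open>\<open>affine_type X r l bs\<close>: \<open>bs\<close> is the diagram, with vertices \<open>0, \<dots>, l\<close>, of the affine type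
  \<open>X\<^sup>(\<^sup>r\<^sup>)\<close>. In type \<open>A\<^sub>2\<^sub>l\<^sup>(\<^sup>2\<^sup>)\<close> the vertex \<open>0\<close> is the one with Kac label \<open>2\<close> and dual Kac label \<open>1\<close>.\<close>

inductive affine_type :: "cartan_type \<Rightarrow> nat \<Rightarrow> nat \<Rightarrow> bond list \<Rightarrow> bool" where
  "affine_type (type_A 1) 1 1 [(0, 1, 2, 2)]"
| "l \<ge> 2 \<Longrightarrow> affine_type (type_A l) 1 l (simple_chain 0 l @ [(l, 0, 1, 1)])"
| "l \<ge> 3 \<Longrightarrow> affine_type (type_B l) 1 l ((0, 2, 1, 1) # finite_bonds (type_B l))"
| "l \<ge> 2 \<Longrightarrow> affine_type (type_C l) 1 l ((0, 1, 1, 2) # finite_bonds (type_C l))"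
| "l \<ge> 4 \<Longrightarrow> affine_type (type_D l) 1 l ((0, 2, 1, 1) # finite_bonds (type_D l))"
| "affine_type (type_E 6) 1 6 ((0, 6, 1, 1) # finite_bonds (type_E 6))"
| "affine_type (type_E 7) 1 7 ((0, 1, 1, 1) # finite_bonds (type_E 7))"
| "affine_type (type_E 8) 1 8 ((0, 1, 1, 1) # finite_bonds (type_E 8))"
| "affine_type type_F4 1 4 ((0, 1, 1, 1) # finite_bonds type_F4)"
| "affine_type type_G2 1 2 ((0, 1, 1, 1) # finite_bonds type_G2)"
| "affine_type (type_A 2) 2 1 [(0, 1, 4, 1)]"
| "l \<ge> 2 \<Longrightarrow> affine_type (type_A (2 * l)) 2 l ((0, 1, 2, 1) # finite_bonds (type_C l))"
| "l \<ge> 3 \<Longrightarrow> affine_type (type_A (2 * l - 1)) 2 l ((0, 2, 1, 1) # finite_bonds (type_C l))"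
| "l \<ge> 2 \<Longrightarrow> affine_type (type_D (l + 1)) 2 l ((0, 1, 2, 1) # finite_bonds (type_B l))"
| "affine_type (type_E 6) 2 4 [(0, 1, 1, 1), (1, 2, 1, 1), (2, 3, 2, 1), (3, 4, 1, 1)]"
| "affine_type (type_D 4) 3 2 [(0, 1, 1, 1), (1, 2, 3, 1)]"

definition kac_labels :: "nat \<Rightarrow> (nat \<Rightarrow> nat \<Rightarrow> int) \<Rightarrow> (nat \<Rightarrow> nat) \<Rightarrow> bool" where
  "kac_labels l a k \<longleftrightarrow> (\<forall>i\<le>l. k i > 0) \<and> Gcd (k ` {..l}) = 1 \<and>
     (\<forall>i\<le>l. (\<Sum>j\<le>l. a i j * int (k j)) = 0)"


section \<open>The affine algebra and its loop realizations\<close>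

text \<open>An element of the untwisted or twisted loop algebra with its central extension: a Laurent
  polynomial in \<open>z\<close> together with the coefficient of \<open>c'\<close>.\<close>

type_synonym 'b loop = "(int \<Rightarrow>\<^sub>0 'b) \<times> complex"

text \<open>All elements of the affine algebra \<open>g(A)\<close> and the Virasoro elements live in an ambient Lie
  algebra \<open>'a\<close>, of which nothing else is required; the simple Lie algebra of type \<open>X\<close> is \<open>'b\<close>. An element \<open>(n, m)\<close> of \<open>exponents\<close>
  stands for the exponent \<open>n\<close>, its multiple occurrences being distinguished by \<open>m\<close>.\<close>

record (overloaded) ('a, 'b :: zero) affine_data =
  fin_type :: cartan_type
  twist :: nat
  aff_rank :: nat
  gcm :: "nat \<Rightarrow> nat \<Rightarrow> int"
  label :: "nat \<Rightarrow> nat"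
  colabel :: "nat \<Rightarrow> nat"
  gen_e :: "nat \<Rightarrow> 'a"
  gen_f :: "nat \<Rightarrow> 'a"
  scaling :: 'a
  form :: "'a \<Rightarrow> 'a \<Rightarrow> complex"
  exponents :: "(int \<times> nat) set"
  heis :: "int \<times> nat \<Rightarrow> 'a"
  simple_x :: "nat \<Rightarrow> 'b"
  simple_y :: "nat \<Rightarrow> 'b"
  simple_form :: "'b \<Rightarrow> 'b \<Rightarrow> complex"
  diagram_aut :: "'b \<Rightarrow> 'b"
  gen_E :: "nat \<Rightarrow> 'b"
  gen_F :: "nat \<Rightarrow> 'b"
  loop_iso :: "(nat \<Rightarrow> nat) \<Rightarrow> 'b loop \<Rightarrow> 'a"
  virasoro :: "(nat \<Rightarrow> nat) \<Rightarrow> int \<Rightarrow> 'a"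

definition principal_grad :: "nat \<Rightarrow> nat" where
  "principal_grad = (\<lambda>i. 1)"

definition homogeneous_grad :: "nat \<Rightarrow> nat" where
  "homogeneous_grad = (\<lambda>i. if i = 0 then 1 else 0)"

definition gradation :: "('a::complex_lie_algebra, 'b::complex_lie_algebra) affine_data \<Rightarrow> (nat \<Rightarrow> nat) \<Rightarrow> bool" where
  "gradation \<A> s \<longleftrightarrow> (\<exists>i\<le>aff_rank \<A>. s i \<noteq> 0)"

text \<open>\<open>coxeter \<A> s\<close> is \<open>h\<^sup>s\<close>; in particular \<open>h\<close> is \<open>coxeter \<A> principal_grad\<close>.\<close>

definition coxeter :: "('a::complex_lie_algebra, 'b::complex_lie_algebra) affine_data \<Rightarrow> (nat \<Rightarrow> nat) \<Rightarrow> nat" where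
  "coxeter \<A> s = (\<Sum>i\<le>aff_rank \<A>. label \<A> i * s i)"

abbreviation period :: "('a::complex_lie_algebra, 'b::complex_lie_algebra) affine_data \<Rightarrow> (nat \<Rightarrow> nat) \<Rightarrow> nat" where
  "period \<A> s \<equiv> twist \<A> * coxeter \<A> s"

definition coroot :: "('a::complex_lie_algebra, 'b::complex_lie_algebra) affine_data \<Rightarrow> nat \<Rightarrow> 'a" where
  "coroot \<A> i = lie (gen_e \<A> i) (gen_f \<A> i)"

definition gen_H :: "('a::complex_lie_algebra, 'b::complex_lie_algebra) affine_data \<Rightarrow> nat \<Rightarrow> 'b" where
  "gen_H \<A> i = lie (gen_E \<A> i) (gen_F \<A> i)"

definition central :: "('a::complex_lie_algebra, 'b::complex_lie_algebra) affine_data \<Rightarrow> 'a" where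
  "central \<A> = (\<Sum>i\<le>aff_rank \<A>. of_nat (colabel \<A> i) *\<^sub>C coroot \<A> i)"

definition cartan_subalgebra :: "('a::complex_lie_algebra, 'b::complex_lie_algebra) affine_data \<Rightarrow> 'a set" where
  "cartan_subalgebra \<A> = complex_vector.span (insert (scaling \<A>) (coroot \<A> ` {..aff_rank \<A>}))"

definition affine_algebra :: "('a::complex_lie_algebra, 'b::complex_lie_algebra) affine_data \<Rightarrow> 'a set" where
  "affine_algebra \<A> = lie_subalgebra hull
     (gen_e \<A> ` {..aff_rank \<A>} \<union> gen_f \<A> ` {..aff_rank \<A>} \<union> cartan_subalgebra \<A>)"

definition derived_affine :: "('a::complex_lie_algebra, 'b::complex_lie_algebra) affine_data \<Rightarrow> 'a set" where
  "derived_affine \<A> = derived_algebra (affine_algebra \<A>)"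

definition affine_kac_moody :: "('a::complex_lie_algebra, 'b::complex_lie_algebra) affine_data \<Rightarrow> bool" where
  "affine_kac_moody \<A> \<longleftrightarrow>
     (\<exists>bs. affine_type (fin_type \<A>) (twist \<A>) (aff_rank \<A>) bs \<and> gcm \<A> = dynkin_matrix bs) \<and>
     kac_labels (aff_rank \<A>) (gcm \<A>) (label \<A>) \<and>
     kac_labels (aff_rank \<A>) (\<lambda>i j. gcm \<A> j i) (colabel \<A>) \<and>
     kac_moody {..aff_rank \<A>} (gcm \<A>) (gen_e \<A>) (gen_f \<A>) (cartan_subalgebra \<A>) (affine_algebra \<A>) \<and>
     scaling \<A> \<notin> complex_vector.span (coroot \<A> ` {..aff_rank \<A>}) \<and>
     (\<forall>i\<le>aff_rank \<A>. lie (scaling \<A>) (gen_e \<A> i) = gen_e \<A> i \<and>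
                  lie (scaling \<A>) (gen_f \<A> i) = - gen_f \<A> i) \<and>
     invariant_form (affine_algebra \<A>) (form \<A>) \<and>
     (\<forall>i\<le>aff_rank \<A>. \<forall>j\<le>aff_rank \<A>. form \<A> (coroot \<A> i) (coroot \<A> j) =
        of_int (gcm \<A> i j) * of_nat (label \<A> j) / of_nat (colabel \<A> j)) \<and>
     (\<forall>j\<le>aff_rank \<A>. form \<A> (scaling \<A>) (coroot \<A> j) = of_nat (label \<A> j) / of_nat (colabel \<A> j)) \<and>
     form \<A> (scaling \<A>) (scaling \<A>) = 0"

definition degree_elt :: "('a::complex_lie_algebra, 'b::complex_lie_algebra) affine_data \<Rightarrow> (nat \<Rightarrow> nat) \<Rightarrow> 'a" where
  "degree_elt \<A> s = (THE x. x \<in> cartan_subalgebra \<A> \<and> form \<A> x x = 0 \<and>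
     (\<forall>i\<le>aff_rank \<A>. form \<A> x (coroot \<A> i) = of_nat (label \<A> i * s i) / of_nat (colabel \<A> i)))"

definition graded_part :: "('a::complex_lie_algebra, 'b::complex_lie_algebra) affine_data \<Rightarrow> (nat \<Rightarrow> nat) \<Rightarrow> int \<Rightarrow> 'a set" where
  "graded_part \<A> s k = {x \<in> derived_affine \<A>. lie (degree_elt \<A> s) x = of_int k *\<^sub>C x}"

definition principal_part :: "('a::complex_lie_algebra, 'b::complex_lie_algebra) affine_data \<Rightarrow> int \<Rightarrow> 'a set" where
  "principal_part \<A> k = {x \<in> derived_affine \<A>. lie (scaling \<A>) x = of_int k *\<^sub>C x}"

definition neg_space :: "('a::complex_lie_algebra, 'b::complex_lie_algebra) affine_data \<Rightarrow> (nat \<Rightarrow> nat) \<Rightarrow> 'a set" where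
  "neg_space \<A> s = complex_vector.span (\<Union>k\<in>{k. k < 0}. graded_part \<A> s k)"

definition nonneg_space :: "('a::complex_lie_algebra, 'b::complex_lie_algebra) affine_data \<Rightarrow> (nat \<Rightarrow> nat) \<Rightarrow> 'a set" where
  "nonneg_space \<A> s = complex_vector.span (\<Union>k\<in>{k. k \<ge> 0}. graded_part \<A> s k)"

definition neg_proj :: "('a::complex_lie_algebra, 'b::complex_lie_algebra) affine_data \<Rightarrow> (nat \<Rightarrow> nat) \<Rightarrow> 'a \<Rightarrow> 'a" where
  "neg_proj \<A> s x = (THE y. y \<in> neg_space \<A> s \<and> x - y \<in> nonneg_space \<A> s)"

definition nonneg_proj :: "('a::complex_lie_algebra, 'b::complex_lie_algebra) affine_data \<Rightarrow> (nat \<Rightarrow> nat) \<Rightarrow> 'a \<Rightarrow> 'a" where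
  "nonneg_proj \<A> s x = (THE y. y \<in> nonneg_space \<A> s \<and> x - y \<in> neg_space \<A> s)"

text \<open>The form is normalized so that long roots have square length \<open>2\<close>: a simple root \<open>\<alpha>\<close> has square
  length \<open>4 / (\<alpha>\<^sup>\<or> | \<alpha>\<^sup>\<or>)\<close>, so that \<open>2\<close> is the least square length of a simple coroot.\<close>

definition normalized_form :: "nat set \<Rightarrow> (nat \<Rightarrow> 'b::complex_lie_algebra) \<Rightarrow> ('b \<Rightarrow> 'b \<Rightarrow> complex) \<Rightarrow> bool" where
  "normalized_form I h b \<longleftrightarrow> invariant_form UNIV b \<and>
     (\<forall>i\<in>I. \<exists>q::real. b (h i) (h i) = of_real q \<and> q \<ge> 2) \<and> (\<exists>i\<in>I. b (h i) (h i) = 2)"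

definition diagram_automorphism ::
  "nat set \<Rightarrow> (nat \<Rightarrow> nat \<Rightarrow> int) \<Rightarrow> (nat \<Rightarrow> 'b::complex_lie_algebra) \<Rightarrow> (nat \<Rightarrow> 'b) \<Rightarrow> ('b \<Rightarrow> 'b) \<Rightarrow> bool" where
  "diagram_automorphism I a x y \<sigma> \<longleftrightarrow>
     bij \<sigma> \<and> Vector_Spaces.linear scaleC scaleC \<sigma> \<and> (\<forall>u v. \<sigma> (lie u v) = lie (\<sigma> u) (\<sigma> v)) \<and>
     (\<exists>\<pi>. bij_betw \<pi> I I \<and> (\<forall>i\<in>I. \<forall>j\<in>I. a (\<pi> i) (\<pi> j) = a i j) \<and>
          (\<forall>i\<in>I. \<sigma> (x i) = x (\<pi> i) \<and> \<sigma> (y i) = y (\<pi> i)))"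

definition special_index :: "('a::complex_lie_algebra, 'b::complex_lie_algebra) affine_data \<Rightarrow> nat" where
  "special_index \<A> = (if twist \<A> = 2 \<and> (\<exists>n. fin_type \<A> = type_A (2 * n))
     then THE i. i \<le> aff_rank \<A> \<and> label \<A> i = 1 else 0)"

definition simple_algebra_data :: "('a::complex_lie_algebra, 'b::complex_lie_algebra) affine_data \<Rightarrow> bool" where
  "simple_algebra_data \<A> \<longleftrightarrow>
     (let I = {1..type_rank (fin_type \<A>)}; a = dynkin_matrix (finite_bonds (fin_type \<A>));
          x = simple_x \<A>; y = simple_y \<A>; \<sigma> = diagram_aut \<A>; r = twist \<A>; l = aff_rank \<A>;
          \<epsilon> = special_index \<A>; \<omega> = cis (2 * pi / real r) in
      simple_fin_dim TYPE('b) \<and> chevalley_generators I a x y UNIV \<and>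
      normalized_form I (\<lambda>i. lie (x i) (y i)) (simple_form \<A>) \<and>
      diagram_automorphism I a x y \<sigma> \<and> \<sigma> ^^ r = id \<and> (\<forall>n. 0 < n \<and> n < r \<longrightarrow> \<sigma> ^^ n \<noteq> id) \<and>
      chevalley_relations {..l} (gcm \<A>) (gen_E \<A>) (gen_F \<A>) \<and>
      (\<Sum>i\<le>l. of_nat (colabel \<A> i) *\<^sub>C gen_H \<A> i) = 0 \<and>
      lie_subalgebra hull (gen_E \<A> ` {..l}) = UNIV \<and>
      lie_subalgebra hull (gen_F \<A> ` {..l}) = UNIV \<and>
      chevalley_generators ({..l} - {\<epsilon>}) (gcm \<A>) (gen_E \<A>) (gen_F \<A>) {u. \<sigma> u = u} \<and>
      \<sigma> (gen_E \<A> \<epsilon>) = \<omega> *\<^sub>C gen_E \<A> \<epsilon> \<and> \<sigma> (gen_F \<A> \<epsilon>) = inverse \<omega> *\<^sub>C gen_F \<A> \<epsilon>)"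

text \<open>\<open>loop_degree \<A> s m u\<close>: \<open>u\<close> belongs to the component of degree \<open>m\<close> modulo \<open>r h\<^sup>s\<close>
  of the gradation with \<open>deg E\<^sub>i = - deg F\<^sub>i = s\<^sub>i\<close>.\<close>

inductive loop_degree :: "('a::complex_lie_algebra, 'b::complex_lie_algebra) affine_data \<Rightarrow> (nat \<Rightarrow> nat) \<Rightarrow> int \<Rightarrow> 'b \<Rightarrow> bool"
  for \<A> s where
  gen_E: "i \<le> aff_rank \<A> \<Longrightarrow> loop_degree \<A> s (int (s i)) (gen_E \<A> i)"
| gen_F: "i \<le> aff_rank \<A> \<Longrightarrow> loop_degree \<A> s (- int (s i)) (gen_F \<A> i)"
| lie: "loop_degree \<A> s m u \<Longrightarrow> loop_degree \<A> s n v \<Longrightarrow> loop_degree \<A> s (m + n) (lie u v)"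
| zero: "loop_degree \<A> s m 0"
| add: "loop_degree \<A> s m u \<Longrightarrow> loop_degree \<A> s m v \<Longrightarrow> loop_degree \<A> s m (u + v)"
| scale: "loop_degree \<A> s m u \<Longrightarrow> loop_degree \<A> s m (c *\<^sub>C u)"
| period: "loop_degree \<A> s m u \<Longrightarrow> m mod int (period \<A> s) = n mod int (period \<A> s) \<Longrightarrow> loop_degree \<A> s n u"

definition loop_algebra :: "('a::complex_lie_algebra, 'b::complex_lie_algebra) affine_data \<Rightarrow> (nat \<Rightarrow> nat) \<Rightarrow> 'b loop set" where
  "loop_algebra \<A> s = {(u, c). \<forall>m. loop_degree \<A> s m (Poly_Mapping.lookup u m)}"

definition zpow :: "int \<Rightarrow> 'b::complex_lie_algebra \<Rightarrow> 'b loop" where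
  "zpow m u = (Poly_Mapping.single m u, 0)"

definition loop_scale :: "complex \<Rightarrow> 'b::complex_lie_algebra loop \<Rightarrow> 'b loop" where
  "loop_scale a x = (Poly_Mapping.map (scaleC a) (fst x), a * snd x)"

definition loop_bracket ::
  "('a::complex_lie_algebra, 'b::complex_lie_algebra) affine_data \<Rightarrow> (nat \<Rightarrow> nat) \<Rightarrow> 'b loop \<Rightarrow> 'b loop \<Rightarrow> 'b loop" where
  "loop_bracket \<A> s x y =
     (let u = Poly_Mapping.lookup (fst x); v = Poly_Mapping.lookup (fst y) in
      (\<Sum>m\<in>Poly_Mapping.keys (fst x). \<Sum>n\<in>Poly_Mapping.keys (fst y).
          Poly_Mapping.single (m + n) (lie (u m) (v n)),
       \<Sum>m\<in>Poly_Mapping.keys (fst x).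
          of_int m / of_nat (period \<A> s) * simple_form \<A> (u m) (v (- m))))"

text \<open>The derivation \<open>- 1 / (r h\<^sup>s) z\<^bsup>r h\<^sup>s k + 1\<^esup> d/dz\<close>.\<close>

definition loop_derivation ::
  "('a::complex_lie_algebra, 'b::complex_lie_algebra) affine_data \<Rightarrow> (nat \<Rightarrow> nat) \<Rightarrow> int \<Rightarrow> 'b loop \<Rightarrow> 'b loop" where
  "loop_derivation \<A> s k x =
     (\<Sum>m\<in>Poly_Mapping.keys (fst x). Poly_Mapping.single (m + int (period \<A> s) * k)
        ((- of_int m / of_nat (period \<A> s)) *\<^sub>C Poly_Mapping.lookup (fst x) m), 0)"

definition loop_isomorphism ::
  "('a::complex_lie_algebra, 'b::complex_lie_algebra) affine_data \<Rightarrow> (nat \<Rightarrow> nat) \<Rightarrow> ('b loop \<Rightarrow> 'a) \<Rightarrow> bool" where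
  "loop_isomorphism \<A> s R \<longleftrightarrow>
     bij_betw R (loop_algebra \<A> s) (derived_affine \<A>) \<and>
     (\<forall>x\<in>loop_algebra \<A> s. \<forall>y\<in>loop_algebra \<A> s. R (x + y) = R x + R y) \<and>
     (\<forall>a. \<forall>x\<in>loop_algebra \<A> s. R (loop_scale a x) = a *\<^sub>C R x) \<and>
     (\<forall>x\<in>loop_algebra \<A> s. \<forall>y\<in>loop_algebra \<A> s. R (loop_bracket \<A> s x y) = lie (R x) (R y)) \<and>
     (\<forall>i\<le>aff_rank \<A>. R (zpow (int (s i)) (gen_E \<A> i)) = gen_e \<A> i) \<and>
     (\<forall>i\<le>aff_rank \<A>. R (zpow (- int (s i)) (gen_F \<A> i)) = gen_f \<A> i) \<and>
     (\<forall>i\<le>aff_rank \<A>. R (zpow 0 (gen_H \<A> i) +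
        (0, of_nat (label \<A> i * s i) / of_nat (colabel \<A> i * coxeter \<A> s))) = coroot \<A> i) \<and>
     R (0, 1) = central \<A>"

definition inverse_matrix_on :: "nat set \<Rightarrow> (nat \<Rightarrow> nat \<Rightarrow> int) \<Rightarrow> nat \<Rightarrow> nat \<Rightarrow> complex" where
  "inverse_matrix_on I a = (THE b. (\<forall>i j. i \<notin> I \<or> j \<notin> I \<longrightarrow> b i j = 0) \<and>
     (\<forall>i\<in>I. \<forall>j\<in>I. (\<Sum>k\<in>I. of_int (a i k) * b k j) = (if i = j then 1 else 0)))"

definition rho_coeff :: "('a::complex_lie_algebra, 'b::complex_lie_algebra) affine_data \<Rightarrow> (nat \<Rightarrow> nat) \<Rightarrow> nat \<Rightarrow> complex" where
  "rho_coeff \<A> s j = 1 / of_nat (period \<A> s) *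
     (\<Sum>i=1..aff_rank \<A>. of_nat (s i) * inverse_matrix_on {1..aff_rank \<A>} (gcm \<A>) i j)"

definition rho :: "('a::complex_lie_algebra, 'b::complex_lie_algebra) affine_data \<Rightarrow> (nat \<Rightarrow> nat) \<Rightarrow> 'a" where
  "rho \<A> s = (\<Sum>i=1..aff_rank \<A>. rho_coeff \<A> s i *\<^sub>C coroot \<A> i)"

definition virasoro_elements :: "('a::complex_lie_algebra, 'b::complex_lie_algebra) affine_data \<Rightarrow> bool" where
  "virasoro_elements \<A> \<longleftrightarrow>
     (let d = virasoro \<A>; s0 = homogeneous_grad; r = twist \<A> in
      (\<forall>s. gradation \<A> s \<longrightarrow> (\<forall>k. \<forall>x\<in>loop_algebra \<A> s.
         lie (d s k) (loop_iso \<A> s x) = loop_iso \<A> s (loop_derivation \<A> s k x))) \<and>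
      (\<forall>k l. lie (d s0 k) (d s0 l) = of_int (k - l) *\<^sub>C d s0 (k + l)) \<and>
      independent_family UNIV (d s0) \<and>
      complex_vector.span (range (d s0)) \<inter> derived_affine \<A> = {0} \<and>
      (\<forall>s. gradation \<A> s \<longrightarrow>
         d s 0 = d s0 0 - rho \<A> s + (of_nat r / 2 * form \<A> (rho \<A> s) (rho \<A> s)) *\<^sub>C central \<A> \<and>
         (\<forall>k. k \<noteq> 0 \<longrightarrow> d s k = d s0 k - (\<Sum>i=1..aff_rank \<A>. rho_coeff \<A> s i *\<^sub>C
            loop_iso \<A> s0 (zpow (int (r * label \<A> 0) * k) (gen_H \<A> i))))))"

definition principal_heisenberg :: "('a::complex_lie_algebra, 'b::complex_lie_algebra) affine_data \<Rightarrow> bool" where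
  "principal_heisenberg \<A> \<longleftrightarrow>
     (let J = exponents \<A>; \<Lambda> = heis \<A>; c = central \<A>; rh = int (period \<A> principal_grad) in
      (\<forall>n m k. (n, m) \<in> J \<longleftrightarrow> (n + rh * k, m) \<in> J) \<and>
      (\<forall>j\<in>J. \<Lambda> j \<in> principal_part \<A> (fst j)) \<and>
      independent_family J \<Lambda> \<and> c \<notin> complex_vector.span (\<Lambda> ` J) \<and>
      complex_vector.span (insert c (\<Lambda> ` J)) =
        {x \<in> derived_affine \<A>. \<exists>a. lie (\<Sum>i\<le>aff_rank \<A>. gen_e \<A> i) x = a *\<^sub>C c} \<and>
      (\<forall>i\<in>J. \<forall>j\<in>J. lie (\<Lambda> i) (\<Lambda> j) =
         (if fst i = - fst j \<and> snd i = snd j then of_int (fst i) *\<^sub>C c else 0)) \<and>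
      (\<forall>k. \<forall>j\<in>J. lie (virasoro \<A> principal_grad k) (\<Lambda> j) =
         (- of_int (fst j) / of_int rh) *\<^sub>C \<Lambda> (fst j + rh * k, snd j)))"

definition affine_setting :: "('a::complex_lie_algebra, 'b::complex_lie_algebra) affine_data \<Rightarrow> bool" where
  "affine_setting \<A> \<longleftrightarrow> affine_kac_moody \<A> \<and> simple_algebra_data \<A> \<and>
     (\<forall>s. gradation \<A> s \<longrightarrow> loop_isomorphism \<A> s (loop_iso \<A> s)) \<and>
     virasoro_elements \<A> \<and> principal_heisenberg \<A>"

definition pos_exponents :: "('a::complex_lie_algebra, 'b::complex_lie_algebra) affine_data \<Rightarrow> (int \<times> nat) set" where
  "pos_exponents \<A> = {j \<in> exponents \<A>. fst j > 0}"


section \<open>Completion in the negative direction\<close>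

text \<open>A (possibly infinite) sum of homogeneous elements is given by its components with respect to
  the principal gradation, a function \<open>int \<Rightarrow> 'a\<close> vanishing at all large degrees. For such functions
  only finitely many terms of the sum defining a component of the bracket are nonzero, and
  similarly for the two series below, as long as \<open>V\<close> has only negative degrees or \<open>ad V\<close> is
  nilpotent on the argument. \<open>Sum_any\<close> is the sum of the nonzero terms.\<close>

definition homogeneous :: "int \<Rightarrow> 'a::complex_lie_algebra \<Rightarrow> int \<Rightarrow> 'a" where
  "homogeneous n x = (\<lambda>m. if m = n then x else 0)"

definition clie :: "(int \<Rightarrow> 'a::complex_lie_algebra) \<Rightarrow> (int \<Rightarrow> 'a) \<Rightarrow> int \<Rightarrow> 'a" where
  "clie X Y = (\<lambda>n. Sum_any (\<lambda>i. lie (X i) (Y (n - i))))"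

text \<open>\<open>exp_ad V X\<close> is \<open>e\<^bsup>ad V\<^esup> X\<close>, and \<open>nabla V W\<close> is the sum of \<open>1 / (m + 1)! (ad V)\<^sup>m W\<close> over all \<open>m\<close>.\<close>

definition exp_ad :: "(int \<Rightarrow> 'a::complex_lie_algebra) \<Rightarrow> (int \<Rightarrow> 'a) \<Rightarrow> int \<Rightarrow> 'a" where
  "exp_ad V X = (\<lambda>n. Sum_any (\<lambda>m. (1 / fact m) *\<^sub>C (clie V ^^ m) X n))"

definition nabla :: "(int \<Rightarrow> 'a::complex_lie_algebra) \<Rightarrow> (int \<Rightarrow> 'a) \<Rightarrow> int \<Rightarrow> 'a" where
  "nabla V W = (\<lambda>n. Sum_any (\<lambda>m. (1 / fact (Suc m)) *\<^sub>C (clie V ^^ m) W n))"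

definition heis_elt :: "('a::complex_lie_algebra, 'b::complex_lie_algebra) affine_data \<Rightarrow> int \<times> nat \<Rightarrow> int \<Rightarrow> 'a" where
  "heis_elt \<A> j = homogeneous (fst j) (heis \<A> j)"

text \<open>The element \<open>d\<^sub>k\<^sup>s\<close> has principal degree \<open>r h k\<close> for every \<open>s\<close>.\<close>

definition vir_elt :: "('a::complex_lie_algebra, 'b::complex_lie_algebra) affine_data \<Rightarrow> (nat \<Rightarrow> nat) \<Rightarrow> int \<Rightarrow> int \<Rightarrow> 'a" where
  "vir_elt \<A> s k = homogeneous (int (period \<A> principal_grad) * k) (virasoro \<A> s k)"

definition Xi :: "('a::complex_lie_algebra, 'b::complex_lie_algebra) affine_data \<Rightarrow> (int \<times> nat \<Rightarrow> complex) \<Rightarrow> int \<Rightarrow> 'a" where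
  "Xi \<A> t = (\<lambda>n. \<Sum>j\<in>{j \<in> pos_exponents \<A>. t j \<noteq> 0 \<and> fst j = n}. t j *\<^sub>C heis \<A> j)"

definition cneg :: "('a::complex_lie_algebra, 'b::complex_lie_algebra) affine_data \<Rightarrow> (nat \<Rightarrow> nat) \<Rightarrow> (int \<Rightarrow> 'a) \<Rightarrow> int \<Rightarrow> 'a" where
  "cneg \<A> s X = (\<lambda>n. neg_proj \<A> s (X n))"

definition cnonneg :: "('a::complex_lie_algebra, 'b::complex_lie_algebra) affine_data \<Rightarrow> (nat \<Rightarrow> nat) \<Rightarrow> (int \<Rightarrow> 'a) \<Rightarrow> int \<Rightarrow> 'a" where
  "cnonneg \<A> s X = (\<lambda>n. nonneg_proj \<A> s (X n))"

definition neg_valued ::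
  "('a::complex_lie_algebra, 'b::complex_lie_algebra) affine_data \<Rightarrow> (nat \<Rightarrow> nat) \<Rightarrow> ('p \<Rightarrow> int \<Rightarrow> 'a) \<Rightarrow> bool" where
  "neg_valued \<A> s V \<longleftrightarrow> (\<forall>p n. V p n \<in> principal_part \<A> n \<inter> neg_space \<A> s)"

definition B_elt ::
  "('a::complex_lie_algebra, 'b::complex_lie_algebra) affine_data \<Rightarrow> (nat \<Rightarrow> nat) \<Rightarrow> int \<Rightarrow>
   (int \<times> nat \<Rightarrow> complex) \<Rightarrow> (int \<Rightarrow> 'a) \<Rightarrow> int \<Rightarrow> 'a" where
  "B_elt \<A> s k t v =
     exp_ad v (exp_ad (- Xi \<A> t) (vir_elt \<A> principal_grad k)) - vir_elt \<A> s k"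

text \<open>Case (I) is \<open>r h\<^sup>s = 1\<close>, Case (II) is \<open>r h\<^sup>s > 1\<close>.\<close>

definition vir_indices :: "('a::complex_lie_algebra, 'b::complex_lie_algebra) affine_data \<Rightarrow> (nat \<Rightarrow> nat) \<Rightarrow> int set" where
  "vir_indices \<A> s = (if period \<A> s = 1 then {-1..} else {0..})"


section \<open>Flows\<close>

text \<open>Functions are defined on a set \<open>'p\<close> of points: this can be the space of all parameters, or the
  phase space of all pairs of a value of \<open>V\<close> and of the times. A flow is a vector field on \<open>'p\<close>,
  given by a curve \<open>\<gamma> p\<close> through each point \<open>p\<close>, and \<open>F'\<close> is the derivative of \<open>F\<close> along the flow
  if every coordinate function of every principal component has this derivative. (The principal
  components take their values in finite-dimensional spaces, so that it does not matter that
  arbitrary linear functionals are used as coordinates.) Different flows are not assumed to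
  commute.\<close>

definition has_flow_derivative ::
  "('p \<Rightarrow> real \<Rightarrow> 'p) \<Rightarrow> ('p \<Rightarrow> int \<Rightarrow> 'a::complex_lie_algebra) \<Rightarrow> ('p \<Rightarrow> int \<Rightarrow> 'a) \<Rightarrow> bool" where
  "has_flow_derivative \<gamma> F F' \<longleftrightarrow> (\<forall>p n \<phi>. linear_functional \<phi> \<longrightarrow>
     ((\<lambda>\<epsilon>. \<phi> (F (\<gamma> p \<epsilon>) n)) has_vector_derivative \<phi> (F' p n)) (at 0))"

text \<open>Along the flow \<open>\<gamma>\<close> the time \<open>t\<^sub>i\<close> changes with constant velocity \<open>w i\<close>.\<close>

definition flow_of_times ::
  "(int \<times> nat) set \<Rightarrow> ('p \<Rightarrow> int \<times> nat \<Rightarrow> complex) \<Rightarrow> ('p \<Rightarrow> real \<Rightarrow> 'p) \<Rightarrow> (int \<times> nat \<Rightarrow> complex) \<Rightarrow> bool" where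
  "flow_of_times J t \<gamma> w \<longleftrightarrow>
     (\<forall>p. \<gamma> p 0 = p \<and> (\<forall>\<^sub>F \<epsilon> in nhds 0. \<forall>i\<in>J. t (\<gamma> p \<epsilon>) i = t p i + of_real \<epsilon> * w i))"

end

theory Submission
  imports Defs
begin

text \<open>Along a flow, \<open>e\<^bsup>ad V\<^esup> X\<close> has derivative \<open>[\<nabla>\<^sub>VV', e\<^bsup>ad V\<^esup> X] + e\<^bsup>ad V\<^esup> X'\<close>, where primes denote
  derivatives and \<open>\<nabla>\<^sub>V\<close> is the series \<open>\<Sum>\<^sub>m (ad V)\<^sup>m / (m + 1)!\<close>. Applied to
  \<open>B + d\<^sup>s = e\<^bsup>ad V\<^esup> e\<^bsup>- ad \<Xi>\<^esup> d\<close>, where the inner exponential has \<open>t\<^sub>j\<close>-derivative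
  \<open>- [\<Lambda>\<^sub>j, e\<^bsup>- ad \<Xi>\<^esup> d]\<close>, this gives the equation for \<open>B\<close>. Let \<open>A\<close> be the negative part of
  \<open>e\<^bsup>ad V\<^esup> \<Lambda>\<^sub>j\<close> and \<open>C\<close> that of \<open>- B\<close>, the values of \<open>\<nabla>\<^sub>V\<close> on the two derivatives of \<open>V\<close>. As bracketing
  with \<open>d\<^sup>s\<close> preserves the nonnegative part, the zero curvature equation
  \<open>\<partial>\<^sub>\<beta>A - \<partial>\<^sub>tC = [C, A]\<close> follows. By the Maurer--Cartan equation, the left side is also
  \<open>[C, A] + \<nabla>\<^sub>V(\<partial>\<^sub>\<beta>\<partial>\<^sub>tV - \<partial>\<^sub>t\<partial>\<^sub>\<beta>V)\<close>, and \<open>\<nabla>\<^sub>V\<close> is injective because \<open>ad V\<close> lowers the principal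
  degree.\<close>

section \<open>Differentiable curves in a Lie algebra\<close>

text \<open>Two gaps separate the formal computation from the hypotheses. A flow derivative is
  tested only by linear functionals, component by component, which by itself gives no product rule
  for the bracket. It does give one for a component confined to a finite-dimensional space, and the
  principal components of \<open>V\<close> are confined in this way. Moreover, no differentiability
  of \<open>Vt\<close> and \<open>V\<beta>\<close> is assumed. Their mixed derivatives have to be
  constructed: the equations for \<open>nabla\<close> are triangular with respect to the principal
  degree, so that a differentiable right side forces a differentiable solution.

  Two different mechanisms make the exponentials finite in each degree. An element that is negative
  for the gradation \<open>s\<close> has only negative principal degrees, by the triangular
  decomposition, and so \<open>ad V\<close> lowers degrees. The element \<open>Xi\<close> has
  positive degrees, but it is exponentiated only on a Virasoro element, where three brackets give
  zero.\<close>

lemma linear_functional_extend: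
  assumes "complex_vector.independent B"
  obtains \<phi> where "linear_functional \<phi>" "\<And>b. b \<in> B \<Longrightarrow> \<phi> b = f b"
proof -
  have "vector_space_pair (scaleC :: complex \<Rightarrow> 'a \<Rightarrow> 'a) ((*) :: complex \<Rightarrow> _)"
    by unfold_locales
  from vector_space_pair.linear_independent_extend[OF this assms, of f] that
  show ?thesis unfolding linear_functional_def by blast
qed

lemma linear_functional_add: "linear_functional \<phi> \<Longrightarrow> \<phi> (x + y) = \<phi> x + \<phi> y"
  and linear_functional_scale: "linear_functional \<phi> \<Longrightarrow> \<phi> (c *\<^sub>C x) = c * \<phi> x"
  unfolding linear_functional_def by (auto simp: Vector_Spaces.linear_iff)

lemma linear_functional_diff: "linear_functional \<phi> \<Longrightarrow> \<phi> (x - y) = \<phi> x - \<phi> y"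
  by (metis linear_functional_add add_diff_cancel_right' diff_add_cancel)

lemma linear_functional_zero: "linear_functional \<phi> \<Longrightarrow> \<phi> 0 = 0"
  using linear_functional_diff[of \<phi> 0 0] by simp

lemma functionals_separate:
  fixes x y :: "'a::complex_lie_algebra"
  assumes "\<And>\<phi>. linear_functional \<phi> \<Longrightarrow> \<phi> x = \<phi> y"
  shows "x = y"
proof (rule ccontr)
  assume "x \<noteq> y"
  then have "complex_vector.independent {x - y}" by simp
  then obtain \<phi> where \<phi>: "linear_functional \<phi>" "\<phi> (x - y) = 1"
    using linear_functional_extend[of "{x - y}" "\<lambda>_. 1"] by auto
  then show False using assms[OF \<phi>(1)] by (simp add: linear_functional_diff)
qed

lemma linear_scaleC_iff:
  "Vector_Spaces.linear scaleC scaleC f \<longleftrightarrow>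
    (\<forall>x y. f (x + y) = f x + f y) \<and> (\<forall>c x. f (c *\<^sub>C x) = c *\<^sub>C f x)"
  for f :: "'a::complex_lie_algebra \<Rightarrow> 'b::complex_lie_algebra"
  by (auto simp: Vector_Spaces.linear_iff complex_vector.vector_space_axioms)

lemma scaleC_zero_left [simp]: "0 *\<^sub>C x = (0::'a::complex_lie_algebra)"
  and scaleC_zero_right [simp]: "a *\<^sub>C 0 = (0::'a::complex_lie_algebra)"
  by (simp_all add: complex_vector.scale_zero_left)

declare scaleC_one [simp]

lemma lie_zero_left [simp]: "lie 0 x = (0::'a::complex_lie_algebra)"
  using lie_add_left[of 0 0 x] by simp

lemma lie_zero_right [simp]: "lie x 0 = (0::'a::complex_lie_algebra)"
  using lie_add_right[of x 0 0] by simp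

lemma lie_minus_left: "lie (- x) y = - lie x (y::'a::complex_lie_algebra)"
  using lie_add_left[of "- x" x y] by (simp add: eq_neg_iff_add_eq_0)

lemma lie_minus_right: "lie x (- y) = - lie x (y::'a::complex_lie_algebra)"
  using lie_add_right[of x "- y" y] by (simp add: eq_neg_iff_add_eq_0)

lemma lie_diff_left: "lie (x - y) z = lie x z - lie y (z::'a::complex_lie_algebra)"
  using lie_add_left[of x "- y" z] by (simp add: lie_minus_left)

lemma lie_antisym: "lie y x = - lie x (y::'a::complex_lie_algebra)"
proof -
  have "lie (x + y) (x + y) = lie x y + lie y x"
    unfolding lie_add_left lie_add_right by (simp add: lie_self)
  then show ?thesis by (simp add: lie_self eq_neg_iff_add_eq_0 add.commute)
qed

lemma lie_derivation: "lie v (lie x y) = lie (lie v x) y + lie x (lie v (y::'a::complex_lie_algebra))"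
proof -
  have "lie x (lie y v) = - lie x (lie v y)" "lie y (lie v x) = - lie (lie v x) y"
    by (metis lie_antisym lie_minus_right, rule lie_antisym)
  then show ?thesis using jacobi[of v x y] by (simp add: algebra_simps)
qed

lemma lie_sum_left: "lie (sum f A) x = (\<Sum>i\<in>A. lie (f i) (x::'a::complex_lie_algebra))"
  by (induction A rule: infinite_finite_induct) (auto simp: lie_add_left)

lemma lie_sum_right: "lie x (sum f A) = (\<Sum>i\<in>A. lie (x::'a::complex_lie_algebra) (f i))"
  by (induction A rule: infinite_finite_induct) (auto simp: lie_add_right)

text \<open>Derivative at \<open>0\<close> of a curve that stays, near \<open>0\<close>, in a finite-dimensional subspace. Unlike
  the coordinatewise derivative, it obeys the product rule for the bracket.\<close>

inductive has_strong_derivative :: "(real \<Rightarrow> 'a::complex_lie_algebra) \<Rightarrow> 'a \<Rightarrow> bool" where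
  line: "(c has_vector_derivative c') (at 0) \<Longrightarrow>
    has_strong_derivative (\<lambda>\<epsilon>. c \<epsilon> *\<^sub>C x) (c' *\<^sub>C x)"
| add: "has_strong_derivative f f' \<Longrightarrow> has_strong_derivative g g' \<Longrightarrow>
    has_strong_derivative (\<lambda>\<epsilon>. f \<epsilon> + g \<epsilon>) (f' + g')"
| cong: "has_strong_derivative f f' \<Longrightarrow> \<forall>\<^sub>F \<epsilon> in nhds 0. f \<epsilon> = g \<epsilon> \<Longrightarrow>
    has_strong_derivative g f'"

lemma has_strong_derivative_functional:
  assumes "has_strong_derivative f f'" "linear_functional \<phi>"
  shows "((\<lambda>\<epsilon>. \<phi> (f \<epsilon>)) has_vector_derivative \<phi> f') (at 0)"
  using assms
proof (induction rule: has_strong_derivative.induct)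
  case (line c c' x)
  then show ?case
    by (simp add: linear_functional_scale)
      (rule has_vector_derivative_mult_left)
next
  case (add f f' g g')
  then show ?case
    by (simp add: linear_functional_add has_vector_derivative_add)
next
  case (cong f f' g)
  have "\<forall>\<^sub>F \<epsilon> in nhds 0. \<epsilon> \<in> UNIV \<longrightarrow> \<phi> (f \<epsilon>) = \<phi> (g \<epsilon>)"
    using cong(2) by (rule eventually_mono) simp
  moreover have "\<phi> (f 0) = \<phi> (g 0)"
    using cong(2) eventually_nhds_x_imp_x by force
  ultimately have "((\<lambda>\<epsilon>. \<phi> (f \<epsilon>)) has_vector_derivative \<phi> f') (at 0) \<longleftrightarrow>
      ((\<lambda>\<epsilon>. \<phi> (g \<epsilon>)) has_vector_derivative \<phi> f') (at 0)"
    by (intro has_vector_derivative_cong_ev) auto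
  then show ?case using cong by simp
qed

lemma has_strong_derivative_unique:
  assumes "has_strong_derivative f f'"
    and "\<And>\<phi>. linear_functional \<phi> \<Longrightarrow> ((\<lambda>\<epsilon>. \<phi> (f \<epsilon>)) has_vector_derivative \<phi> f'') (at 0)"
  shows "f'' = f'"
  by (rule functionals_separate)
    (metis assms has_strong_derivative_functional vector_derivative_unique_at)

lemma has_strong_derivative_const: "has_strong_derivative (\<lambda>_. x) 0"
  using has_strong_derivative.line[of "\<lambda>_. 1" 0 x] by simp

lemma has_strong_derivative_sum:
  assumes "\<And>i. i \<in> I \<Longrightarrow> has_strong_derivative (f i) (f' i)"
  shows "has_strong_derivative (\<lambda>\<epsilon>. \<Sum>i\<in>I. f i \<epsilon>) (\<Sum>i\<in>I. f' i)"
  using assms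
  by (induction I rule: infinite_finite_induct)
    (auto intro: has_strong_derivative.add has_strong_derivative_const)

lemma has_strong_derivative_linear:
  assumes "has_strong_derivative f f'" "Vector_Spaces.linear scaleC scaleC P"
  shows "has_strong_derivative (\<lambda>\<epsilon>. P (f \<epsilon>)) (P f')"
  using assms
proof (induction rule: has_strong_derivative.induct)
  case (line c c' x)
  then show ?case by (auto simp: linear_scaleC_iff intro: has_strong_derivative.line)
next
  case (add f f' g g')
  then show ?case by (auto simp: linear_scaleC_iff intro: has_strong_derivative.add)
next
  case (cong f f' g)
  have "\<forall>\<^sub>F \<epsilon> in nhds 0. P (f \<epsilon>) = P (g \<epsilon>)"
    using cong(2) by (rule eventually_mono) simp
  then show ?case using cong by (blast intro: has_strong_derivative.cong)
qed

text \<open>As the bracket is bilinear, an induction over the construction of each factor reduces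
  the product rule to scalar multiples of two fixed vectors, where it is the product rule for the
  coefficients.\<close>

lemma has_strong_derivative_lie:
  assumes "has_strong_derivative f f'" "has_strong_derivative g g'"
  shows "has_strong_derivative (\<lambda>\<epsilon>. lie (f \<epsilon>) (g \<epsilon>)) (lie f' (g 0) + lie (f 0) g')"
  using assms(1)
proof (induction rule: has_strong_derivative.induct)
  case (line c c' x)
  show ?case
    using assms(2)
  proof (induction rule: has_strong_derivative.induct)
    case (line d d' y)
    have "((\<lambda>\<epsilon>. c \<epsilon> * d \<epsilon>) has_vector_derivative (c 0 * d' + c' * d 0)) (at 0)"
      by (rule has_vector_derivative_mult) (use line \<open>(c has_vector_derivative c') (at 0)\<close> in auto)
    from has_strong_derivative.line[OF this, of "lie x y"] show ?case
      by (simp add: lie_scale_left lie_scale_right scaleC_scaleC scaleC_add_left add.commute mult.commute)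
  next
    case (add f f' g g')
    from has_strong_derivative.add[OF add(3,4)] show ?case
      by (simp add: lie_add_right algebra_simps)
  next
    case (cong f f' g)
    \<comment> \<open>A property that holds eventually in \<open>nhds 0\<close> holds at 0 itself,
      so the curves agree at the point where the product rule evaluates them.\<close>
    have "f 0 = g 0" using cong(2) eventually_nhds_x_imp_x by force
    moreover have "\<forall>\<^sub>F \<epsilon> in nhds 0. lie (c \<epsilon> *\<^sub>C x) (f \<epsilon>) = lie (c \<epsilon> *\<^sub>C x) (g \<epsilon>)"
      using cong(2) by (rule eventually_mono) simp
    ultimately show ?case using has_strong_derivative.cong[OF cong(3)] by simp
  qed
next
  case (add f f' h h')
  from has_strong_derivative.add[OF add(3,4)] show ?case
    by (simp add: lie_add_left algebra_simps)
next
  case (cong f f' h)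
  have "f 0 = h 0" using cong(2) eventually_nhds_x_imp_x by force
  moreover have "\<forall>\<^sub>F \<epsilon> in nhds 0. lie (f \<epsilon>) (g \<epsilon>) = lie (h \<epsilon>) (g \<epsilon>)"
    using cong(2) by (rule eventually_mono) simp
  ultimately show ?case using has_strong_derivative.cong[OF cong(3)] by simp
qed

text \<open>A basis of the span has dual functionals on the whole space, so the curve is a finite
  sum of differentiable coordinates times fixed vectors. This converts the coordinatewise flow
  derivative into one that obeys a product rule.\<close>

lemma has_strong_derivativeI:
  fixes f :: "real \<Rightarrow> 'a::complex_lie_algebra"
  assumes S: "finite S" "\<And>\<epsilon>. f \<epsilon> \<in> complex_vector.span S"
    and weak: "\<And>\<phi>. linear_functional \<phi> \<Longrightarrow> ((\<lambda>\<epsilon>. \<phi> (f \<epsilon>)) has_vector_derivative \<phi> f') (at 0)"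
  shows "has_strong_derivative f f'"
proof -
  obtain B where B: "B \<subseteq> S" "complex_vector.independent B" "S \<subseteq> complex_vector.span B"
    using complex_vector.maximal_independent_subset[of S] by blast
  have "finite B" using B S finite_subset by blast
  have "\<exists>\<phi>. linear_functional \<phi> \<and> (\<forall>b'\<in>B. \<phi> b' = (if b' = b then 1 else 0))" for b
    using linear_functional_extend[OF B(2), of "\<lambda>b'. if b' = b then 1 else 0"] by metis
  then obtain \<phi> where \<phi>: "\<And>b. linear_functional (\<phi> b)"
      "\<And>b b'. b' \<in> B \<Longrightarrow> \<phi> b b' = (if b' = b then 1 else 0)"
    by metis
  have expand: "x = (\<Sum>b\<in>B. \<phi> b x *\<^sub>C b)" if "x \<in> complex_vector.span B" for x
    using that
  proof (induction rule: complex_vector.span_induct_alt)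
    case base
    then show ?case by (simp add: linear_functional_zero[OF \<phi>(1)])
  next
    case (step c x y)
    have "(\<Sum>b\<in>B. \<phi> b (c *\<^sub>C x + y) *\<^sub>C b) = c *\<^sub>C (\<Sum>b\<in>B. \<phi> b x *\<^sub>C b) + y"
      using step(2) by (simp add: linear_functional_add[OF \<phi>(1)] linear_functional_scale[OF \<phi>(1)]
          scaleC_add_left sum.distrib complex_vector.scale_sum_right scaleC_scaleC)
    also have "(\<Sum>b\<in>B. \<phi> b x *\<^sub>C b) = (\<Sum>b\<in>B. if x = b then b else 0)"
      by (rule sum.cong) (auto simp: \<phi>(2)[OF step(1)])
    also have "\<dots> = x"
      using step(1) \<open>finite B\<close> by simp
    finally show ?case by simp
  qed
  have "complex_vector.span S \<subseteq> complex_vector.span B"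
    using B(3) complex_vector.span_minimal complex_vector.subspace_span by blast
  then have f: "f \<epsilon> = (\<Sum>b\<in>B. \<phi> b (f \<epsilon>) *\<^sub>C b)" for \<epsilon>
    using S(2) expand by blast
  have "has_strong_derivative (\<lambda>\<epsilon>. \<Sum>b\<in>B. \<phi> b (f \<epsilon>) *\<^sub>C b) (\<Sum>b\<in>B. \<phi> b f' *\<^sub>C b)"
    by (intro has_strong_derivative_sum has_strong_derivative.line weak \<phi>(1))
  then have *: "has_strong_derivative f (\<Sum>b\<in>B. \<phi> b f' *\<^sub>C b)"
    by (rule has_strong_derivative.cong) (use f in auto)
  \<comment> \<open>The derivative found is a combination of \<open>B\<close>, whereas
    \<open>f'\<close> is a priori any vector; since functionals separate points, the two
    coincide.\<close>
  with has_strong_derivative_unique[OF * weak] show ?thesis by simp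
qed

section \<open>The completed bracket\<close>

lemma sum_fun_apply: "(\<Sum>i\<in>A. f i) x = (\<Sum>i\<in>A. f i x)"
  for f :: "'i \<Rightarrow> 'c \<Rightarrow> 'd::comm_monoid_add"
  by (induction A rule: infinite_finite_induct) auto

definition vanishes_above :: "int \<Rightarrow> (int \<Rightarrow> 'a::zero) \<Rightarrow> bool" where
  "vanishes_above N X \<longleftrightarrow> (\<forall>n>N. X n = 0)"

definition bounded_above :: "(int \<Rightarrow> 'a::zero) \<Rightarrow> bool" where
  "bounded_above X \<longleftrightarrow> (\<exists>N. vanishes_above N X)"

definition cscale :: "complex \<Rightarrow> (int \<Rightarrow> 'a::complex_lie_algebra) \<Rightarrow> int \<Rightarrow> 'a" where
  "cscale c X = (\<lambda>n. c *\<^sub>C X n)"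

lemma cscale_apply: "cscale c X n = c *\<^sub>C X n"
  by (simp add: cscale_def)

lemma vanishes_above_mono: "vanishes_above N X \<Longrightarrow> N \<le> M \<Longrightarrow> vanishes_above M X"
  by (auto simp: vanishes_above_def)

lemma vanishes_above_add:
  "vanishes_above N X \<Longrightarrow> vanishes_above N Y \<Longrightarrow> vanishes_above N (X + (Y :: int \<Rightarrow> 'a::ab_group_add))"
  and vanishes_above_diff:
  "vanishes_above N X \<Longrightarrow> vanishes_above N Y \<Longrightarrow> vanishes_above N (X - Y)"
  and vanishes_above_minus:
  "vanishes_above N X \<Longrightarrow> vanishes_above N (- X)"
  and vanishes_above_zero: "vanishes_above N (0 :: int \<Rightarrow> 'a)"
  by (auto simp: vanishes_above_def)

lemma vanishes_above_cscale: "vanishes_above N X \<Longrightarrow> vanishes_above N (cscale c X)"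
  by (auto simp: vanishes_above_def cscale_def)

lemma vanishes_above_sum:
  "(\<And>i. i \<in> I \<Longrightarrow> vanishes_above N (X i)) \<Longrightarrow> vanishes_above N (\<Sum>i\<in>I. (X i :: int \<Rightarrow> 'a::ab_group_add))"
  by (auto simp: vanishes_above_def sum_fun_apply)

text \<open>A term is nonzero only for \<open>i \<le> N\<close> and \<open>n - i \<le> M\<close>.
  The limits \<open>a\<close> and \<open>b\<close> are left free so that brackets of different
  elements can be written over one common range.\<close>

lemma clie_eq_sum:
  assumes "vanishes_above N X" "vanishes_above M Y" "a \<le> n - M" "N \<le> b"
  shows "clie X Y n = (\<Sum>i\<in>{a..b}. lie (X i) (Y (n - i)))"
  unfolding clie_def
proof (rule Sum_any.expand_superset)
  show "{i. lie (X i) (Y (n - i)) \<noteq> 0} \<subseteq> {a..b}"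
  proof
    fix i assume "i \<in> {i. lie (X i) (Y (n - i)) \<noteq> 0}"
    then have "X i \<noteq> 0" "Y (n - i) \<noteq> 0" by auto
    then have "i \<le> N" "n - i \<le> M"
      using assms(1,2) by (auto simp: vanishes_above_def not_less[symmetric])
    then show "i \<in> {a..b}" using assms(3,4) by auto
  qed
qed simp

lemma vanishes_above_clie:
  assumes "vanishes_above N X" "vanishes_above M Y"
  shows "vanishes_above (N + M) (clie X Y)"
  unfolding vanishes_above_def
proof (intro allI impI)
  fix n assume "N + M < n"
  then show "clie X Y n = 0"
    using clie_eq_sum[OF assms, of "n - M" n N] by simp
qed

lemma bounded_aboveI: "vanishes_above N X \<Longrightarrow> bounded_above X"
  by (auto simp: bounded_above_def)

lemma bounded_above_common:
  assumes "bounded_above X" "bounded_above Y"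
  obtains N where "vanishes_above N X" "vanishes_above N Y"
proof -
  obtain a b where "vanishes_above a X" "vanishes_above b Y"
    using assms by (auto simp: bounded_above_def)
  then show ?thesis using that[of "max a b"] vanishes_above_mono by (metis max.cobounded1 max.cobounded2)
qed

lemma bounded_above_clie: "bounded_above X \<Longrightarrow> bounded_above Y \<Longrightarrow> bounded_above (clie X Y)"
  using vanishes_above_clie unfolding bounded_above_def by blast

lemma bounded_above_add:
  "bounded_above X \<Longrightarrow> bounded_above Y \<Longrightarrow> bounded_above (X + (Y :: int \<Rightarrow> 'a::ab_group_add))"
  by (metis bounded_aboveI bounded_above_common vanishes_above_add)

lemma bounded_above_minus: "bounded_above X \<Longrightarrow> bounded_above (- (X :: int \<Rightarrow> 'a::ab_group_add))"
  by (auto simp: bounded_above_def dest: vanishes_above_minus)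

lemma bounded_above_zero: "bounded_above (0 :: int \<Rightarrow> 'a::ab_group_add)"
  using vanishes_above_zero by (rule bounded_aboveI)

lemma bounded_above_cscale: "bounded_above X \<Longrightarrow> bounded_above (cscale c X)"
  by (auto simp: bounded_above_def dest: vanishes_above_cscale)

lemma bounded_above_sum:
  "(\<And>i. i \<in> I \<Longrightarrow> bounded_above (X i)) \<Longrightarrow> bounded_above (\<Sum>i\<in>I. (X i :: int \<Rightarrow> 'a::ab_group_add))"
  by (induction I rule: infinite_finite_induct) (auto simp: bounded_above_zero bounded_above_add)

lemma bounded_above_funpow:
  "bounded_above V \<Longrightarrow> bounded_above X \<Longrightarrow> bounded_above ((clie V ^^ m) X)"
  by (induction m) (auto intro: bounded_above_clie)

lemmas bounded_above_intros = bounded_above_clie bounded_above_add bounded_above_minus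
  bounded_above_zero bounded_above_cscale bounded_above_sum bounded_above_funpow

lemma clie_antisym:
  assumes "bounded_above X" "bounded_above Y"
  shows "clie Y X = - clie X Y"
proof
  fix n
  obtain N where N: "vanishes_above N X" "vanishes_above N Y"
    using bounded_above_common[OF assms] .
  have "clie Y X n = (\<Sum>i\<in>{n - N..N}. lie (Y i) (X (n - i)))"
    by (rule clie_eq_sum) (use N in auto)
  also have "\<dots> = (\<Sum>i\<in>{n - N..N}. lie (Y (n - i)) (X i))"
    by (rule sum.reindex_bij_witness[of _ "\<lambda>i. n - i" "\<lambda>i. n - i"]) auto
  also have "\<dots> = - (\<Sum>i\<in>{n - N..N}. lie (X i) (Y (n - i)))"
    unfolding sum_negf[symmetric] by (rule sum.cong) (auto intro: lie_antisym)
  also have "\<dots> = - clie X Y n"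
    by (subst clie_eq_sum[where N = N and M = N]) (use N in auto)
  finally show "clie Y X n = (- clie X Y) n" by simp
qed

lemma clie_add_right:
  assumes "bounded_above X" "bounded_above Y" "bounded_above Z"
  shows "clie X (Y + Z) = clie X Y + clie X Z"
proof
  fix n
  obtain M where M: "vanishes_above M Y" "vanishes_above M Z"
    using bounded_above_common[OF assms(2,3)] .
  obtain N where N: "vanishes_above N X" using assms(1) by (auto simp: bounded_above_def)
  note eq = clie_eq_sum[OF N, of M _ "n - M" n N]
  show "clie X (Y + Z) n = (clie X Y + clie X Z) n"
    by (simp add: eq M vanishes_above_add lie_add_right sum.distrib)
qed

lemma clie_cscale_right: "clie X (cscale c Y) = cscale c (clie X Y)"
  if bdd: "bounded_above X" "bounded_above Y"
proof
  fix n
  obtain N where N: "vanishes_above N X" "vanishes_above N Y"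
    using bounded_above_common[OF bdd] .
  note eq = clie_eq_sum[OF N(1), of N _ "n - N" n N]
  have "clie X (cscale c Y) n = (\<Sum>i\<in>{n - N..N}. lie (X i) (cscale c Y (n - i)))"
    by (rule eq) (use N in \<open>auto intro: vanishes_above_cscale\<close>)
  also have "\<dots> = c *\<^sub>C clie X Y n"
    by (simp add: eq N cscale_def lie_scale_right complex_vector.scale_sum_right)
  finally show "clie X (cscale c Y) n = cscale c (clie X Y) n"
    by (simp add: cscale_def)
qed

lemma clie_zero_right [simp]: "clie X 0 = 0"
  by (rule ext) (simp add: clie_def)

lemma clie_zero_left [simp]: "clie 0 X = 0"
  by (rule ext) (simp add: clie_def)

lemma clie_minus_right: "clie X (- Y) = - clie X Y"
  if "bounded_above X" "bounded_above Y"
  using clie_add_right[of X Y "- Y"] that by (simp add: bounded_above_minus eq_neg_iff_add_eq_0 add.commute)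

lemma clie_minus_left: "clie (- X) Y = - clie X Y"
  if "bounded_above X" "bounded_above Y"
  using that by (metis bounded_above_minus clie_antisym clie_minus_right)

lemma clie_add_left:
  assumes "bounded_above X" "bounded_above Y" "bounded_above Z"
  shows "clie (X + Y) Z = clie X Z + clie Y Z"
  using assms clie_add_right[OF assms(3,1,2)]
  by (simp add: clie_antisym[of Z] bounded_above_add)

lemma clie_cscale_left: "clie (cscale c X) Y = cscale c (clie X Y)"
  if "bounded_above X" "bounded_above Y"
proof -
  have "clie (cscale c X) Y = - clie Y (cscale c X)"
    using that by (metis bounded_above_cscale clie_antisym)
  also have "\<dots> = - cscale c (- clie X Y)"
    using that by (metis clie_cscale_right clie_antisym)
  finally show ?thesis by (simp add: cscale_def fun_eq_iff)
qed

lemma clie_sum_right: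
  assumes "bounded_above X" "\<And>i. i \<in> I \<Longrightarrow> bounded_above (Y i)"
  shows "clie X (\<Sum>i\<in>I. Y i) = (\<Sum>i\<in>I. clie X (Y i))"
  using assms(2)
  by (induction I rule: infinite_finite_induct)
    (auto simp: clie_add_right[OF assms(1)] bounded_above_sum)

text \<open>In each degree this is the Jacobi identity, once all three double brackets are written
  over the same finite rectangle of degrees of \<open>V\<close> and \<open>X\<close>.\<close>

lemma clie_derivation:
  assumes "bounded_above V" "bounded_above X" "bounded_above Y"
  shows "clie V (clie X Y) = clie (clie V X) Y + clie X (clie V Y)"
proof
  fix n
  obtain a where a: "vanishes_above a V" using assms(1) by (auto simp: bounded_above_def)
  obtain b where b: "vanishes_above b X" using assms(2) by (auto simp: bounded_above_def)
  obtain c where c: "vanishes_above c Y" using assms(3) by (auto simp: bounded_above_def)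
  let ?I = "{n - b - c..a}" and ?J = "{n - a - c..b}"
  have 1: "clie V (clie X Y) n = (\<Sum>i\<in>?I. \<Sum>j\<in>?J. lie (V i) (lie (X j) (Y (n - i - j))))"
    by (subst clie_eq_sum[OF a vanishes_above_clie[OF b c], of "n - b - c" _ a], simp, simp)
      (rule sum.cong[OF refl], subst clie_eq_sum[OF b c, of "n - a - c" _ b],
        auto simp: lie_sum_right)
  have 2: "clie X (clie V Y) n = (\<Sum>i\<in>?I. \<Sum>j\<in>?J. lie (X j) (lie (V i) (Y (n - i - j))))"
    by (subst clie_eq_sum[OF b vanishes_above_clie[OF a c], of "n - a - c" _ b], simp, simp,
        subst sum.swap)
      (rule sum.cong[OF refl], subst clie_eq_sum[OF a c, of "n - b - c" _ a],
        auto simp: lie_sum_right algebra_simps)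
  have "clie (clie V X) Y n = (\<Sum>m\<in>{n - c..a + b}. \<Sum>i\<in>?I. lie (lie (V i) (X (m - i))) (Y (n - m)))"
    by (subst clie_eq_sum[OF vanishes_above_clie[OF a b] c, of "n - c" _ "a + b"], simp, simp)
      (rule sum.cong[OF refl], subst clie_eq_sum[OF a b, of "n - b - c" _ a],
        auto simp: lie_sum_left)
  also have "\<dots> = (\<Sum>i\<in>?I. \<Sum>m\<in>{n - c..a + b}. lie (lie (V i) (X (m - i))) (Y (n - m)))"
    by (rule sum.swap)
  also have "\<dots> = (\<Sum>i\<in>?I. \<Sum>j\<in>?J. lie (lie (V i) (X j)) (Y (n - i - j)))"
  \<comment> \<open>Substitute \<open>m = i + j\<close>. The two ranges do not match exactly, but an
    unmatched \<open>m\<close> has \<open>m - i > b\<close>, where \<open>X\<close> vanishes, and an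
    unmatched \<open>j\<close> has \<open>n - i - j > c\<close>, where \<open>Y\<close>
    vanishes.\<close>
  proof (rule sum.cong[OF refl])
    fix i assume i: "i \<in> ?I"
    have "X (m - i) = 0" if "m - i \<notin> ?J" "m \<in> {n - c..a + b}" for m
      using that i b by (auto simp: vanishes_above_def)
    moreover have "Y (n - i - j) = 0" if "j + i \<notin> {n - c..a + b}" "j \<in> ?J" for j
      using that i c by (auto simp: vanishes_above_def)
    moreover have "finite {m \<in> {n - c..a + b}. m - i \<notin> ?J}"
      by (rule finite_subset[of _ "{n - c..a + b}"]) auto
    moreover have "finite {j \<in> ?J. j + i \<notin> {n - c..a + b}}"
      by (rule finite_subset[of _ ?J]) auto
    ultimately show "(\<Sum>m\<in>{n - c..a + b}. lie (lie (V i) (X (m - i))) (Y (n - m))) =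
        (\<Sum>j\<in>?J. lie (lie (V i) (X j)) (Y (n - i - j)))"
      by (intro sum.reindex_bij_witness_not_neutral
          [of "{m \<in> {n - c..a + b}. m - i \<notin> ?J}" "{j \<in> ?J. j + i \<notin> {n - c..a + b}}" _
            "\<lambda>j. j + i" "\<lambda>m. m - i"])
        (auto simp: algebra_simps)
  qed
  finally have 3: "clie (clie V X) Y n = (\<Sum>i\<in>?I. \<Sum>j\<in>?J. lie (lie (V i) (X j)) (Y (n - i - j)))" .
  show "clie V (clie X Y) n = (clie (clie V X) Y + clie X (clie V Y)) n"
    unfolding plus_fun_apply 1 2 3 sum.distrib[symmetric]
    by (intro sum.cong refl lie_derivation)
qed

section \<open>Series in \<open>ad V\<close> for \<open>V\<close> of negative degree\<close>

lemma vanishes_above_funpow: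
  assumes "vanishes_above (-1) V" "vanishes_above N X"
  shows "vanishes_above (N - int m) ((clie V ^^ m) X)"
proof (induction m)
  case (Suc m)
  from vanishes_above_clie[OF assms(1) this] show ?case
    by (simp add: algebra_simps)
qed (use assms in simp)

lemma clie_funpow_add:
  "bounded_above V \<Longrightarrow> bounded_above X \<Longrightarrow> bounded_above Y \<Longrightarrow>
    (clie V ^^ m) (X + Y) = (clie V ^^ m) X + (clie V ^^ m) Y"
  by (induction m) (auto simp: clie_add_right bounded_above_funpow)

text \<open>The pattern of a series in \<open>ad V\<close> with \<open>V\<close> in negative
  degrees: the bound drops by one with every term, so only finitely many terms meet a given
  degree.\<close>

definition falling :: "int \<Rightarrow> (nat \<Rightarrow> int \<Rightarrow> 'a::zero) \<Rightarrow> bool" where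
  "falling N F \<longleftrightarrow> (\<forall>m. vanishes_above (N - int m) (F m))"

definition graded_sum :: "(nat \<Rightarrow> int \<Rightarrow> 'a::comm_monoid_add) \<Rightarrow> int \<Rightarrow> 'a" where
  "graded_sum F = (\<lambda>n. Sum_any (\<lambda>m. F m n))"

lemma exp_ad_graded_sum: "exp_ad V X = graded_sum (\<lambda>m. cscale (1 / fact m) ((clie V ^^ m) X))"
  and nabla_graded_sum: "nabla V X = graded_sum (\<lambda>m. cscale (1 / fact (Suc m)) ((clie V ^^ m) X))"
  by (simp_all add: exp_ad_def nabla_def graded_sum_def cscale_def)

lemma graded_sum_eq:
  assumes "falling N F" "N - n < int K"
  shows "graded_sum F n = (\<Sum>m<K. F m n)"
  unfolding graded_sum_def
proof (rule Sum_any.expand_superset)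
  show "{m. F m n \<noteq> 0} \<subseteq> {..<K}"
    using assms by (force simp: falling_def vanishes_above_def)
qed simp

lemma vanishes_above_graded_sum: "falling N F \<Longrightarrow> vanishes_above N (graded_sum F)"
  unfolding vanishes_above_def using graded_sum_eq[of N F _ 0] by auto

lemma graded_sum_add:
  assumes "falling N F" "falling N G"
  shows "graded_sum (\<lambda>m. F m + G m) = graded_sum F + graded_sum G"
proof
  fix n
  obtain K :: nat where K: "N - n < int K" using that[of "nat (N - n) + 1"] by simp
  have "falling N (\<lambda>m. F m + G m)"
    using assms by (simp add: falling_def vanishes_above_def)
  with assms K show "graded_sum (\<lambda>m. F m + G m) n = (graded_sum F + graded_sum G) n"
    by (simp add: graded_sum_eq sum.distrib)
qed

lemma graded_sum_minus: "graded_sum (\<lambda>m. - F m) = - graded_sum F" if "falling N F"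
  for F :: "nat \<Rightarrow> int \<Rightarrow> 'a::ab_group_add"
proof
  fix n
  have "falling N (\<lambda>m. - F m)"
    using that by (simp add: falling_def vanishes_above_def)
  with that show "graded_sum (\<lambda>m. - F m) n = (- graded_sum F) n"
    using graded_sum_eq[of N F n "nat (N - n) + 1"] graded_sum_eq[of N "\<lambda>m. - F m" n "nat (N - n) + 1"]
    by (simp add: sum_negf)
qed

lemma graded_sum_Suc:
  assumes "falling N F"
  shows "graded_sum F = F 0 + graded_sum (\<lambda>m. F (Suc m))"
proof
  fix n
  let ?K = "nat (N - n) + 1"
  have "falling N (\<lambda>m. F (Suc m))"
    using assms unfolding falling_def vanishes_above_def by auto
  then show "graded_sum F n = (F 0 + graded_sum (\<lambda>m. F (Suc m))) n"
    using graded_sum_eq[OF assms, of n "Suc ?K"] graded_sum_eq[of N "\<lambda>m. F (Suc m)" n ?K]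
    by (simp add: sum.lessThan_Suc_shift del: sum.lessThan_Suc)
qed

text \<open>The Cauchy product: in a fixed degree \<open>n\<close> both sums can be cut at a common
  \<open>K\<close>, and the product of the truncated sums is regrouped along antidiagonals.\<close>

lemma clie_graded_sum:
  assumes "falling N F" "falling M G"
  shows "clie (graded_sum F) (graded_sum G) = graded_sum (\<lambda>m. \<Sum>i\<le>m. clie (F i) (G (m - i)))"
proof
  fix n
  define K where "K = nat (N + M - n) + 1"
  have K: "N + M - n < int K" by (simp add: K_def)
  have van: "vanishes_above (N - int i) (F i)" "vanishes_above (M - int i) (G i)" for i
    using assms by (auto simp: falling_def)
  have van': "vanishes_above (N + M - int (i + j)) (clie (F i) (G j))" for i j
    using vanishes_above_clie[OF van(1)[of i] van(2)[of j]] by (simp add: algebra_simps)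
  have fall: "falling (N + M) (\<lambda>m. \<Sum>i\<le>m. clie (F i) (G (m - i)))"
    unfolding falling_def
  proof (intro allI vanishes_above_sum)
    fix m i :: nat assume "i \<in> {..m}"
    with van'[of i "m - i"] show "vanishes_above (N + M - int m) (clie (F i) (G (m - i)))" by simp
  qed
  have van0: "vanishes_above N (F i)" "vanishes_above M (G i)" for i
    by (rule vanishes_above_mono[OF van(1)], simp, rule vanishes_above_mono[OF van(2)], simp)
  have "clie (graded_sum F) (graded_sum G) n =
      (\<Sum>i\<in>{n - M..N}. lie (graded_sum F i) (graded_sum G (n - i)))"
    by (rule clie_eq_sum) (use assms vanishes_above_graded_sum in auto)
  also have "\<dots> = (\<Sum>i\<in>{n - M..N}. \<Sum>a<K. \<Sum>b<K. lie (F a i) (G b (n - i)))"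
  proof (rule sum.cong[OF refl])
    fix i assume "i \<in> {n - M..N}"
    then have "graded_sum F i = (\<Sum>a<K. F a i)" "graded_sum G (n - i) = (\<Sum>b<K. G b (n - i))"
      using K by (auto intro!: graded_sum_eq assms)
    then show "lie (graded_sum F i) (graded_sum G (n - i)) = (\<Sum>a<K. \<Sum>b<K. lie (F a i) (G b (n - i)))"
      by (simp add: lie_sum_left lie_sum_right) (rule sum.swap)
  qed
  also have "\<dots> = (\<Sum>a<K. \<Sum>b<K. \<Sum>i\<in>{n - M..N}. lie (F a i) (G b (n - i)))"
    by (subst sum.swap, rule sum.cong[OF refl], rule sum.swap)
  also have "\<dots> = (\<Sum>a<K. \<Sum>b<K. clie (F a) (G b) n)"
    by (intro sum.cong refl clie_eq_sum[symmetric]) (use van0 in auto)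
  also have "\<dots> = (\<Sum>(a, b)\<in>{..<K} \<times> {..<K}. clie (F a) (G b) n)"
    by (rule sum.cartesian_product)
  \<comment> \<open>By the choice of \<open>K\<close>, brackets with \<open>K \<le> a + b\<close>
    live only in degrees below \<open>n\<close>, so the square can be cut down to a
    triangle.\<close>
  also have "\<dots> = (\<Sum>(a, b)\<in>{(a, b). a + b < K}. clie (F a) (G b) n)"
  proof (rule sum.mono_neutral_right)
    show "\<forall>x\<in>{..<K} \<times> {..<K} - {(a, b). a + b < K}. (case x of (a, b) \<Rightarrow> clie (F a) (G b) n) = 0"
    proof
      fix x assume "x \<in> {..<K} \<times> {..<K} - {(a, b). a + b < K}"
      then obtain a b where x: "x = (a, b)" "K \<le> a + b" by (cases x) auto
      then have "N + M - int (a + b) < n" using K by linarith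
      with van'[of a b] x show "(case x of (a, b) \<Rightarrow> clie (F a) (G b) n) = 0"
        by (simp add: vanishes_above_def)
    qed
  qed auto
  also have "\<dots> = (\<Sum>m<K. \<Sum>i\<le>m. clie (F i) (G (m - i)) n)"
    by (rule sum.triangle_reindex)
  also have "\<dots> = graded_sum (\<lambda>m. \<Sum>i\<le>m. clie (F i) (G (m - i))) n"
    using graded_sum_eq[OF fall K] by (simp add: sum_fun_apply)
  finally show "clie (graded_sum F) (graded_sum G) n = graded_sum (\<lambda>m. \<Sum>i\<le>m. clie (F i) (G (m - i))) n" .
qed

lemma falling_funpow:
  "vanishes_above (-1) V \<Longrightarrow> vanishes_above N X \<Longrightarrow> falling N (\<lambda>m. cscale (c m) ((clie V ^^ m) X))"
  by (simp add: falling_def vanishes_above_cscale vanishes_above_funpow)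

lemma vanishes_above_exp_ad:
  "vanishes_above (-1) V \<Longrightarrow> vanishes_above N X \<Longrightarrow> vanishes_above N (exp_ad V X)"
  unfolding exp_ad_graded_sum by (intro vanishes_above_graded_sum falling_funpow)

lemma vanishes_above_nabla:
  "vanishes_above (-1) V \<Longrightarrow> vanishes_above N X \<Longrightarrow> vanishes_above N (nabla V X)"
  unfolding nabla_graded_sum by (intro vanishes_above_graded_sum falling_funpow)

lemma cscale_add: "cscale c (X + Y) = cscale c X + cscale c Y"
  and cscale_cscale: "cscale c (cscale d X) = cscale (c * d) X"
  and cscale_add_left: "cscale (c + d) X = cscale c X + cscale d X"
  and cscale_one: "cscale 1 X = X"
  and cscale_zero: "cscale c 0 = 0"
  and cscale_minus: "cscale c (- X) = - cscale c X"
  by (simp_all add: cscale_def fun_eq_iff scaleC_add_right scaleC_scaleC scaleC_add_left)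

lemma cscale_sum: "cscale c (\<Sum>i\<in>I. X i) = (\<Sum>i\<in>I. cscale c (X i))"
  by (simp add: fun_eq_iff cscale_apply sum_fun_apply complex_vector.scale_sum_right)

lemma exp_ad_add:
  assumes "vanishes_above (-1) V" "vanishes_above N X" "vanishes_above N Y"
  shows "exp_ad V (X + Y) = exp_ad V X + exp_ad V Y"
proof -
  have "bounded_above V" "bounded_above X" "bounded_above Y" using assms bounded_aboveI by auto
  then show ?thesis
    unfolding exp_ad_graded_sum
    by (subst graded_sum_add[symmetric, OF falling_funpow falling_funpow])
      (use assms in \<open>auto simp: clie_funpow_add cscale_add\<close>)
qed

lemma nabla_add:
  assumes "vanishes_above (-1) V" "vanishes_above N X" "vanishes_above N Y"
  shows "nabla V (X + Y) = nabla V X + nabla V Y"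
proof -
  have "bounded_above V" "bounded_above X" "bounded_above Y" using assms bounded_aboveI by auto
  then show ?thesis
    unfolding nabla_graded_sum
    by (subst graded_sum_add[symmetric, OF falling_funpow falling_funpow])
      (use assms in \<open>auto simp: clie_funpow_add cscale_add\<close>)
qed

lemma nabla_diff:
  assumes "vanishes_above (-1) V" "vanishes_above N X" "vanishes_above N Y"
  shows "nabla V (X - Y) = nabla V X - nabla V Y"
  using nabla_add[OF assms(1), of N "X - Y" Y] assms by (simp add: vanishes_above_diff)

text \<open>Only the term \<open>m = 0\<close>, which is \<open>X\<close> itself, reaches the top
  degree; every application of \<open>clie V\<close> lowers the bound.\<close>

lemma nabla_top:
  assumes "vanishes_above (-1) V" "vanishes_above n X"
  shows "nabla V X n = X n"
  unfolding nabla_graded_sum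
  by (subst graded_sum_eq[OF falling_funpow[OF assms], of n 1]) (auto simp: cscale_apply)

text \<open>By \<open>nabla_top\<close> the component in the highest admissible degree vanishes,
  which improves the bound by one; repeating this reaches every degree.\<close>

lemma nabla_eq_zero:
  assumes "vanishes_above (-1) V" "vanishes_above N X" "nabla V X = 0"
  shows "X = 0"
proof -
  have van: "vanishes_above (N - int i) X" for i
  proof (induction i)
    case (Suc i)
    have "X (N - int i) = 0" using nabla_top[OF assms(1) Suc] assms(3) by simp
    moreover have "n = N - int i \<or> n > N - int i" if "n > N - int (Suc i)" for n
      using that by auto
    ultimately show ?case
      using Suc unfolding vanishes_above_def by blast
  qed (use assms in simp)
  have "X n = 0" for n
  proof -
    have "N - int (nat (N - n) + 1) < n" by simp
    then show ?thesis
      using van[of "nat (N - n) + 1"] unfolding vanishes_above_def by blast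
  qed
  then show ?thesis by (simp add: fun_eq_iff)
qed

section \<open>Derivatives of the exponential series\<close>

text \<open>The derivative of the power \<open>Suc m\<close> of \<open>ad V\<close> on
  \<open>Y\<close> when \<open>V\<close> moves in direction \<open>X\<close>, that is, the sum over
  \<open>p \<le> m\<close> of \<open>(clie V ^^ p) (clie X ((clie V ^^ (m - p)) Y))\<close>.
  Expanding by Leibniz' rule, the coefficient is the sum of \<open>p choose i\<close> over
  \<open>p \<le> m\<close>, which is \<open>Suc m choose Suc i\<close>.\<close>

definition bracket_sum ::
  "(int \<Rightarrow> 'a::complex_lie_algebra) \<Rightarrow> nat \<Rightarrow> (int \<Rightarrow> 'a) \<Rightarrow> (int \<Rightarrow> 'a) \<Rightarrow> int \<Rightarrow> 'a" where
  "bracket_sum V m X Y = (\<Sum>i\<le>m. cscale (of_nat (Suc m choose Suc i))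
     (clie ((clie V ^^ i) X) ((clie V ^^ (m - i)) Y)))"

text \<open>The product rule for one further factor \<open>ad V\<close>: either one of the inner
  factors is varied or the outermost one. On the coefficients this is Pascal's rule.\<close>

lemma bracket_sum_Suc:
  assumes "bounded_above V" "bounded_above X" "bounded_above Y"
  shows "bracket_sum V (Suc m) X Y =
    clie V (bracket_sum V m X Y) + clie X ((clie V ^^ Suc m) Y)"
proof -
  define b where "b i j = clie ((clie V ^^ i) X) ((clie V ^^ j) Y)" for i j
  note bd = assms bounded_above_funpow[OF assms(1)] bounded_above_clie bounded_above_cscale
  have b: "clie V (b i j) = b (Suc i) j + b i (Suc j)" for i j
    unfolding b_def by (subst clie_derivation) (auto intro: bd)
  have "clie V (bracket_sum V m X Y) =
      (\<Sum>i\<le>m. cscale (of_nat (Suc m choose Suc i)) (clie V (b i (m - i))))"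
    unfolding bracket_sum_def b_def[symmetric]
    by (subst clie_sum_right) (auto intro!: bd clie_cscale_right simp: b_def clie_cscale_right bd)
  also have "\<dots> = (\<Sum>i\<le>m. cscale (of_nat (Suc m choose Suc i)) (b (Suc i) (m - i))) +
      (\<Sum>i\<le>m. cscale (of_nat (Suc m choose Suc i)) (b i (Suc m - i)))"
    unfolding b cscale_add sum.distrib
    by (intro arg_cong2[where f = "(+)"] sum.cong) (auto simp: Suc_diff_le)
  finally have 1: "clie V (bracket_sum V m X Y) + b 0 (Suc m) =
      ((\<Sum>i\<le>m. cscale (of_nat (Suc m choose Suc i)) (b (Suc i) (m - i))) + b 0 (Suc m)) +
      (\<Sum>i\<le>m. cscale (of_nat (Suc m choose Suc i)) (b i (Suc m - i)))"
    by (simp add: algebra_simps)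
  have 2: "(\<Sum>i\<le>Suc m. cscale (of_nat (Suc m choose i)) (b i (Suc m - i))) =
      (\<Sum>i\<le>m. cscale (of_nat (Suc m choose Suc i)) (b (Suc i) (m - i))) + b 0 (Suc m)"
    by (subst sum.atMost_Suc_shift) (simp add: cscale_one add.commute del: binomial_Suc_Suc)
  \<comment> \<open>The added term \<open>i = Suc m\<close> has binomial coefficient 0, which gives
    this sum the same range as the one in the previous step.\<close>
  have 3: "(\<Sum>i\<le>Suc m. cscale (of_nat (Suc m choose Suc i)) (b i (Suc m - i))) =
      (\<Sum>i\<le>m. cscale (of_nat (Suc m choose Suc i)) (b i (Suc m - i)))"
    by (simp add: cscale_def zero_fun_def binomial_eq_0 del: binomial_Suc_Suc)
  have "bracket_sum V (Suc m) X Y =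
      (\<Sum>i\<le>Suc m. cscale (of_nat (Suc m choose i)) (b i (Suc m - i))) +
      (\<Sum>i\<le>Suc m. cscale (of_nat (Suc m choose Suc i)) (b i (Suc m - i)))"
    unfolding bracket_sum_def b_def[symmetric] sum.distrib[symmetric] cscale_add_left[symmetric]
      of_nat_add[symmetric]
    by (rule sum.cong[OF refl]) simp
  with 1 2 3 show ?thesis by (simp add: b_def)
qed

lemma vanishes_above_bracket_sum:
  assumes "vanishes_above (-1) V" "vanishes_above N X" "vanishes_above M Y"
  shows "vanishes_above (N + M - int m) (bracket_sum V m X Y)"
  unfolding bracket_sum_def
proof (intro vanishes_above_sum vanishes_above_cscale)
  fix i assume "i \<in> {..m}"
  with vanishes_above_clie[OF vanishes_above_funpow[OF assms(1,2), of i]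
      vanishes_above_funpow[OF assms(1,3), of "m - i"]]
  show "vanishes_above (N + M - int m) (clie ((clie V ^^ i) X) ((clie V ^^ (m - i)) Y))"
    by (simp add: of_nat_diff algebra_simps)
qed

lemma binomial_inverse_fact:
  assumes "i \<le> m"
  shows "1 / fact (Suc m) * of_nat (Suc m choose Suc i) = 1 / fact (Suc i) * (1 / fact (m - i) :: complex)"
  using binomial_fact[of "Suc i" "Suc m", where 'a = complex] assms
  by (simp add: field_simps del: fact_Suc binomial_Suc_Suc of_nat_binomial_eq_mult_binomial_Suc)

text \<open>By \<open>binomial_inverse_fact\<close> the coefficients are those of the Cauchy product
  of the two series. With \<open>bracket_sum\<close> read as a derivative, the right side is the
  variation of \<open>exp_ad V X\<close> when \<open>V\<close> moves in direction
  \<open>W\<close>.\<close>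

lemma clie_nabla_exp_ad:
  assumes "vanishes_above (-1) V" "vanishes_above N W" "vanishes_above M X"
  shows "clie (nabla V W) (exp_ad V X) =
    graded_sum (\<lambda>m. cscale (1 / fact (Suc m)) (bracket_sum V m W X))"
proof -
  have bd: "bounded_above V" "bounded_above W" "bounded_above X"
    using assms by (auto intro: bounded_aboveI)
  show ?thesis
    unfolding nabla_graded_sum exp_ad_graded_sum
    by (subst clie_graded_sum[OF falling_funpow[OF assms(1,2)] falling_funpow[OF assms(1,3)]],
        intro arg_cong[where f = graded_sum], rule ext)
      (auto simp: bracket_sum_def cscale_sum clie_cscale_left clie_cscale_right bd
        bounded_above_intros cscale_cscale binomial_inverse_fact mult.commute simp del: fact_Suc
        binomial_Suc_Suc times_divide_eq_left times_divide_eq_right times_divide_times_eq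
        intro!: sum.cong)
qed

text \<open>The variation of \<open>nabla V Y\<close> when \<open>V\<close> moves in direction
  \<open>X\<close>: the power \<open>Suc m\<close> of \<open>ad V\<close> carries the coefficient
  \<open>1 / fact (Suc (Suc m))\<close>, and the power 0 does not depend on
  \<open>V\<close>.\<close>

definition nabla_deriv ::
  "(int \<Rightarrow> 'a::complex_lie_algebra) \<Rightarrow> (int \<Rightarrow> 'a) \<Rightarrow> (int \<Rightarrow> 'a) \<Rightarrow> int \<Rightarrow> 'a" where
  "nabla_deriv V X Y = graded_sum (\<lambda>m. cscale (1 / fact (Suc (Suc m))) (bracket_sum V m X Y))"

text \<open>The Maurer--Cartan equation: the coefficients of \<open>[ad\<^sup>i X, ad\<^sup>j Y]\<close> with \<open>i + j = m\<close> add up to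
  \<open>((m + 1 choose i + 1) + (m + 1 choose i)) / (m + 2)! = 1 / ((i + 1)! (j + 1)!)\<close>.\<close>

lemma nabla_deriv_antisym:
  assumes "vanishes_above (-1) V" "vanishes_above N X" "vanishes_above M Y"
  shows "nabla_deriv V X Y - nabla_deriv V Y X = clie (nabla V X) (nabla V Y)"
proof -
  have bd: "bounded_above V" "bounded_above X" "bounded_above Y"
    using assms by (auto intro: bounded_aboveI)
  define b where "b i j = clie ((clie V ^^ i) X) ((clie V ^^ j) Y)" for i j
  have b: "clie ((clie V ^^ i) Y) ((clie V ^^ j) X) = - b j i" for i j
    unfolding b_def by (rule clie_antisym) (auto intro: bounded_above_intros bd)
  have fallX: "falling (N + M) (\<lambda>m. cscale (c m) (bracket_sum V m X Y))" for c
    using assms by (auto simp: falling_def intro: vanishes_above_cscale vanishes_above_bracket_sum)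
  have fallY: "falling (N + M) (\<lambda>m. cscale (c m) (bracket_sum V m Y X))" for c
    using assms vanishes_above_bracket_sum[OF assms(1,3,2)]
    by (auto simp: falling_def add.commute intro: vanishes_above_cscale)
  have key: "bracket_sum V m X Y - bracket_sum V m Y X =
      (\<Sum>i\<le>m. cscale (of_nat (Suc (Suc m) choose Suc i)) (b i (m - i)))" for m
  proof -
    have "bracket_sum V m Y X = (\<Sum>i\<le>m. cscale (of_nat (Suc m choose Suc i)) (- b (m - i) i))"
      unfolding bracket_sum_def b ..
    \<comment> \<open>Replacing \<open>i\<close> by \<open>m - i\<close> turns
      \<open>Suc m choose Suc i\<close> into \<open>Suc m choose Suc (m - i)\<close>, which equals
      \<open>Suc m choose i\<close>; Pascal's rule can then merge the two sums.\<close>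
    also have "\<dots> = (\<Sum>i\<le>m. cscale (of_nat (Suc m choose i)) (- b i (m - i)))"
      by (rule sum.reindex_bij_witness[of _ "\<lambda>i. m - i" "\<lambda>i. m - i"])
        (auto simp: binomial_symmetric[of "Suc _" "Suc m"] simp del: binomial_Suc_Suc)
    finally have "bracket_sum V m X Y - bracket_sum V m Y X =
        (\<Sum>i\<le>m. cscale (of_nat (Suc m choose Suc i)) (b i (m - i))) +
        (\<Sum>i\<le>m. cscale (of_nat (Suc m choose i)) (b i (m - i)))"
      unfolding bracket_sum_def b_def[symmetric] by (simp add: cscale_minus sum_negf)
    then show ?thesis
      unfolding sum.distrib[symmetric] cscale_add_left[symmetric] of_nat_add[symmetric]
      by (simp add: add.commute)
  qed
  have coeff: "(of_nat (Suc (Suc m) choose Suc i) / fact (Suc (Suc m)) :: complex) =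
      1 / fact (Suc i) * (1 / fact (Suc (m - i)))" if "i \<le> m" for i m
    using binomial_inverse_fact[of i "Suc m"] that by (simp add: Suc_diff_le)
  have "nabla_deriv V X Y - nabla_deriv V Y X =
      graded_sum (\<lambda>m. cscale (1 / fact (Suc (Suc m))) (bracket_sum V m X Y)) +
      graded_sum (\<lambda>m. - cscale (1 / fact (Suc (Suc m))) (bracket_sum V m Y X))"
    unfolding nabla_deriv_def by (subst graded_sum_minus[OF fallY]) simp
  also have "\<dots> = graded_sum (\<lambda>m. cscale (1 / fact (Suc (Suc m))) (bracket_sum V m X Y) +
      - cscale (1 / fact (Suc (Suc m))) (bracket_sum V m Y X))"
  proof (rule graded_sum_add[symmetric, OF fallX])
    show "falling (N + M) (\<lambda>m. - cscale (1 / fact (Suc (Suc m))) (bracket_sum V m Y X))"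
      using fallY[of "\<lambda>m. - (1 / fact (Suc (Suc m)))"]
      by (simp add: cscale_def fun_Compl_def)
  qed
  also have "\<dots> = graded_sum (\<lambda>m. \<Sum>i\<le>m. cscale (1 / fact (Suc i) * (1 / fact (Suc (m - i)))) (b i (m - i)))"
  proof (intro arg_cong[where f = graded_sum] ext)
    fix m n
    have "cscale (1 / fact (Suc (Suc m))) (bracket_sum V m X Y) +
        - cscale (1 / fact (Suc (Suc m))) (bracket_sum V m Y X) =
        cscale (1 / fact (Suc (Suc m))) (bracket_sum V m X Y - bracket_sum V m Y X)"
      unfolding diff_conv_add_uminus cscale_add cscale_minus ..
    also have "\<dots> = (\<Sum>i\<le>m. cscale (1 / fact (Suc i) * (1 / fact (Suc (m - i)))) (b i (m - i)))"
      unfolding key cscale_sum cscale_cscale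
      by (intro sum.cong refl arg_cong2[where f = cscale]) (use coeff in auto)
    finally show "(cscale (1 / fact (Suc (Suc m))) (bracket_sum V m X Y) +
        - cscale (1 / fact (Suc (Suc m))) (bracket_sum V m Y X)) n =
      (\<Sum>i\<le>m. cscale (1 / fact (Suc i) * (1 / fact (Suc (m - i)))) (b i (m - i))) n"
      by simp
  qed
  also have "\<dots> = clie (nabla V X) (nabla V Y)"
    unfolding nabla_graded_sum
    by (subst clie_graded_sum[OF falling_funpow[OF assms(1,2)] falling_funpow[OF assms(1,3)]])
      (simp add: clie_cscale_left clie_cscale_right bd bounded_above_intros cscale_cscale b_def
        mult.commute del: fact_Suc)
  finally show ?thesis .
qed

text \<open>Componentwise derivatives together with one bound on the degrees for all small
  \<epsilon>. The bound turns each component of a bracket or of a series into a finite sum over a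
  fixed range near 0, which can be differentiated termwise.\<close>

definition has_curve_derivative ::
  "int \<Rightarrow> (real \<Rightarrow> int \<Rightarrow> 'a::complex_lie_algebra) \<Rightarrow> (int \<Rightarrow> 'a) \<Rightarrow> bool" where
  "has_curve_derivative N F F' \<longleftrightarrow>
     (\<forall>n. has_strong_derivative (\<lambda>\<epsilon>. F \<epsilon> n) (F' n)) \<and>
     (\<forall>\<^sub>F \<epsilon> in nhds 0. vanishes_above N (F \<epsilon>))"

lemma has_curve_derivative_vanishes:
  assumes "has_curve_derivative N F F'"
  shows "vanishes_above N (F 0)" "vanishes_above N F'"
proof -
  show "vanishes_above N (F 0)"
    using assms eventually_nhds_x_imp_x[of "\<lambda>\<epsilon>. vanishes_above N (F \<epsilon>)" 0]
    by (simp add: has_curve_derivative_def)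
  have "F' n = 0" if "n > N" for n
  proof -
    have "\<forall>\<^sub>F \<epsilon> in nhds 0. F \<epsilon> n = 0"
      using assms that unfolding has_curve_derivative_def vanishes_above_def
      by (auto elim: eventually_mono)
    then have "has_strong_derivative (\<lambda>\<epsilon>. 0) (F' n)"
      using assms has_strong_derivative.cong[of "\<lambda>\<epsilon>. F \<epsilon> n"] by (simp add: has_curve_derivative_def)
    then have "0 = F' n"
      by (rule has_strong_derivative_unique)
        (rule has_strong_derivative_functional[OF has_strong_derivative_const])
    then show ?thesis by simp
  qed
  then show "vanishes_above N F'" by (simp add: vanishes_above_def)
qed

lemma has_curve_derivative_eq:
  "has_curve_derivative N F F' \<Longrightarrow> F' = G' \<Longrightarrow> has_curve_derivative N F G'"
  by simp

lemma has_curve_derivative_unique: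
  assumes "has_curve_derivative N F F'" "has_curve_derivative M F F''"
  shows "F' = F''"
proof
  fix n
  have "has_strong_derivative (\<lambda>\<epsilon>. F \<epsilon> n) (F' n)" "has_strong_derivative (\<lambda>\<epsilon>. F \<epsilon> n) (F'' n)"
    using assms by (simp_all add: has_curve_derivative_def)
  then show "F' n = F'' n"
    by (intro has_strong_derivative_unique has_strong_derivative_functional)
qed

lemma has_curve_derivative_cong:
  assumes "has_curve_derivative N F F'" "\<forall>\<^sub>F \<epsilon> in nhds 0. F \<epsilon> = G \<epsilon>"
  shows "has_curve_derivative N G F'"
proof -
  have "has_strong_derivative (\<lambda>\<epsilon>. G \<epsilon> n) (F' n)" for n
  proof (rule has_strong_derivative.cong)
    show "has_strong_derivative (\<lambda>\<epsilon>. F \<epsilon> n) (F' n)"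
      using assms(1) by (simp add: has_curve_derivative_def)
    show "\<forall>\<^sub>F \<epsilon> in nhds 0. F \<epsilon> n = G \<epsilon> n"
      using assms(2) by (rule eventually_mono) simp
  qed
  moreover have "\<forall>\<^sub>F \<epsilon> in nhds 0. vanishes_above N (G \<epsilon>)"
  proof -
    have "\<forall>\<^sub>F \<epsilon> in nhds 0. vanishes_above N (F \<epsilon>)"
      using assms(1) by (simp add: has_curve_derivative_def)
    from this assms(2) show ?thesis by (rule eventually_elim2) simp
  qed
  ultimately show ?thesis by (simp add: has_curve_derivative_def)
qed

lemma has_curve_derivative_mono:
  "has_curve_derivative N F F' \<Longrightarrow> N \<le> M \<Longrightarrow> has_curve_derivative M F F'"
  unfolding has_curve_derivative_def by (auto elim: eventually_mono vanishes_above_mono)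

lemma has_curve_derivative_const: "vanishes_above N X \<Longrightarrow> has_curve_derivative N (\<lambda>_. X) 0"
  by (simp add: has_curve_derivative_def has_strong_derivative_const)

lemma has_curve_derivative_add:
  assumes "has_curve_derivative N F F'" "has_curve_derivative N G G'"
  shows "has_curve_derivative N (\<lambda>\<epsilon>. F \<epsilon> + G \<epsilon>) (F' + G')"
proof -
  have "\<forall>\<^sub>F \<epsilon> in nhds 0. vanishes_above N (F \<epsilon>)" "\<forall>\<^sub>F \<epsilon> in nhds 0. vanishes_above N (G \<epsilon>)"
    using assms by (simp_all add: has_curve_derivative_def)
  then have "\<forall>\<^sub>F \<epsilon> in nhds 0. vanishes_above N (F \<epsilon> + G \<epsilon>)"
    by (rule eventually_elim2) (rule vanishes_above_add)
  then show ?thesis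
    using assms unfolding has_curve_derivative_def
    by (auto intro: has_strong_derivative.add)
qed

lemma has_curve_derivative_linear:
  assumes "has_curve_derivative N F F'" "Vector_Spaces.linear scaleC scaleC P"
  shows "has_curve_derivative N (\<lambda>\<epsilon> n. P (F \<epsilon> n)) (\<lambda>n. P (F' n))"
proof -
  have "P 0 = 0" using assms(2) by (metis add_cancel_right_left linear_scaleC_iff)
  then have "\<forall>\<^sub>F \<epsilon> in nhds 0. vanishes_above N (\<lambda>n. P (F \<epsilon> n))"
    using assms(1) unfolding has_curve_derivative_def vanishes_above_def
    by (auto elim: eventually_mono)
  then show ?thesis
    using assms has_strong_derivative_linear unfolding has_curve_derivative_def by blast
qed

lemma linear_scaleC: "Vector_Spaces.linear scaleC scaleC (\<lambda>x::'a::complex_lie_algebra. c *\<^sub>C x)"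
  by (simp add: linear_scaleC_iff scaleC_add_right scaleC_scaleC mult.commute)

lemma has_curve_derivative_cscale:
  "has_curve_derivative N F F' \<Longrightarrow> has_curve_derivative N (\<lambda>\<epsilon>. cscale c (F \<epsilon>)) (cscale c F')"
  unfolding cscale_def by (rule has_curve_derivative_linear) (auto intro: linear_scaleC)

lemma cscale_minus_one: "cscale (-1) X = - X"
  by (simp add: cscale_def fun_eq_iff)

lemma has_curve_derivative_minus:
  "has_curve_derivative N F F' \<Longrightarrow> has_curve_derivative N (\<lambda>\<epsilon>. - F \<epsilon>) (- F')"
  using has_curve_derivative_cscale[of N F F' "-1"] by (simp add: cscale_minus_one)

lemma has_curve_derivative_diff:
  "has_curve_derivative N F F' \<Longrightarrow> has_curve_derivative N G G' \<Longrightarrow>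
    has_curve_derivative N (\<lambda>\<epsilon>. F \<epsilon> - G \<epsilon>) (F' - G')"
  using has_curve_derivative_add[of N F F' "\<lambda>\<epsilon>. - G \<epsilon>" "- G'"] has_curve_derivative_minus by fastforce

lemma has_curve_derivative_clie:
  assumes "has_curve_derivative N F F'" "has_curve_derivative M G G'"
  shows "has_curve_derivative (N + M) (\<lambda>\<epsilon>. clie (F \<epsilon>) (G \<epsilon>)) (clie F' (G 0) + clie (F 0) G')"
proof -
  have van: "\<forall>\<^sub>F \<epsilon> in nhds 0. vanishes_above N (F \<epsilon>) \<and> vanishes_above M (G \<epsilon>)"
    using assms unfolding has_curve_derivative_def by (auto intro: eventually_conj)
  note van0 = has_curve_derivative_vanishes[OF assms(1)] has_curve_derivative_vanishes[OF assms(2)]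
  have "has_strong_derivative (\<lambda>\<epsilon>. clie (F \<epsilon>) (G \<epsilon>) n) ((clie F' (G 0) + clie (F 0) G') n)" for n
  proof (rule has_strong_derivative.cong)
    have "has_strong_derivative (\<lambda>\<epsilon>. \<Sum>i\<in>{n - M..N}. lie (F \<epsilon> i) (G \<epsilon> (n - i)))
        (\<Sum>i\<in>{n - M..N}. lie (F' i) (G 0 (n - i)) + lie (F 0 i) (G' (n - i)))"
      using assms unfolding has_curve_derivative_def
      by (intro has_strong_derivative_sum has_strong_derivative_lie) auto
    also have "(\<Sum>i\<in>{n - M..N}. lie (F' i) (G 0 (n - i)) + lie (F 0 i) (G' (n - i))) =
        (clie F' (G 0) + clie (F 0) G') n"
      using van0 by (simp add: clie_eq_sum[where N = N and M = M and a = "n - M" and b = N] sum.distrib)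
    finally show "has_strong_derivative (\<lambda>\<epsilon>. \<Sum>i\<in>{n - M..N}. lie (F \<epsilon> i) (G \<epsilon> (n - i)))
        ((clie F' (G 0) + clie (F 0) G') n)" .
    show "\<forall>\<^sub>F \<epsilon> in nhds 0. (\<Sum>i\<in>{n - M..N}. lie (F \<epsilon> i) (G \<epsilon> (n - i))) = clie (F \<epsilon>) (G \<epsilon>) n"
      using van by (rule eventually_mono) (rule clie_eq_sum[symmetric], auto)
  qed
  moreover have "\<forall>\<^sub>F \<epsilon> in nhds 0. vanishes_above (N + M) (clie (F \<epsilon>) (G \<epsilon>))"
    using van by (rule eventually_mono) (auto intro: vanishes_above_clie)
  ultimately show ?thesis unfolding has_curve_derivative_def by blast
qed

lemma has_curve_derivative_graded_sum:
  assumes "\<And>m. has_curve_derivative (N - int m) (F m) (F' m)"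
    and "\<forall>\<^sub>F \<epsilon> in nhds 0. falling N (\<lambda>m. F m \<epsilon>)"
  shows "has_curve_derivative N (\<lambda>\<epsilon>. graded_sum (\<lambda>m. F m \<epsilon>)) (graded_sum F')"
proof -
  have F': "falling N F'"
    using has_curve_derivative_vanishes(2)[OF assms(1)] by (simp add: falling_def)
  have "has_strong_derivative (\<lambda>\<epsilon>. graded_sum (\<lambda>m. F m \<epsilon>) n) (graded_sum F' n)" for n
  proof (rule has_strong_derivative.cong)
    have K: "N - n < int (nat (N - n) + 1)" by simp
    have "has_strong_derivative (\<lambda>\<epsilon>. \<Sum>m<nat (N - n) + 1. F m \<epsilon> n) (\<Sum>m<nat (N - n) + 1. F' m n)"
      using assms(1) unfolding has_curve_derivative_def by (intro has_strong_derivative_sum) auto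
    with graded_sum_eq[OF F' K]
    show "has_strong_derivative (\<lambda>\<epsilon>. \<Sum>m<nat (N - n) + 1. F m \<epsilon> n) (graded_sum F' n)" by simp
    show "\<forall>\<^sub>F \<epsilon> in nhds 0. (\<Sum>m<nat (N - n) + 1. F m \<epsilon> n) = graded_sum (\<lambda>m. F m \<epsilon>) n"
      using assms(2) by (rule eventually_mono) (rule graded_sum_eq[symmetric, OF _ K])
  qed
  moreover have "\<forall>\<^sub>F \<epsilon> in nhds 0. vanishes_above N (graded_sum (\<lambda>m. F m \<epsilon>))"
    using assms(2) by (rule eventually_mono) (rule vanishes_above_graded_sum)
  ultimately show ?thesis unfolding has_curve_derivative_def by blast
qed

text \<open>The \<open>bracket_sum\<close> accounts for the variation of the \<open>m\<close>
  factors \<open>ad V\<close>, whence its index \<open>m - 1\<close>; for \<open>m = 0\<close> there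
  is no factor to vary. The induction step is \<open>bracket_sum_Suc\<close>.\<close>

lemma has_curve_derivative_funpow:
  assumes "has_curve_derivative (-1) V V'" "has_curve_derivative N X X'"
  shows "has_curve_derivative (N - int m) (\<lambda>\<epsilon>. (clie (V \<epsilon>) ^^ m) (X \<epsilon>))
    ((clie (V 0) ^^ m) X' + (if m = 0 then 0 else bracket_sum (V 0) (m - 1) V' (X 0)))"
proof (induction m)
  case 0
  then show ?case using assms by simp
next
  case (Suc m)
  note v = has_curve_derivative_vanishes[OF assms(1)] has_curve_derivative_vanishes[OF assms(2)]
  note bd = v[THEN bounded_aboveI]
  have T: "bounded_above (bracket_sum (V 0) k V' (X 0))" for k
    using vanishes_above_bracket_sum v bounded_aboveI by blast
  have "bracket_sum (V 0) m V' (X 0) = clie V' ((clie (V 0) ^^ m) (X 0)) +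
      clie (V 0) (if m = 0 then 0 else bracket_sum (V 0) (m - 1) V' (X 0))"
  proof (cases m)
    case 0
    then show ?thesis by (simp add: bracket_sum_def cscale_one)
  next
    case (Suc k)
    then show ?thesis using bracket_sum_Suc[OF bd(1,2,3), of k] by (simp add: add.commute)
  qed
  moreover have "clie (V 0) ((clie (V 0) ^^ m) X' + (if m = 0 then 0 else bracket_sum (V 0) (m - 1) V' (X 0))) =
     clie (V 0) ((clie (V 0) ^^ m) X') +
      clie (V 0) (if m = 0 then 0 else bracket_sum (V 0) (m - 1) V' (X 0))"
    by (rule clie_add_right) (auto intro: bd T bounded_above_intros)
  ultimately have eq: "clie V' ((clie (V 0) ^^ m) (X 0)) +
      clie (V 0) ((clie (V 0) ^^ m) X' + (if m = 0 then 0 else bracket_sum (V 0) (m - 1) V' (X 0))) =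
      (clie (V 0) ^^ Suc m) X' + bracket_sum (V 0) m V' (X 0)"
    by (simp add: algebra_simps)
  have "- 1 + (N - int m) = N - int (Suc m)" by simp
  then show ?case
    using has_curve_derivative_eq[OF has_curve_derivative_clie[OF assms(1) Suc] eq]
    by (simp only: funpow.simps comp_apply nat.distinct if_False diff_Suc_1)
qed

lemma eventually_falling_funpow:
  assumes "has_curve_derivative (-1) V V'" "has_curve_derivative N X X'"
  shows "\<forall>\<^sub>F \<epsilon> in nhds 0. falling N (\<lambda>m. cscale (c m) ((clie (V \<epsilon>) ^^ m) (X \<epsilon>)))"
proof -
  have "\<forall>\<^sub>F \<epsilon> in nhds 0. vanishes_above (-1) (V \<epsilon>)" "\<forall>\<^sub>F \<epsilon> in nhds 0. vanishes_above N (X \<epsilon>)"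
    using assms by (simp_all add: has_curve_derivative_def)
  then show ?thesis
    by (rule eventually_elim2) (rule falling_funpow)
qed

text \<open>The coefficients \<open>c\<close> are arbitrary so that \<open>exp_ad\<close> and
  \<open>nabla\<close> are two instances of one differentiation. The index shift in the second
  series comes from the constant term, which has no variation.\<close>

lemma has_curve_derivative_series:
  assumes "has_curve_derivative (-1) V V'" "has_curve_derivative N X X'"
  shows "has_curve_derivative N (\<lambda>\<epsilon>. graded_sum (\<lambda>m. cscale (c m) ((clie (V \<epsilon>) ^^ m) (X \<epsilon>))))
    (graded_sum (\<lambda>m. cscale (c m) ((clie (V 0) ^^ m) X')) +
     graded_sum (\<lambda>m. cscale (c (Suc m)) (bracket_sum (V 0) m V' (X 0))))"
proof -
  note v = has_curve_derivative_vanishes[OF assms(1)] has_curve_derivative_vanishes[OF assms(2)]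
  let ?T = "\<lambda>m. cscale (c m) (if m = 0 then 0 else bracket_sum (V 0) (m - 1) V' (X 0))"
  have T: "falling N ?T"
    unfolding falling_def
  proof (intro allI vanishes_above_cscale)
    fix m
    show "vanishes_above (N - int m) (if m = 0 then 0 else bracket_sum (V 0) (m - 1) V' (X 0))"
      using vanishes_above_bracket_sum[OF v(1) v(2) v(3), of "m - 1"]
      by (cases m) (auto simp: vanishes_above_zero algebra_simps)
  qed
  have "has_curve_derivative N (\<lambda>\<epsilon>. graded_sum (\<lambda>m. cscale (c m) ((clie (V \<epsilon>) ^^ m) (X \<epsilon>))))
     (graded_sum (\<lambda>m. cscale (c m) ((clie (V 0) ^^ m) X' +
       (if m = 0 then 0 else bracket_sum (V 0) (m - 1) V' (X 0)))))"
    by (intro has_curve_derivative_graded_sum has_curve_derivative_cscale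
        has_curve_derivative_funpow[OF assms] eventually_falling_funpow[OF assms])
  also have "(\<lambda>m. cscale (c m) ((clie (V 0) ^^ m) X' +
       (if m = 0 then 0 else bracket_sum (V 0) (m - 1) V' (X 0)))) =
      (\<lambda>m. cscale (c m) ((clie (V 0) ^^ m) X') + ?T m)"
    by (simp add: cscale_add)
  also have "graded_sum \<dots> = graded_sum (\<lambda>m. cscale (c m) ((clie (V 0) ^^ m) X')) + graded_sum ?T"
    by (rule graded_sum_add[OF falling_funpow[OF v(1) v(4)] T])
  also have "graded_sum ?T = graded_sum (\<lambda>m. cscale (c (Suc m)) (bracket_sum (V 0) m V' (X 0)))"
    by (subst graded_sum_Suc[OF T]) (simp add: cscale_zero)
  finally show ?thesis .
qed

lemma has_curve_derivative_exp_ad: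
  assumes "has_curve_derivative (-1) V V'" "has_curve_derivative N X X'"
  shows "has_curve_derivative N (\<lambda>\<epsilon>. exp_ad (V \<epsilon>) (X \<epsilon>))
    (exp_ad (V 0) X' + clie (nabla (V 0) V') (exp_ad (V 0) (X 0)))"
  using has_curve_derivative_series[OF assms, of "\<lambda>m. 1 / fact m"]
    has_curve_derivative_vanishes[OF assms(1)] has_curve_derivative_vanishes[OF assms(2)]
  by (simp add: exp_ad_graded_sum[symmetric] clie_nabla_exp_ad del: fact_Suc)

lemma has_curve_derivative_nabla:
  assumes "has_curve_derivative (-1) V V'" "has_curve_derivative N X X'"
  shows "has_curve_derivative N (\<lambda>\<epsilon>. nabla (V \<epsilon>) (X \<epsilon>))
    (nabla (V 0) X' + nabla_deriv (V 0) V' (X 0))"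
  using has_curve_derivative_series[OF assms, of "\<lambda>m. 1 / fact (Suc m)"]
  by (simp add: nabla_graded_sum[symmetric] nabla_deriv_def del: fact_Suc)

text \<open>This is how \<open>Vt\<close> and \<open>V\<beta>\<close> become differentiable along
  the other flow. Their defining equations can be solved from the top degree downwards, each
  component being determined by the right side and by components of higher degree, so
  differentiability passes from the right side to the solution.\<close>

lemma has_curve_derivative_solve_nabla:
  assumes V: "has_curve_derivative (-1) V V'" and C: "has_curve_derivative N C C'"
    and W: "\<And>\<epsilon>. vanishes_above N (W \<epsilon>)"
    and eq: "\<And>\<epsilon>. nabla (V \<epsilon>) (W \<epsilon>) = C \<epsilon>"
  obtains W' where "has_curve_derivative N W W'" "nabla (V 0) W' + nabla_deriv (V 0) V' (W 0) = C'"
proof -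
  have "\<exists>w. has_strong_derivative (\<lambda>\<epsilon>. W \<epsilon> n) w" for n
  \<comment> \<open>The measure counts the degrees from \<open>n\<close> up to \<open>N\<close>. It
    is 0 above \<open>N\<close>, so it still drops when passing from \<open>n = N\<close> to
    \<open>N + 1\<close>.\<close>
  proof (induction "nat (N + 1 - n)" arbitrary: n rule: less_induct)
    case less
    show ?case
    proof (cases "n > N")
      case True
      then have "(\<lambda>\<epsilon>. W \<epsilon> n) = (\<lambda>_. 0)"
        using W by (auto simp: vanishes_above_def)
      then show ?thesis using has_strong_derivative_const[of 0] by metis
    next
      case False
      \<comment> \<open>As \<open>ad V\<close> lowers degrees, \<open>nabla V W\<close> is in degree \<open>n\<close> the sum of \<open>W n\<close> and a term
        depending only on the part of \<open>W\<close> in degrees above \<open>n\<close>.\<close>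
      define Y where "Y \<epsilon> m = (if m > n then W \<epsilon> m else 0)" for \<epsilon> m
      have "\<exists>w. has_strong_derivative (\<lambda>\<epsilon>. Y \<epsilon> m) w" for m
        using less[of m] False has_strong_derivative_const[of 0] unfolding Y_def by (cases "m > n") auto
      then obtain Y' where Y': "\<And>m. has_strong_derivative (\<lambda>\<epsilon>. Y \<epsilon> m) (Y' m)" by metis
      have YN: "vanishes_above N (Y \<epsilon>)" for \<epsilon>
        using W[of \<epsilon>] by (simp add: Y_def vanishes_above_def)
      have "has_curve_derivative N Y Y'"
        using Y' YN by (simp add: has_curve_derivative_def)
      from has_curve_derivative_diff[OF C has_curve_derivative_nabla[OF V this]]
      obtain D where "has_curve_derivative N (\<lambda>\<epsilon>. C \<epsilon> - nabla (V \<epsilon>) (Y \<epsilon>)) D" by blast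
      then have "has_strong_derivative (\<lambda>\<epsilon>. C \<epsilon> n - nabla (V \<epsilon>) (Y \<epsilon>) n) (D n)"
        by (simp add: has_curve_derivative_def)
      moreover have "C \<epsilon> n - nabla (V \<epsilon>) (Y \<epsilon>) n = W \<epsilon> n" if "vanishes_above (-1) (V \<epsilon>)" for \<epsilon>
      proof -
        have "vanishes_above n (W \<epsilon> - Y \<epsilon>)" by (simp add: vanishes_above_def Y_def)
        from nabla_top[OF that this] nabla_diff[OF that W YN] show ?thesis
          by (simp add: eq Y_def)
      qed
      then have "\<forall>\<^sub>F \<epsilon> in nhds 0. C \<epsilon> n - nabla (V \<epsilon>) (Y \<epsilon>) n = W \<epsilon> n"
        using V unfolding has_curve_derivative_def by (auto elim: eventually_mono)
      ultimately have "has_strong_derivative (\<lambda>\<epsilon>. W \<epsilon> n) (D n)"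
        by (rule has_strong_derivative.cong)
      then show ?thesis by blast
    qed
  qed
  then obtain W' where "\<And>n. has_strong_derivative (\<lambda>\<epsilon>. W \<epsilon> n) (W' n)" by metis
  with W have W': "has_curve_derivative N W W'" by (simp add: has_curve_derivative_def)
  have "nabla (V 0) W' + nabla_deriv (V 0) V' (W 0) = C'"
    by (rule has_curve_derivative_unique[OF _ C])
      (use has_curve_derivative_nabla[OF V W'] in \<open>simp add: eq\<close>)
  with W' show ?thesis using that by blast
qed

section \<open>Structure of the affine algebra\<close>

lemma lie_subalgebra_hull: "lie_subalgebra (lie_subalgebra hull S)"
proof -
  have "lie_subalgebra (\<Inter>F)" if "\<forall>L\<in>F. lie_subalgebra L" for F
    using that unfolding lie_subalgebra_def complex_vector.subspace_def by auto
  from this[of "{L. lie_subalgebra L \<and> S \<subseteq> L}"] show ?thesis unfolding hull_def by simp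
qed

lemma lie_span_mem:
  assumes "x \<in> complex_vector.span S" "y \<in> complex_vector.span T" "complex_vector.subspace U"
    and "\<And>x y. x \<in> S \<Longrightarrow> y \<in> T \<Longrightarrow> lie x y \<in> U"
  shows "lie x (y :: 'a::complex_lie_algebra) \<in> U"
proof -
  have *: "lie x y \<in> U" if "x \<in> S" for x
    using assms(2)
  proof (induction rule: complex_vector.span_induct_alt)
    case base
    show ?case using complex_vector.subspace_0[OF assms(3)] by simp
  next
    case (step c z y)
    then show ?case
      using assms(3,4) that
      by (auto simp: lie_add_right lie_scale_right complex_vector.subspace_def)
  qed
  show ?thesis
    using assms(1)
  proof (induction rule: complex_vector.span_induct_alt)
    case base
    show ?case using complex_vector.subspace_0[OF assms(3)] by simp
  next
    case (step c z y)
    then show ?case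
      using assms(3) *
      by (auto simp: lie_add_left lie_scale_left complex_vector.subspace_def)
  qed
qed

lemma lie_span_right_mem:
  assumes "y \<in> complex_vector.span T" "complex_vector.subspace U"
    and "\<And>y. y \<in> T \<Longrightarrow> lie x y \<in> U"
  shows "lie x (y :: 'a::complex_lie_algebra) \<in> U"
  by (rule lie_span_mem[of x "{x}" y T U]) (use assms in \<open>auto intro: complex_vector.span_base\<close>)

section \<open>Chevalley generators, Cartan subalgebra and invariant form\<close>

locale affine_realization =
  fixes \<A> :: "('a::complex_lie_algebra, 'b::complex_lie_algebra) affine_data"
  assumes setting: "affine_setting \<A>"
begin

abbreviation "l \<equiv> aff_rank \<A>"
abbreviation "a \<equiv> gcm \<A>"
abbreviation "k \<equiv> label \<A>"
abbreviation "k' \<equiv> colabel \<A>"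
abbreviation "e \<equiv> gen_e \<A>"
abbreviation "f \<equiv> gen_f \<A>"
abbreviation "\<alpha> \<equiv> coroot \<A>"
abbreviation "H \<equiv> cartan_subalgebra \<A>"
abbreviation "L \<equiv> affine_algebra \<A>"
abbreviation "\<g> \<equiv> derived_affine \<A>"
abbreviation "d \<equiv> scaling \<A>"
abbreviation "c \<equiv> central \<A>"

lemma kac_moody_data: "affine_kac_moody \<A>"
  and simple_data: "simple_algebra_data \<A>"
  and loop_isomorphism: "gradation \<A> s \<Longrightarrow> loop_isomorphism \<A> s (loop_iso \<A> s)"
  and virasoro_data: "virasoro_elements \<A>"
  and heisenberg_data: "principal_heisenberg \<A>"
  using setting unfolding affine_setting_def by auto

lemma twist_pos: "twist \<A> > 0"
proof -
  obtain bs where "affine_type (fin_type \<A>) (twist \<A>) l bs"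
    using kac_moody_data unfolding affine_kac_moody_def by blast
  then show ?thesis by cases auto
qed

lemma label_pos: "i \<le> l \<Longrightarrow> k i > 0"
  and colabel_pos: "i \<le> l \<Longrightarrow> k' i > 0"
  and gcm_label: "i \<le> l \<Longrightarrow> (\<Sum>j\<le>l. a i j * int (k j)) = 0"
  and gcm_colabel: "i \<le> l \<Longrightarrow> (\<Sum>j\<le>l. a j i * int (k' j)) = 0"
  using kac_moody_data unfolding affine_kac_moody_def kac_labels_def by blast+

lemma gcm_label_complex: "i \<le> l \<Longrightarrow> (\<Sum>j\<le>l. of_int (a i j) * of_nat (k j) :: complex) = 0"
  and gcm_colabel_complex: "i \<le> l \<Longrightarrow> (\<Sum>j\<le>l. of_int (a j i) * of_nat (k' j) :: complex) = 0"
  using arg_cong[OF gcm_label, of i of_int] arg_cong[OF gcm_colabel, of i of_int]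
  by simp_all

lemma km: "kac_moody {..l} a e f H L"
  using kac_moody_data unfolding affine_kac_moody_def by blast

lemma chevalley:
  assumes "i \<le> l" "j \<le> l"
  shows "i \<noteq> j \<Longrightarrow> lie (e i) (f j) = 0" "lie (\<alpha> i) (e j) = of_int (a i j) *\<^sub>C e j"
    "lie (\<alpha> i) (f j) = - (of_int (a i j) *\<^sub>C f j)"
  using km assms unfolding kac_moody_def chevalley_relations_def coroot_def by blast+

lemma cartan_abelian: "x \<in> H \<Longrightarrow> y \<in> H \<Longrightarrow> lie x y = 0"
  using km unfolding kac_moody_def by simp

lemma subspace_cartan: "complex_vector.subspace H"
  unfolding cartan_subalgebra_def by (rule complex_vector.subspace_span)

lemma coroot_in_cartan: "i \<le> l \<Longrightarrow> \<alpha> i \<in> H"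
  and scaling_in_cartan: "d \<in> H"
  unfolding cartan_subalgebra_def by (auto intro: complex_vector.span_base)

text \<open>Otherwise the coroot would vanish, contrary to the independence of the coroots. This
  allows eigenvalues on \<open>e i\<close> to be compared.\<close>

lemma e_nonzero: "i \<le> l \<Longrightarrow> e i \<noteq> 0"
proof
  assume i: "i \<le> l" "e i = 0"
  have "independent_family {..l} \<alpha>"
    using km unfolding kac_moody_def coroot_def by auto
  then have "0 \<notin> \<alpha> ` {..l}"
    using complex_vector.dependent_zero unfolding independent_family_def by metis
  moreover have "\<alpha> i = 0" using i(2) by (simp add: coroot_def)
  ultimately show False using i(1) by force
qed

lemma scaling_generators: "i \<le> l \<Longrightarrow> lie d (e i) = e i" "i \<le> l \<Longrightarrow> lie d (f i) = - f i"
proof -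
  have "\<forall>i\<le>l. lie d (e i) = e i \<and> lie d (f i) = - f i"
    using kac_moody_data unfolding affine_kac_moody_def by (elim conjE)
  then show "i \<le> l \<Longrightarrow> lie d (e i) = e i" "i \<le> l \<Longrightarrow> lie d (f i) = - f i" by auto
qed

lemma subalgebra_affine: "lie_subalgebra L"
  unfolding affine_algebra_def by (rule lie_subalgebra_hull)

lemma subspace_affine: "complex_vector.subspace L"
  and lie_affine: "x \<in> L \<Longrightarrow> y \<in> L \<Longrightarrow> lie x y \<in> L"
  using subalgebra_affine unfolding lie_subalgebra_def by auto

lemma generators_in_affine:
  "e ` {..l} \<union> f ` {..l} \<union> H \<subseteq> L"
  unfolding affine_algebra_def by (rule hull_subset)

lemma e_in_affine: "i \<le> l \<Longrightarrow> e i \<in> L" and f_in_affine: "i \<le> l \<Longrightarrow> f i \<in> L"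
  and cartan_in_affine: "x \<in> H \<Longrightarrow> x \<in> L"
  using generators_in_affine by auto

lemma subspace_derived: "complex_vector.subspace \<g>"
  unfolding derived_affine_def derived_algebra_def by (rule complex_vector.subspace_span)

lemma lie_affine_derived: "x \<in> L \<Longrightarrow> y \<in> L \<Longrightarrow> lie x y \<in> \<g>"
  unfolding derived_affine_def derived_algebra_def by (auto intro: complex_vector.span_base)

lemma derived_in_affine: "x \<in> \<g> \<Longrightarrow> x \<in> L"
proof -
  have "\<g> \<subseteq> L"
    unfolding derived_affine_def derived_algebra_def
    by (rule complex_vector.span_minimal) (auto intro: lie_affine subspace_affine)
  then show "x \<in> \<g> \<Longrightarrow> x \<in> L" by auto
qed

lemma lie_derived: "x \<in> \<g> \<Longrightarrow> y \<in> \<g> \<Longrightarrow> lie x y \<in> \<g>"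
  by (intro lie_affine_derived derived_in_affine)

lemma e_in_derived: "i \<le> l \<Longrightarrow> e i \<in> \<g>" and f_in_derived: "i \<le> l \<Longrightarrow> f i \<in> \<g>"
  using lie_affine_derived[OF cartan_in_affine[OF scaling_in_cartan] e_in_affine, of i]
    lie_affine_derived[OF cartan_in_affine[OF scaling_in_cartan] f_in_affine, of i]
    complex_vector.subspace_neg[OF subspace_derived, of "- f i"]
  by (auto simp: scaling_generators)

lemma coroot_in_derived: "i \<le> l \<Longrightarrow> \<alpha> i \<in> \<g>"
  unfolding coroot_def by (intro lie_affine_derived e_in_affine f_in_affine)

lemma central_in_cartan: "c \<in> H"
  unfolding central_def
  by (intro complex_vector.subspace_sum complex_vector.subspace_scale subspace_cartan coroot_in_cartan) auto

lemma central_in_derived: "c \<in> \<g>"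
  unfolding central_def
  by (intro complex_vector.subspace_sum complex_vector.subspace_scale subspace_derived coroot_in_derived) auto

lemma form_data: "invariant_form L (form \<A>)"
  using kac_moody_data unfolding affine_kac_moody_def by blast

lemma form_coroots: "i \<le> l \<Longrightarrow> j \<le> l \<Longrightarrow>
    form \<A> (\<alpha> i) (\<alpha> j) = of_int (a i j) * of_nat (k j) / of_nat (k' j)"
  and form_scaling: "j \<le> l \<Longrightarrow> form \<A> d (\<alpha> j) = of_nat (k j) / of_nat (k' j)"
  and form_scaling_scaling: "form \<A> d d = 0"
proof -
  have *: "\<forall>i\<le>l. \<forall>j\<le>l. form \<A> (\<alpha> i) (\<alpha> j) = of_int (a i j) * of_nat (k j) / of_nat (k' j)"
    "\<forall>j\<le>l. form \<A> d (\<alpha> j) = of_nat (k j) / of_nat (k' j)" "form \<A> d d = 0"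
    using kac_moody_data unfolding affine_kac_moody_def by - (elim conjE; assumption)+
  show "i \<le> l \<Longrightarrow> j \<le> l \<Longrightarrow>
    form \<A> (\<alpha> i) (\<alpha> j) = of_int (a i j) * of_nat (k j) / of_nat (k' j)"
    "j \<le> l \<Longrightarrow> form \<A> d (\<alpha> j) = of_nat (k j) / of_nat (k' j)" "form \<A> d d = 0"
    using * by auto
qed

lemma form_sym: "x \<in> L \<Longrightarrow> y \<in> L \<Longrightarrow> form \<A> x y = form \<A> y x"
  and form_add_left: "x \<in> L \<Longrightarrow> y \<in> L \<Longrightarrow> z \<in> L \<Longrightarrow> form \<A> (x + y) z = form \<A> x z + form \<A> y z"
  and form_scale_left: "x \<in> L \<Longrightarrow> y \<in> L \<Longrightarrow> form \<A> (t *\<^sub>C x) y = t * form \<A> x y"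
  using form_data unfolding invariant_form_def by blast+

lemma form_sum_left:
  assumes "\<And>i. i \<in> I \<Longrightarrow> x i \<in> L" "y \<in> L"
  shows "form \<A> (\<Sum>i\<in>I. t i *\<^sub>C x i) y = (\<Sum>i\<in>I. t i * form \<A> (x i) y)"
proof -
  have 0: "form \<A> 0 y = 0"
    using form_scale_left[OF assms(2,2), of 0] by simp
  show ?thesis
    using assms(1)
  proof (induction I rule: infinite_finite_induct)
    case (insert j I)
    have "(\<Sum>i\<in>I. t i *\<^sub>C x i) \<in> L"
      using insert by (intro complex_vector.subspace_sum complex_vector.subspace_scale subspace_affine) auto
    with insert assms(2) show ?case
      by (simp add: form_add_left form_scale_left complex_vector.subspace_scale[OF subspace_affine])
  qed (simp_all add: 0)
qed

lemma cartan_expand: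
  assumes "x \<in> H"
  obtains \<gamma> t where "x = \<gamma> *\<^sub>C d + (\<Sum>j\<le>l. t j *\<^sub>C \<alpha> j)"
proof -
  obtain \<gamma> where "x - \<gamma> *\<^sub>C d \<in> complex_vector.span (\<alpha> ` {..l})"
    using assms complex_vector.span_breakdown_eq unfolding cartan_subalgebra_def by blast
  moreover have "\<exists>t. y = (\<Sum>j\<le>l. t j *\<^sub>C \<alpha> j)" if "y \<in> complex_vector.span (\<alpha> ` {..l})" for y
    using that
  proof (induction rule: complex_vector.span_induct_alt)
    case base
    show ?case by (rule exI[of _ "\<lambda>_. 0"]) simp
  next
    case (step b x y)
    then obtain i t where "i \<le> l" "x = \<alpha> i" "y = (\<Sum>j\<le>l. t j *\<^sub>C \<alpha> j)" by auto
    then have "b *\<^sub>C x + y = (\<Sum>j\<le>l. ((if j = i then b else 0) + t j) *\<^sub>C \<alpha> j)"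
      by (simp add: scaleC_add_left sum.distrib if_distrib[of "\<lambda>z. z *\<^sub>C _"] cong: if_cong)
    then show ?case by (intro exI[of _ "\<lambda>j. (if j = i then b else 0) + t j"])
  qed
  ultimately show ?thesis using that[of \<gamma>] by (metis add.commute diff_add_cancel)
qed

text \<open>The form identifies the simple root with the coroot scaled by \<open>k' i / k i\<close>,
  so an element of \<open>H\<close> acts on the generators through its product with
  \<open>\<alpha> i\<close>. By linearity this is a computation on \<open>d\<close> and the
  coroots.\<close>

lemma cartan_generators:
  assumes "x \<in> H" "i \<le> l"
  shows "lie x (e i) = (form \<A> x (\<alpha> i) * of_nat (k' i) / of_nat (k i)) *\<^sub>C e i"
    and "lie x (f i) = - ((form \<A> x (\<alpha> i) * of_nat (k' i) / of_nat (k i)) *\<^sub>C f i)"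
proof -
  obtain \<gamma> t where x: "x = \<gamma> *\<^sub>C d + (\<Sum>j\<le>l. t j *\<^sub>C \<alpha> j)"
    using cartan_expand[OF assms(1)] .
  have "(\<Sum>j\<le>l. t j *\<^sub>C \<alpha> j) \<in> H"
    by (intro complex_vector.subspace_sum complex_vector.subspace_scale subspace_cartan coroot_in_cartan) auto
  then have "form \<A> x (\<alpha> i) = \<gamma> * form \<A> d (\<alpha> i) + (\<Sum>j\<le>l. t j * form \<A> (\<alpha> j) (\<alpha> i))"
    unfolding x
    by (subst form_add_left, simp_all add: cartan_in_affine coroot_in_cartan scaling_in_cartan assms(2)
        complex_vector.subspace_scale[OF subspace_affine])
      (subst form_scale_left form_sum_left,
        simp_all add: cartan_in_affine coroot_in_cartan scaling_in_cartan assms(2))+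
  also have "\<dots> = (\<gamma> + (\<Sum>j\<le>l. t j * of_int (a j i))) * (of_nat (k i) / of_nat (k' i))"
    using assms(2) by (simp add: form_coroots form_scaling distrib_right distrib_left sum_distrib_left
        sum_divide_distrib add_divide_distrib mult_ac)
  finally have "form \<A> x (\<alpha> i) * of_nat (k' i) / of_nat (k i) = \<gamma> + (\<Sum>j\<le>l. t j * of_int (a j i))"
    using label_pos[OF assms(2)] colabel_pos[OF assms(2)] by simp
  moreover have "lie x (e i) = (\<gamma> + (\<Sum>j\<le>l. t j * of_int (a j i))) *\<^sub>C e i"
    using assms(2) by (simp add: x lie_add_left lie_scale_left lie_sum_left scaling_generators
        chevalley scaleC_add_left scaleC_scaleC complex_vector.scale_sum_left)
  moreover have "lie x (f i) = - ((\<gamma> + (\<Sum>j\<le>l. t j * of_int (a j i))) *\<^sub>C f i)"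
    using assms(2) by (simp add: x lie_add_left lie_scale_left lie_sum_left scaling_generators
        chevalley scaleC_add_left scaleC_scaleC complex_vector.scale_sum_left sum_negf)
  ultimately show "lie x (e i) = (form \<A> x (\<alpha> i) * of_nat (k' i) / of_nat (k i)) *\<^sub>C e i"
    "lie x (f i) = - ((form \<A> x (\<alpha> i) * of_nat (k' i) / of_nat (k i)) *\<^sub>C f i)"
    by simp_all
qed

lemma form_central_coroot: "i \<le> l \<Longrightarrow> form \<A> c (\<alpha> i) = 0"
proof -
  assume i: "i \<le> l"
  have "form \<A> c (\<alpha> i) = (\<Sum>j\<le>l. of_nat (k' j) * form \<A> (\<alpha> j) (\<alpha> i))"
    unfolding central_def
    by (rule form_sum_left) (use i in \<open>auto intro: cartan_in_affine coroot_in_cartan\<close>)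
  also have "\<dots> = (\<Sum>j\<le>l. of_int (a j i) * of_nat (k' j)) * (of_nat (k i) / of_nat (k' i))"
    using i by (simp add: form_coroots sum_distrib_left sum_divide_distrib mult_ac)
  finally show ?thesis using gcm_colabel_complex[OF i] by simp
qed

lemma form_with_central:
  assumes "x \<in> H"
  shows "form \<A> x c = (\<Sum>i\<le>l. of_nat (k' i) * form \<A> x (\<alpha> i))"
proof -
  have "form \<A> x c = form \<A> c x"
    using assms central_in_cartan by (intro form_sym cartan_in_affine)
  also have "\<dots> = (\<Sum>i\<le>l. of_nat (k' i) * form \<A> (\<alpha> i) x)"
    unfolding central_def
    by (rule form_sum_left) (use assms in \<open>auto intro: cartan_in_affine coroot_in_cartan\<close>)
  also have "\<dots> = (\<Sum>i\<le>l. of_nat (k' i) * form \<A> x (\<alpha> i))"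
    using assms by (intro sum.cong refl arg_cong2[where f = "(*)"] form_sym)
      (auto intro: cartan_in_affine coroot_in_cartan)
  finally show ?thesis .
qed

lemma form_central_central: "form \<A> c c = 0"
  using form_with_central[OF central_in_cartan] form_central_coroot by simp

lemma coxeter_pos: "gradation \<A> s \<Longrightarrow> coxeter \<A> s > 0"
proof -
  assume "gradation \<A> s"
  then obtain i where "i \<le> l" "s i \<noteq> 0" unfolding gradation_def by blast
  with label_pos[of i] have "0 < k i * s i" "i \<in> {..l}" by auto
  then show ?thesis
    unfolding coxeter_def by (intro sum_pos2) auto
qed

lemma period_pos: "gradation \<A> s \<Longrightarrow> period \<A> s > 0"
  using coxeter_pos twist_pos by simp

lemma gradation_homogeneous: "gradation \<A> homogeneous_grad"
  and gradation_principal: "gradation \<A> principal_grad"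
  unfolding gradation_def homogeneous_grad_def principal_grad_def by auto

section \<open>The graded loop algebra and its derivations\<close>

lemma loop_algebraI: "(\<And>m. loop_degree \<A> s m (Poly_Mapping.lookup u m)) \<Longrightarrow> (u, t) \<in> loop_algebra \<A> s"
  by (simp add: loop_algebra_def)

lemma loop_algebra_add:
  "x \<in> loop_algebra \<A> s \<Longrightarrow> y \<in> loop_algebra \<A> s \<Longrightarrow> x + y \<in> loop_algebra \<A> s"
  by (cases x; cases y) (auto simp: loop_algebra_def lookup_add intro: loop_degree.add)

lemma lookup_loop_scale: "Poly_Mapping.lookup (fst (loop_scale t x)) m = t *\<^sub>C Poly_Mapping.lookup (fst x) m"
  by (simp add: loop_scale_def map.rep_eq when_def)

lemma snd_loop_scale: "snd (loop_scale t x) = t * snd x"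
  by (simp add: loop_scale_def)

lemma loop_algebra_scale: "x \<in> loop_algebra \<A> s \<Longrightarrow> loop_scale t x \<in> loop_algebra \<A> s"
  using lookup_loop_scale[of t x]
  by (cases x; cases "loop_scale t x") (auto simp: loop_algebra_def intro: loop_degree.scale)

lemma zpow_in_loop_algebra: "loop_degree \<A> s m u \<Longrightarrow> zpow m u \<in> loop_algebra \<A> s"
  unfolding zpow_def
  by (rule loop_algebraI) (auto simp: lookup_single when_def intro: loop_degree.zero)

lemma constant_in_loop_algebra: "(0, t) \<in> loop_algebra \<A> s"
  by (rule loop_algebraI) (auto intro: loop_degree.zero)

lemma zero_in_loop_algebra: "0 \<in> loop_algebra \<A> s"
  using constant_in_loop_algebra[of 0] by (simp add: zero_prod_def)

lemma lookup_loop_derivation: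
  "Poly_Mapping.lookup (fst (loop_derivation \<A> s j x)) n =
    (- of_int (n - int (period \<A> s) * j) / of_nat (period \<A> s)) *\<^sub>C
      Poly_Mapping.lookup (fst x) (n - int (period \<A> s) * j)"
proof -
  let ?P = "int (period \<A> s)"
  let ?g = "\<lambda>m. (- of_int m / of_nat (period \<A> s)) *\<^sub>C Poly_Mapping.lookup (fst x) m"
  have "Poly_Mapping.lookup (fst (loop_derivation \<A> s j x)) n =
      (\<Sum>m\<in>Poly_Mapping.keys (fst x). if m = n - ?P * j then ?g m else 0)"
    unfolding loop_derivation_def fst_conv lookup_sum lookup_single when_def
    by (rule sum.cong) auto
  also have "\<dots> = ?g (n - ?P * j)"
    by (auto simp: sum.delta in_keys_iff)
  finally show ?thesis .
qed

lemma loop_derivation_in_loop_algebra: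
  assumes "x \<in> loop_algebra \<A> s"
  shows "loop_derivation \<A> s j x \<in> loop_algebra \<A> s"
proof -
  have "loop_degree \<A> s n (Poly_Mapping.lookup (fst (loop_derivation \<A> s j x)) n)" for n
    unfolding lookup_loop_derivation
    by (rule loop_degree.scale, rule loop_degree.period[where m = "n - int (period \<A> s) * j"])
      (use assms in \<open>auto simp: loop_algebra_def mod_diff_eq simp flip: mod_diff_right_eq split: prod.splits\<close>)
  then show ?thesis
    by (cases "loop_derivation \<A> s j x") (auto simp: loop_algebra_def)
qed

end

section \<open>Transport along the loop isomorphism\<close>

context affine_realization
begin

context
  fixes s :: "nat \<Rightarrow> nat"
  assumes s: "gradation \<A> s"
begin

abbreviation "R \<equiv> loop_iso \<A> s"
abbreviation "LA \<equiv> loop_algebra \<A> s"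
abbreviation "P \<equiv> period \<A> s"

lemma loop_iso_bij: "bij_betw R LA \<g>"
  and loop_iso_add: "x \<in> LA \<Longrightarrow> y \<in> LA \<Longrightarrow> R (x + y) = R x + R y"
  and loop_iso_scale: "x \<in> LA \<Longrightarrow> R (loop_scale t x) = t *\<^sub>C R x"
  and loop_iso_bracket: "x \<in> LA \<Longrightarrow> y \<in> LA \<Longrightarrow> R (loop_bracket \<A> s x y) = lie (R x) (R y)"
  and loop_iso_e: "i \<le> l \<Longrightarrow> R (zpow (int (s i)) (gen_E \<A> i)) = e i"
  and loop_iso_f: "i \<le> l \<Longrightarrow> R (zpow (- int (s i)) (gen_F \<A> i)) = f i"
  and loop_iso_central: "R (0, 1) = c"
  using loop_isomorphism[OF s] unfolding loop_isomorphism_def by simp_all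

lemma loop_iso_zero: "R 0 = 0"
  using loop_iso_add[OF zero_in_loop_algebra zero_in_loop_algebra] by simp

lemma loop_iso_sum: "(\<And>i. i \<in> I \<Longrightarrow> x i \<in> LA) \<Longrightarrow> R (\<Sum>i\<in>I. x i) = (\<Sum>i\<in>I. R (x i)) \<and> (\<Sum>i\<in>I. x i) \<in> LA"
  by (induction I rule: infinite_finite_induct)
    (auto simp: loop_iso_zero loop_iso_add loop_algebra_add zero_in_loop_algebra)

lemma loop_iso_derived: "x \<in> LA \<Longrightarrow> R x \<in> \<g>"
  using loop_iso_bij by (auto simp: bij_betw_def)

lemma derived_loop_iso:
  assumes "x \<in> \<g>"
  obtains y where "y \<in> LA" "x = R y"
proof -
  have "x \<in> R ` LA" using assms loop_iso_bij by (simp add: bij_betw_def)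
  then show ?thesis using that by blast
qed

lemma loop_iso_eqD: "x \<in> LA \<Longrightarrow> y \<in> LA \<Longrightarrow> R x = R y \<Longrightarrow> x = y"
  using loop_iso_bij by (auto simp: bij_betw_def inj_on_def)

lemma loop_iso_constant: "R (0, t) = t *\<^sub>C c"
proof -
  have "loop_scale t (0, 1) = ((0, t) :: 'b loop)"
    by (simp add: loop_scale_def poly_mapping_eqI map.rep_eq when_def)
  then show ?thesis
    using loop_iso_scale[OF constant_in_loop_algebra, of t 1] loop_iso_central by simp
qed

lemma lie_central: "x \<in> \<g> \<Longrightarrow> lie c x = 0"
proof -
  assume "x \<in> \<g>"
  then obtain y where y: "y \<in> LA" "x = R y" by (rule derived_loop_iso)
  have "loop_bracket \<A> s (0, 1) y = 0"
    by (simp add: loop_bracket_def zero_prod_def)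
  with loop_iso_bracket[OF constant_in_loop_algebra y(1), of 1] show ?thesis
    by (simp add: y loop_iso_central loop_iso_zero)
qed

lemma virasoro_loop: "x \<in> LA \<Longrightarrow> lie (virasoro \<A> s j) (R x) = R (loop_derivation \<A> s j x)"
  using virasoro_data s unfolding virasoro_elements_def by (simp add: Let_def)

lemma virasoro_derived: "x \<in> \<g> \<Longrightarrow> lie (virasoro \<A> s j) x \<in> \<g>"
  by (erule derived_loop_iso) (simp add: virasoro_loop loop_iso_derived loop_derivation_in_loop_algebra)

lemma period_ne: "(of_nat P :: complex) \<noteq> 0"
  using period_pos[OF s] by simp

lemma loop_derivation_zpow:
  "loop_derivation \<A> s j (zpow m u) = loop_scale (- of_int m / of_nat P) (zpow (m + int P * j) u)"
proof (rule prod_eqI)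
  show "fst (loop_derivation \<A> s j (zpow m u)) = fst (loop_scale (- of_int m / of_nat P) (zpow (m + int P * j) u))"
  proof (rule poly_mapping_eqI)
    fix n
    show "Poly_Mapping.lookup (fst (loop_derivation \<A> s j (zpow m u))) n =
        Poly_Mapping.lookup (fst (loop_scale (- of_int m / of_nat P) (zpow (m + int P * j) u))) n"
      by (cases "n = m + int P * j")
        (auto simp: lookup_loop_derivation lookup_loop_scale zpow_def lookup_single when_def)
  qed
qed (simp add: loop_derivation_def loop_scale_def zpow_def)

lemma virasoro_zpow:
  assumes "loop_degree \<A> s m u"
  shows "lie (virasoro \<A> s j) (R (zpow m u)) = (- of_int m / of_nat P) *\<^sub>C R (zpow (m + int P * j) u)"
proof -
  have "loop_degree \<A> s (m + int P * j) u"
    using assms by (rule loop_degree.period) simp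
  then show ?thesis
    using assms by (simp add: virasoro_loop zpow_in_loop_algebra loop_derivation_zpow loop_iso_scale)
qed

lemma virasoro_zero_generators:
  assumes "i \<le> l"
  shows "lie (virasoro \<A> s 0) (e i) = (- of_nat (s i) / of_nat P) *\<^sub>C e i"
    and "lie (virasoro \<A> s 0) (f i) = (of_nat (s i) / of_nat P) *\<^sub>C f i"
  using virasoro_zpow[OF loop_degree.gen_E[OF assms], of 0] loop_iso_e[OF assms]
    virasoro_zpow[OF loop_degree.gen_F[OF assms], of 0] loop_iso_f[OF assms]
  by simp_all

end

lemma virasoro_zero: "gradation \<A> s \<Longrightarrow> virasoro \<A> s 0 = virasoro \<A> homogeneous_grad 0 - rho \<A> s +
    (of_nat (twist \<A>) / 2 * form \<A> (rho \<A> s) (rho \<A> s)) *\<^sub>C c"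
  and virasoro_nonzero: "gradation \<A> s \<Longrightarrow> j \<noteq> 0 \<Longrightarrow> virasoro \<A> s j = virasoro \<A> homogeneous_grad j -
    (\<Sum>i=1..l. rho_coeff \<A> s i *\<^sub>C
      loop_iso \<A> homogeneous_grad (zpow (int (twist \<A> * k 0) * j) (gen_H \<A> i)))"
  using virasoro_data unfolding virasoro_elements_def by (simp_all add: Let_def)

lemma coxeter_homogeneous: "coxeter \<A> homogeneous_grad = k 0"
proof -
  have "coxeter \<A> homogeneous_grad = (\<Sum>i\<le>l. if i = 0 then k i else 0)"
    unfolding coxeter_def homogeneous_grad_def by (rule sum.cong) auto
  then show ?thesis by simp
qed

text \<open>Compare the actions of \<open>d\<^sub>0\<^sup>s\<close> and \<open>d\<^sub>0\<^bsup>s\<^sup>0\<^esup>\<close> on \<open>e\<^sub>i\<close>. Since \<open>s\<close> is arbitrary, this determines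
  the row space of the Cartan matrix without reference to the classification.\<close>

lemma rho_coeff_gcm:
  assumes s: "gradation \<A> s" and i: "i \<le> l"
  shows "(\<Sum>j=1..l. rho_coeff \<A> s j * of_int (a j i)) =
    of_nat (s i) / of_nat (period \<A> s) - (if i = 0 then 1 / of_nat (twist \<A> * k 0) else 0)"
proof -
  let ?S = "\<Sum>j=1..l. rho_coeff \<A> s j * of_int (a j i)"
  have "lie (rho \<A> s) (e i) = ?S *\<^sub>C e i"
    unfolding rho_def lie_sum_left using i
    by (simp add: lie_scale_left chevalley scaleC_scaleC complex_vector.scale_sum_left)
  moreover have "lie c (e i) = 0"
    using lie_central[OF s e_in_derived[OF i]] .
  ultimately have "lie (virasoro \<A> s 0) (e i) =
      lie (virasoro \<A> homogeneous_grad 0) (e i) - ?S *\<^sub>C e i"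
    by (subst virasoro_zero[OF s]) (simp add: lie_add_left lie_diff_left lie_scale_left)
  then have "?S *\<^sub>C e i = (of_nat (s i) / of_nat (period \<A> s)
      - of_nat (homogeneous_grad i) / of_nat (period \<A> homogeneous_grad)) *\<^sub>C e i"
    unfolding virasoro_zero_generators(1)[OF s i] virasoro_zero_generators(1)[OF gradation_homogeneous i]
    by (simp add: complex_vector.scale_left_diff_distrib algebra_simps)
  then have "?S = of_nat (s i) / of_nat (period \<A> s)
      - of_nat (homogeneous_grad i) / of_nat (period \<A> homogeneous_grad)"
    using e_nonzero[OF i] by (simp add: complex_vector.scale_cancel_right)
  then show ?thesis unfolding coxeter_homogeneous by (simp add: homogeneous_grad_def)
qed

text \<open>Everything comes down to the kernel of the Cartan matrix being spanned by the labels.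
  This is read off from the row relations \<open>rho_coeff_gcm\<close> rather than from the list of
  diagrams.\<close>

lemma cartan_kernel:
  assumes "x \<in> H" "\<And>i. i \<le> l \<Longrightarrow> form \<A> x (\<alpha> i) = 0"
  obtains \<tau> where "x = \<tau> *\<^sub>C c"
proof -
  obtain \<gamma> t where x: "x = \<gamma> *\<^sub>C d + (\<Sum>j\<le>l. t j *\<^sub>C \<alpha> j)"
    using cartan_expand[OF assms(1)] .
  have "(\<Sum>j\<le>l. t j *\<^sub>C \<alpha> j) \<in> H"
    by (intro complex_vector.subspace_sum complex_vector.subspace_scale subspace_cartan coroot_in_cartan) auto
  then have form: "form \<A> x (\<alpha> i) = \<gamma> * form \<A> d (\<alpha> i) + (\<Sum>j\<le>l. t j * form \<A> (\<alpha> j) (\<alpha> i))" if "i \<le> l" for i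
    unfolding x using that
    by (subst form_add_left, simp_all add: cartan_in_affine coroot_in_cartan scaling_in_cartan
        complex_vector.subspace_scale[OF subspace_affine])
      (subst form_scale_left form_sum_left,
        simp_all add: cartan_in_affine coroot_in_cartan scaling_in_cartan)+
  \<comment> \<open>Weighting the vanishing products by \<open>k' i\<close> eliminates the coroot
    part, because the labels are a null vector of the Cartan matrix; what remains is \<gamma> times
    the positive sum of the labels.\<close>
  have "0 = (\<Sum>i\<le>l. of_nat (k' i) * form \<A> x (\<alpha> i))"
    using assms(2) by simp
  also have "\<dots> = (\<Sum>i\<le>l. \<gamma> * of_nat (k i) + (\<Sum>j\<le>l. t j * (of_int (a j i) * of_nat (k i))))"
    using colabel_pos
    by (intro sum.cong refl) (force simp: form form_scaling form_coroots distrib_left sum_distrib_left mult_ac)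
  also have "\<dots> = \<gamma> * of_nat (\<Sum>i\<le>l. k i) + (\<Sum>j\<le>l. t j * (\<Sum>i\<le>l. of_int (a j i) * of_nat (k i)))"
    by (simp add: sum.distrib sum_distrib_left[symmetric]) (subst sum.swap, simp add: sum_distrib_left)
  also have "\<dots> = \<gamma> * of_nat (\<Sum>i\<le>l. k i)"
    by (simp add: gcm_label_complex)
  finally have "\<gamma> * of_nat (\<Sum>i\<le>l. k i) = 0" by simp
  moreover have "(\<Sum>i\<le>l. k i) > 0"
    using label_pos by (intro sum_pos) auto
  ultimately have \<gamma>: "\<gamma> = 0"
    by (metis mult_eq_0_iff of_nat_eq_0_iff less_irrefl)
  \<comment> \<open>The form on coroots contains the factor \<open>k j / k' j\<close>. Absorbing it
    into the unknowns turns orthogonality to all coroots into the statement that \<open>u\<close> is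
    a null vector of the Cartan matrix.\<close>
  define u where "u j = t j * of_nat (k j) / of_nat (k' j)" for j
  have Au: "(\<Sum>j\<le>l. of_int (a i j) * u j) = 0" if i: "i \<le> l" for i
  proof -
    have "(\<Sum>j\<le>l. of_int (a i j) * u j) = (\<Sum>j\<le>l. t j * form \<A> (\<alpha> i) (\<alpha> j))"
      unfolding u_def using i by (intro sum.cong) (auto simp: form_coroots)
    also have "\<dots> = (\<Sum>j\<le>l. t j * form \<A> (\<alpha> j) (\<alpha> i))"
      using i by (intro sum.cong refl arg_cong2[where f = "(*)"] form_sym)
        (auto intro: cartan_in_affine coroot_in_cartan)
    finally show ?thesis using form[OF i] assms(2)[OF i] \<gamma> by simp
  qed
  have u: "u m = of_nat (k m) * (u 0 / of_nat (k 0))" if m: "m \<le> l" for m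
  proof -
    \<comment> \<open>For the unit vector at \<open>m\<close>, the rows \<open>1..l\<close> combined
      with the coefficients \<open>rho_coeff\<close> give a row supported on the columns
      \<open>m\<close> and 0. Applied to the null vector \<open>u\<close>, it ties
      \<open>u m\<close> to \<open>u 0\<close>.\<close>
    define s :: "nat \<Rightarrow> nat" where "s = (\<lambda>i. if i = m then 1 else 0)"
    have s: "gradation \<A> s" using m by (auto simp: s_def gradation_def)
    have s_if: "s i = (if i = m then 1 else 0)" for i by (simp add: s_def)
    have cox: "coxeter \<A> s = k m"
    proof -
      have "coxeter \<A> s = (\<Sum>i\<le>l. if i = m then k i else 0)"
        unfolding coxeter_def s_def by (rule sum.cong) auto
      then show ?thesis using m by simp
    qed
    have "0 = (\<Sum>i=1..l. rho_coeff \<A> s i * (\<Sum>j\<le>l. of_int (a i j) * u j))"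
      by (simp add: Au)
    also have "\<dots> = (\<Sum>j\<le>l. (\<Sum>i=1..l. rho_coeff \<A> s i * of_int (a i j)) * u j)"
      by (simp add: sum_distrib_left sum_distrib_right mult.assoc) (rule sum.swap)
    also have "\<dots> = (\<Sum>j\<le>l. (if j = m then u j / of_nat (twist \<A> * k m) else 0) -
        (if j = 0 then u j / of_nat (twist \<A> * k 0) else 0))"
      by (rule sum.cong[OF refl], subst rho_coeff_gcm[OF s], simp)
        (auto simp: cox s_if algebra_simps simp del: of_nat_mult)
    also have "\<dots> = u m / of_nat (twist \<A> * k m) - u 0 / of_nat (twist \<A> * k 0)"
      using m by (simp add: sum_subtractf)
    finally show ?thesis
      using twist_pos label_pos[OF m] label_pos[of 0] by (simp add: field_simps)
  qed
  have "t m *\<^sub>C \<alpha> m = (u 0 / of_nat (k 0)) *\<^sub>C of_nat (k' m) *\<^sub>C \<alpha> m" if m: "m \<le> l" for m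
  proof -
    have "t m = u 0 / of_nat (k 0) * of_nat (k' m)"
      using u[OF m] label_pos[OF m] colabel_pos[OF m] label_pos[of 0] unfolding u_def[of m] by (simp add: field_simps)
    then show ?thesis by (simp only: scaleC_scaleC)
  qed
  then have "(\<Sum>j\<le>l. t j *\<^sub>C \<alpha> j) = (\<Sum>j\<le>l. (u 0 / of_nat (k 0)) *\<^sub>C of_nat (k' j) *\<^sub>C \<alpha> j)"
    by (intro sum.cong) auto
  then have "x = (u 0 / of_nat (k 0)) *\<^sub>C c"
    unfolding x \<gamma> central_def complex_vector.scale_sum_right by simp
  then show ?thesis using that by blast
qed

section \<open>The degree element of a gradation\<close>

lemma form_add_right: "x \<in> L \<Longrightarrow> y \<in> L \<Longrightarrow> z \<in> L \<Longrightarrow> form \<A> z (x + y) = form \<A> z x + form \<A> z y"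
  by (metis form_add_left form_sym complex_vector.subspace_add subspace_affine)

lemma form_scale_right: "x \<in> L \<Longrightarrow> y \<in> L \<Longrightarrow> form \<A> x (t *\<^sub>C y) = t * form \<A> x y"
  by (metis form_scale_left form_sym complex_vector.subspace_scale subspace_affine)

text \<open>As \<open>c\<close> is isotropic, the square changes only linearly with \<tau>. For a
  degree element the slope is \<open>2 * coxeter \<A> s\<close>, which is nonzero, so the condition
  of square zero selects exactly one multiple of \<open>c\<close>.\<close>

lemma form_shift_central:
  assumes "x \<in> H"
  shows "form \<A> (x + \<tau> *\<^sub>C c) (x + \<tau> *\<^sub>C c) = form \<A> x x + 2 * \<tau> * form \<A> x c"
proof -
  have "x \<in> L" "c \<in> L" "\<tau> *\<^sub>C c \<in> L" "x + \<tau> *\<^sub>C c \<in> L"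
    using assms central_in_cartan
    by (auto intro: cartan_in_affine complex_vector.subspace_scale[OF subspace_affine]
        complex_vector.subspace_add[OF subspace_affine])
  then show ?thesis
    by (simp add: form_add_left form_add_right form_scale_left form_scale_right form_central_central
        form_sym[of c x])
qed

text \<open>The predicate under the definite description in \<open>degree_elt\<close>, named so that
  existence and uniqueness can be stated for it.\<close>

definition degree_element :: "(nat \<Rightarrow> nat) \<Rightarrow> 'a \<Rightarrow> bool" where
  "degree_element s x \<longleftrightarrow> x \<in> H \<and> form \<A> x x = 0 \<and>
     (\<forall>i\<le>l. form \<A> x (\<alpha> i) = of_nat (k i * s i) / of_nat (k' i))"

lemma form_degree_central:
  assumes "x \<in> H" "\<forall>i\<le>l. form \<A> x (\<alpha> i) = of_nat (k i * s i) / of_nat (k' i)"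
  shows "form \<A> x c = of_nat (coxeter \<A> s)"
proof -
  have "form \<A> x c = (\<Sum>i\<le>l. of_nat (k' i) * form \<A> x (\<alpha> i))"
    by (rule form_with_central[OF assms(1)])
  also have "\<dots> = (\<Sum>i\<le>l. of_nat (k i * s i))"
    using assms(2) colabel_pos by (intro sum.cong) force+
  finally show ?thesis by (simp add: coxeter_def)
qed

lemma degree_element_unique:
  assumes s: "gradation \<A> s" and "degree_element s x" "degree_element s y"
  shows "x = y"
proof -
  have H: "x \<in> H" "y \<in> H" using assms unfolding degree_element_def by auto
  have "x - y \<in> H" using H by (simp add: complex_vector.subspace_diff subspace_cartan)
  moreover have "form \<A> (x - y) (\<alpha> i) = 0" if "i \<le> l" for i
  proof -
    have "form \<A> (x - y + y) (\<alpha> i) = form \<A> (x - y) (\<alpha> i) + form \<A> y (\<alpha> i)"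
      using \<open>x - y \<in> H\<close> H that by (intro form_add_left cartan_in_affine coroot_in_cartan) auto
    then show ?thesis using assms that unfolding degree_element_def by simp
  qed
  ultimately obtain \<tau> where "x - y = \<tau> *\<^sub>C c" by (rule cartan_kernel)
  then have x: "x = y + \<tau> *\<^sub>C c" by (metis add.commute diff_add_cancel)
  have "form \<A> x x = form \<A> y y + 2 * \<tau> * form \<A> y c"
    unfolding x by (rule form_shift_central[OF H(2)])
  then have "\<tau> * of_nat (coxeter \<A> s) = 0"
    using assms form_degree_central[of y s] unfolding degree_element_def by simp
  then show ?thesis using coxeter_pos[OF s] x by simp
qed

lemma degree_element_exists:
  assumes s: "gradation \<A> s"
  shows "\<exists>x. degree_element s x"
proof -
  let ?p = "principal_grad" and ?h = "of_nat (coxeter \<A> s) / of_nat (coxeter \<A> principal_grad) :: complex"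
  \<comment> \<open>In the difference of the two relations \<open>rho_coeff_gcm\<close> the term at
    index 0 cancels. After multiplication by the period it leaves \<open>s i - ?h\<close>, and the
    multiple \<open>?h\<close> of \<open>d\<close> supplies the missing \<open>?h\<close>.\<close>
  define r where "r = (\<lambda>j. of_nat (period \<A> s) * (rho_coeff \<A> s j - rho_coeff \<A> ?p j))"
  define x where "x = ?h *\<^sub>C d + (\<Sum>j=1..l. r j *\<^sub>C \<alpha> j)"
  have sumH: "(\<Sum>j=1..l. r j *\<^sub>C \<alpha> j) \<in> H"
    by (intro complex_vector.subspace_sum complex_vector.subspace_scale subspace_cartan coroot_in_cartan) auto
  then have xH: "x \<in> H"
    unfolding x_def
    by (intro complex_vector.subspace_add complex_vector.subspace_scale subspace_cartan scaling_in_cartan)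
  have form: "form \<A> x (\<alpha> i) = of_nat (k i * s i) / of_nat (k' i)" if i: "i \<le> l" for i
  proof -
    have "form \<A> x (\<alpha> i) = ?h * form \<A> d (\<alpha> i) + (\<Sum>j=1..l. r j * form \<A> (\<alpha> j) (\<alpha> i))"
      unfolding x_def using i sumH
      by (subst form_add_left, simp_all add: cartan_in_affine coroot_in_cartan scaling_in_cartan
          complex_vector.subspace_scale[OF subspace_affine])
        (subst form_scale_left form_sum_left,
          simp_all add: cartan_in_affine coroot_in_cartan scaling_in_cartan)+
    also have "\<dots> = (?h + (\<Sum>j=1..l. r j * of_int (a j i))) * (of_nat (k i) / of_nat (k' i))"
      using i by (simp add: form_coroots form_scaling distrib_right distrib_left sum_distrib_left
          sum_divide_distrib add_divide_distrib mult_ac)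
    also have "(\<Sum>j=1..l. r j * of_int (a j i)) = of_nat (period \<A> s) *
        ((\<Sum>j=1..l. rho_coeff \<A> s j * of_int (a j i)) - (\<Sum>j=1..l. rho_coeff \<A> ?p j * of_int (a j i)))"
      unfolding r_def by (simp add: sum_distrib_left sum_subtractf[symmetric] algebra_simps)
    also have "\<dots> = of_nat (s i) - ?h"
      unfolding rho_coeff_gcm[OF s i] rho_coeff_gcm[OF gradation_principal i]
      using coxeter_pos[OF s] coxeter_pos[OF gradation_principal] twist_pos
      by (simp add: field_simps principal_grad_def)
    finally show ?thesis by (simp add: mult_ac)
  qed
  \<comment> \<open>The solution of the linear equation in \<open>form_shift_central\<close>, where
    the product of \<open>x\<close> with \<open>c\<close> is \<open>coxeter \<A> s\<close>.\<close>
  define \<tau> where "\<tau> = - form \<A> x x / (2 * of_nat (coxeter \<A> s))"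
  have "form \<A> (x + \<tau> *\<^sub>C c) (x + \<tau> *\<^sub>C c) = 0"
    using form_shift_central[OF xH, of \<tau>] form_degree_central[OF xH, of s] form coxeter_pos[OF s]
    by (simp add: \<tau>_def)
  moreover have "form \<A> (x + \<tau> *\<^sub>C c) (\<alpha> i) = form \<A> x (\<alpha> i)" if "i \<le> l" for i
    using that xH central_in_cartan
    by (subst form_add_left) (auto simp: form_scale_left form_central_coroot cartan_in_affine coroot_in_cartan
        complex_vector.subspace_scale[OF subspace_affine])
  moreover have "x + \<tau> *\<^sub>C c \<in> H"
    by (intro complex_vector.subspace_add complex_vector.subspace_scale subspace_cartan xH central_in_cartan)
  ultimately show ?thesis using form unfolding degree_element_def by (intro exI[of _ "x + \<tau> *\<^sub>C c"]) auto
qed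

lemma degree_elt: "gradation \<A> s \<Longrightarrow> degree_element s (degree_elt \<A> s)"
  using theI'[of "degree_element s"] degree_element_exists degree_element_unique
  unfolding degree_elt_def degree_element_def[symmetric, abs_def] by blast

lemma degree_elt_in_cartan: "gradation \<A> s \<Longrightarrow> degree_elt \<A> s \<in> H"
  using degree_elt unfolding degree_element_def by blast

lemma degree_elt_principal: "degree_elt \<A> principal_grad = d"
proof (rule degree_element_unique[OF gradation_principal degree_elt[OF gradation_principal]])
  show "degree_element principal_grad d"
    by (simp add: degree_element_def scaling_in_cartan form_scaling form_scaling_scaling principal_grad_def)
qed

lemma degree_elt_generators:
  assumes "gradation \<A> s" "i \<le> l"
  shows "lie (degree_elt \<A> s) (e i) = of_nat (s i) *\<^sub>C e i"
    and "lie (degree_elt \<A> s) (f i) = - (of_nat (s i) *\<^sub>C f i)"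
  using cartan_generators[OF degree_elt_in_cartan[OF assms(1)] assms(2)] degree_elt[OF assms(1)] assms(2)
    label_pos[OF assms(2)] colabel_pos[OF assms(2)]
  unfolding degree_element_def by simp_all

end

section \<open>Monomials in the generators\<close>

inductive_set brackets :: "nat \<Rightarrow> (nat \<Rightarrow> 'a::complex_lie_algebra) \<Rightarrow> 'a set" for n g where
  generator: "i \<le> n \<Longrightarrow> g i \<in> brackets n g"
| bracket: "i \<le> n \<Longrightarrow> x \<in> brackets n g \<Longrightarrow> lie (g i) x \<in> brackets n g"

lemma brackets_weight:
  assumes "x \<in> brackets n g" "\<And>i. i \<le> n \<Longrightarrow> \<exists>w. lie h (g i) = w *\<^sub>C g i"
  shows "\<exists>w. lie h x = w *\<^sub>C x"
  using assms(1)
proof induction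
  case (bracket i x)
  obtain w w' where "lie h (g i) = w *\<^sub>C g i" "lie h x = w' *\<^sub>C x"
    using assms(2)[OF bracket(1)] bracket(3) by blast
  then have "lie h (lie (g i) x) = (w + w') *\<^sub>C lie (g i) x"
    by (subst lie_derivation) (simp add: lie_scale_left lie_scale_right scaleC_add_left)
  then show ?case by blast
qed (rule assms(2))

text \<open>Moving the opposite generator past the first factor leaves a term in which an element of
  \<open>H\<close> scales the remaining monomial, and a term covered by the induction. The span has
  to include \<open>H\<close> because a monomial of length one already produces an element of
  \<open>H\<close>.\<close>

lemma lie_opposite_brackets:
  fixes g g' :: "nat \<Rightarrow> 'a::complex_lie_algebra"
  assumes x: "x \<in> brackets n g" and i: "i \<le> n"
    and weight: "\<And>h j. h \<in> H \<Longrightarrow> j \<le> n \<Longrightarrow> \<exists>w. lie h (g j) = w *\<^sub>C g j"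
    and cross: "\<And>j. j \<le> n \<Longrightarrow> lie (g' i) (g j) \<in> H"
  shows "lie (g' i) x \<in> complex_vector.span (brackets n g \<union> H)"
  using x
proof induction
  case (generator j)
  then show ?case by (auto intro: complex_vector.span_base cross)
next
  case (bracket j x)
  have "\<exists>w. lie (lie (g' i) (g j)) x = w *\<^sub>C x"
    using bracket(2) weight[OF cross[OF bracket(1)]] by (rule brackets_weight)
  then have "lie (lie (g' i) (g j)) x \<in> complex_vector.span (brackets n g \<union> H)"
    using bracket(2) by (auto intro!: complex_vector.span_scale intro: complex_vector.span_base)
  moreover have "lie (g j) (lie (g' i) x) \<in> complex_vector.span (brackets n g \<union> H)"
  proof (rule lie_span_right_mem[OF bracket(3) complex_vector.subspace_span])
    fix y assume y: "y \<in> brackets n g \<union> H"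
    show "lie (g j) y \<in> complex_vector.span (brackets n g \<union> H)"
    proof (cases "y \<in> brackets n g")
      case True
      then show ?thesis
        using brackets.bracket[OF bracket(1)] by (auto intro: complex_vector.span_base)
    next
      case False
      then obtain w where "lie y (g j) = w *\<^sub>C g j"
        using y weight bracket(1) by blast
      then have "lie (g j) y = (- w) *\<^sub>C g j" by (simp add: lie_antisym[of "g j" y])
      then show ?thesis
        using brackets.generator[OF bracket(1)]
        by (metis UnI1 complex_vector.span_base complex_vector.span_scale)
    qed
  qed
  ultimately show ?case
    by (subst lie_derivation) (rule complex_vector.span_add)
qed

context affine_realization
begin

text \<open>The subalgebra \<open>M\<close> generated by the \<open>e i\<close> and
  \<open>f i\<close> is stable under \<open>ad d\<close>. Adding the line of \<open>d\<close>
  therefore gives a subalgebra that contains all of \<open>L\<close>, and its brackets fall back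
  into \<open>M\<close>.\<close>

lemma derived_generated: "\<g> \<subseteq> lie_subalgebra hull (e ` {..l} \<union> f ` {..l})"
proof -
  let ?G = "e ` {..l} \<union> f ` {..l}"
  define M where "M = lie_subalgebra hull ?G"
  have M: "complex_vector.subspace M" "\<And>x y. x \<in> M \<Longrightarrow> y \<in> M \<Longrightarrow> lie x y \<in> M"
    using lie_subalgebra_hull[of ?G] unfolding M_def lie_subalgebra_def by auto
  have G: "?G \<subseteq> M" unfolding M_def by (rule hull_subset)
  note sub = M(1)[THEN complex_vector.subspace_add] M(1)[THEN complex_vector.subspace_scale]
    M(1)[THEN complex_vector.subspace_0] M(1)[THEN complex_vector.subspace_neg]
  have "lie_subalgebra {x \<in> M. lie d x \<in> M}"
    unfolding lie_subalgebra_def complex_vector.subspace_def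
    using M sub by (auto simp: lie_add_right lie_scale_right lie_derivation[of d])
  moreover have "?G \<subseteq> {x \<in> M. lie d x \<in> M}"
    using G sub by (auto simp: scaling_generators)
  ultimately have "M \<subseteq> {x \<in> M. lie d x \<in> M}"
    unfolding M_def by (intro hull_minimal)
  then have dM: "x \<in> M \<Longrightarrow> lie d x \<in> M" "x \<in> M \<Longrightarrow> lie x d \<in> M" for x
    using sub lie_antisym[of x d] by auto
  define N where "N = {x + t *\<^sub>C d |x t. x \<in> M}"
  have lieN: "lie x y \<in> M" if xy: "x \<in> N" "y \<in> N" for x y
  proof -
    obtain x' t y' u where "x = x' + t *\<^sub>C d" "y = y' + u *\<^sub>C d" "x' \<in> M" "y' \<in> M"
      using xy unfolding N_def by blast
    then show ?thesis
      using M(2) dM sub by (simp add: lie_add_left lie_add_right lie_scale_left lie_scale_right lie_self)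
  qed
  have MN: "M \<subseteq> N" unfolding N_def by (force intro: exI[of _ 0])
  have "complex_vector.subspace N"
    unfolding complex_vector.subspace_def
  proof (intro conjI ballI allI)
    show "0 \<in> N" using MN sub(3) by blast
  next
    fix x y assume "x \<in> N" "y \<in> N"
    then obtain x' t y' u where "x = x' + t *\<^sub>C d" "y = y' + u *\<^sub>C d" "x' \<in> M" "y' \<in> M"
      unfolding N_def by blast
    then have "x + y = (x' + y') + (t + u) *\<^sub>C d" "x' + y' \<in> M"
      using sub by (auto simp: scaleC_add_left)
    then show "x + y \<in> N" unfolding N_def by blast
  next
    fix b x assume "x \<in> N"
    then obtain x' t where "x = x' + t *\<^sub>C d" "x' \<in> M" unfolding N_def by blast
    then have "b *\<^sub>C x = b *\<^sub>C x' + (b * t) *\<^sub>C d" "b *\<^sub>C x' \<in> M"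
      using sub by (auto simp: scaleC_add_right scaleC_scaleC)
    then show "b *\<^sub>C x \<in> N" unfolding N_def by blast
  qed
  moreover have "x \<in> N" if "x \<in> H" for x
  proof -
    have "\<alpha> i \<in> M" if "i \<le> l" for i
      unfolding coroot_def using M(2) G that by blast
    moreover obtain \<gamma> t where "x = \<gamma> *\<^sub>C d + (\<Sum>j\<le>l. t j *\<^sub>C \<alpha> j)"
      using cartan_expand[OF \<open>x \<in> H\<close>] .
    ultimately have "x = (\<Sum>j\<le>l. t j *\<^sub>C \<alpha> j) + \<gamma> *\<^sub>C d" "(\<Sum>j\<le>l. t j *\<^sub>C \<alpha> j) \<in> M"
      by (auto simp: add.commute intro!: complex_vector.subspace_sum[OF M(1)] sub)
    then show ?thesis unfolding N_def by blast
  qed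
  ultimately have "L \<subseteq> N"
    unfolding affine_algebra_def using G MN lieN
    by (intro hull_minimal) (auto simp: lie_subalgebra_def)
  then show ?thesis
    unfolding derived_affine_def derived_algebra_def M_def[symmetric]
    by (intro complex_vector.span_minimal M(1)) (use lieN in blast)
qed

section \<open>The gradation \<open>s\<close>, its two halves and the projections\<close>

context
  fixes s :: "nat \<Rightarrow> nat"
  assumes s: "gradation \<A> s"
begin

text \<open>Both sides are derivations with the same values on the generators, and a derivation that
  kills the generators kills the algebra generated by them. The gradation thereby becomes the one by
  powers of z in the loop realization.\<close>

lemma lie_degree_elt:
  assumes "x \<in> \<g>"
  shows "lie (degree_elt \<A> s) x = (- of_nat (period \<A> s)) *\<^sub>C lie (virasoro \<A> s 0) x"
proof -
  define D where "D = degree_elt \<A> s + of_nat (period \<A> s) *\<^sub>C virasoro \<A> s 0"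
  have P: "(of_nat (period \<A> s) :: complex) \<noteq> 0" by (rule period_ne[OF s])
  have "lie_subalgebra {x. lie D x = 0}"
    unfolding lie_subalgebra_def complex_vector.subspace_def
    by (auto simp: lie_add_right lie_scale_right lie_derivation[of D])
  moreover have "e ` {..l} \<union> f ` {..l} \<subseteq> {x. lie D x = 0}"
    using P by (auto simp: D_def lie_add_left lie_scale_left degree_elt_generators[OF s]
        virasoro_zero_generators[OF s] scaleC_scaleC)
  ultimately have "\<g> \<subseteq> {x. lie D x = 0}"
    using derived_generated hull_minimal[of "e ` {..l} \<union> f ` {..l}" "{x. lie D x = 0}" lie_subalgebra]
    by (metis subset_trans)
  then have "lie D x = 0" using assms by blast
  then show ?thesis
    by (simp add: D_def lie_add_left lie_scale_left eq_neg_iff_add_eq_0)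
qed

lemma lie_graded_part:
  "x \<in> graded_part \<A> s m \<Longrightarrow> y \<in> graded_part \<A> s n \<Longrightarrow> lie x y \<in> graded_part \<A> s (m + n)"
  unfolding graded_part_def
  by (auto simp: lie_derived lie_derivation[of "degree_elt \<A> s"] lie_scale_left lie_scale_right
      scaleC_add_left)

lemma cartan_graded_part: "x \<in> H \<Longrightarrow> x \<in> \<g> \<Longrightarrow> x \<in> graded_part \<A> s 0"
  unfolding graded_part_def by (simp add: cartan_abelian degree_elt_in_cartan[OF s])

lemma zpow_graded_part:
  assumes "loop_degree \<A> s m u"
  shows "loop_iso \<A> s (zpow m u) \<in> graded_part \<A> s m"
proof -
  have "loop_iso \<A> s (zpow m u) \<in> \<g>"
    by (intro loop_iso_derived[OF s] zpow_in_loop_algebra assms)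
  then show ?thesis
    using period_ne[OF s]
    by (simp add: graded_part_def lie_degree_elt virasoro_zpow[OF s assms] scaleC_scaleC)
qed

text \<open>The loop derivation multiplies the coefficient in degree \<open>n\<close> by a multiple
  of \<open>n\<close> and kills the central term. An eigenvector hence has a single coefficient, and
  a central term only in degree 0.\<close>

lemma graded_part_loop:
  assumes "x \<in> graded_part \<A> s m"
  obtains u t where "loop_degree \<A> s m u" "x = loop_iso \<A> s (zpow m u) + t *\<^sub>C c" "m \<noteq> 0 \<Longrightarrow> t = 0"
proof -
  let ?P = "of_nat (period \<A> s) :: complex"
  have x: "x \<in> \<g>" "lie (degree_elt \<A> s) x = of_int m *\<^sub>C x"
    using assms by (auto simp: graded_part_def)
  obtain y where y: "y \<in> loop_algebra \<A> s" "x = loop_iso \<A> s y"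
    using derived_loop_iso[OF s x(1)] .
  let ?p = "Poly_Mapping.lookup (fst y)"
  have "loop_iso \<A> s (loop_scale (- ?P) (loop_derivation \<A> s 0 y)) = loop_iso \<A> s (loop_scale (of_int m) y)"
    using x y by (simp add: lie_degree_elt virasoro_loop[OF s] loop_iso_scale[OF s] loop_derivation_in_loop_algebra)
  then have eq: "loop_scale (- ?P) (loop_derivation \<A> s 0 y) = loop_scale (of_int m) y"
    by (intro loop_iso_eqD[OF s] loop_algebra_scale loop_derivation_in_loop_algebra y(1))
  have p: "?p n = 0" if "n \<noteq> m" for n
  proof -
    have "of_int n *\<^sub>C ?p n = of_int m *\<^sub>C ?p n"
      using arg_cong[OF eq, of "\<lambda>z. Poly_Mapping.lookup (fst z) n"] period_ne[OF s]
      by (simp add: lookup_loop_scale lookup_loop_derivation scaleC_scaleC)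
    then show ?thesis using that by (simp add: complex_vector.scale_cancel_right)
  qed
  have "of_int m * snd y = 0"
    using arg_cong[OF eq, of snd] by (simp add: snd_loop_scale loop_derivation_def)
  moreover have "y = zpow m (?p m) + (0, snd y)"
    unfolding zpow_def using p
    by (intro prod_eqI poly_mapping_eqI) (auto simp: lookup_add lookup_single when_def)
  moreover have deg: "loop_degree \<A> s m (?p m)"
    using y(1) by (cases y) (auto simp: loop_algebra_def)
  ultimately show ?thesis
    using that[of "?p m" "snd y"] y(2)
      loop_iso_add[OF s zpow_in_loop_algebra[OF deg] constant_in_loop_algebra[of "snd y"]]
      loop_iso_constant[OF s, of "snd y"]
    by auto
qed

lemma subspace_neg_space: "complex_vector.subspace (neg_space \<A> s)"
  and subspace_nonneg_space: "complex_vector.subspace (nonneg_space \<A> s)"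
  unfolding neg_space_def nonneg_space_def by (rule complex_vector.subspace_span)+

lemma graded_part_neg_space: "m < 0 \<Longrightarrow> x \<in> graded_part \<A> s m \<Longrightarrow> x \<in> neg_space \<A> s"
  and graded_part_nonneg_space: "m \<ge> 0 \<Longrightarrow> x \<in> graded_part \<A> s m \<Longrightarrow> x \<in> nonneg_space \<A> s"
  unfolding neg_space_def nonneg_space_def by (auto intro!: complex_vector.span_base)

lemma neg_space_derived: "x \<in> neg_space \<A> s \<Longrightarrow> x \<in> \<g>"
  and nonneg_space_derived: "x \<in> nonneg_space \<A> s \<Longrightarrow> x \<in> \<g>"
proof -
  have "neg_space \<A> s \<subseteq> \<g>" "nonneg_space \<A> s \<subseteq> \<g>"
    unfolding neg_space_def nonneg_space_def
    by (intro complex_vector.span_minimal subspace_derived; auto simp: graded_part_def)+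
  then show "x \<in> neg_space \<A> s \<Longrightarrow> x \<in> \<g>" "x \<in> nonneg_space \<A> s \<Longrightarrow> x \<in> \<g>" by auto
qed

lemma lie_neg_space:
  assumes "x \<in> neg_space \<A> s" "y \<in> neg_space \<A> s"
  shows "lie x y \<in> neg_space \<A> s"
proof (rule lie_span_mem[OF assms[unfolded neg_space_def] subspace_neg_space])
  fix x y assume "x \<in> (\<Union>m\<in>{m. m < 0}. graded_part \<A> s m)" "y \<in> (\<Union>m\<in>{m. m < 0}. graded_part \<A> s m)"
  then obtain m n where "m < 0" "x \<in> graded_part \<A> s m" "n < 0" "y \<in> graded_part \<A> s n" by blast
  then show "lie x y \<in> neg_space \<A> s"
    by (intro graded_part_neg_space[OF _ lie_graded_part]) auto
qed

lemma lie_nonneg_space: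
  assumes "x \<in> nonneg_space \<A> s" "y \<in> nonneg_space \<A> s"
  shows "lie x y \<in> nonneg_space \<A> s"
proof (rule lie_span_mem[OF assms[unfolded nonneg_space_def] subspace_nonneg_space])
  fix x y assume "x \<in> (\<Union>m\<in>{m. m \<ge> 0}. graded_part \<A> s m)" "y \<in> (\<Union>m\<in>{m. m \<ge> 0}. graded_part \<A> s m)"
  then obtain m n where "m \<ge> 0" "x \<in> graded_part \<A> s m" "n \<ge> 0" "y \<in> graded_part \<A> s n" by blast
  then show "lie x y \<in> nonneg_space \<A> s"
    by (intro graded_part_nonneg_space[OF _ lie_graded_part]) auto
qed

text \<open>Spans of graded parts correspond to loops with restricted support; the last clause
  reflects that \<open>c\<close> has degree 0.\<close>

lemma span_graded_loop:
  assumes "x \<in> complex_vector.span (\<Union>m\<in>M. graded_part \<A> s m)"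
  obtains y where "y \<in> loop_algebra \<A> s" "x = loop_iso \<A> s y"
    "\<And>m. m \<notin> M \<Longrightarrow> Poly_Mapping.lookup (fst y) m = 0" "0 \<notin> M \<Longrightarrow> snd y = 0"
proof -
  have "\<exists>y\<in>loop_algebra \<A> s. x = loop_iso \<A> s y \<and>
    (\<forall>m. m \<notin> M \<longrightarrow> Poly_Mapping.lookup (fst y) m = 0) \<and> (0 \<notin> M \<longrightarrow> snd y = 0)"
    using assms
  proof (induction rule: complex_vector.span_induct_alt)
    case base
    show ?case
      by (rule bexI[of _ 0]) (auto simp: loop_iso_zero[OF s] zero_in_loop_algebra)
  next
    case (step b x z)
    then obtain m where m: "m \<in> M" "x \<in> graded_part \<A> s m" by blast
    obtain u t where u: "loop_degree \<A> s m u" "x = loop_iso \<A> s (zpow m u) + t *\<^sub>C c" "m \<noteq> 0 \<Longrightarrow> t = 0"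
      using graded_part_loop[OF m(2)] by blast
    obtain y where y: "y \<in> loop_algebra \<A> s" "z = loop_iso \<A> s y"
        "\<forall>m. m \<notin> M \<longrightarrow> Poly_Mapping.lookup (fst y) m = 0" "0 \<notin> M \<longrightarrow> snd y = 0"
      using step by blast
    let ?w = "zpow m u + (0, t)"
    have w: "?w \<in> loop_algebra \<A> s" "loop_iso \<A> s ?w = x"
      using u zpow_in_loop_algebra[OF u(1)] constant_in_loop_algebra[of t s]
      by (auto simp: loop_algebra_add loop_iso_add[OF s] loop_iso_constant[OF s])
    show ?case
    proof (rule bexI[of _ "loop_scale b ?w + y"], intro conjI allI impI)
      show "b *\<^sub>C x + z = loop_iso \<A> s (loop_scale b ?w + y)"
        using w y by (simp add: loop_iso_add[OF s] loop_iso_scale[OF s] loop_algebra_scale)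
      show "Poly_Mapping.lookup (fst (loop_scale b ?w + y)) n = 0" if "n \<notin> M" for n
        using that m(1) y(3) by (auto simp: lookup_add lookup_loop_scale zpow_def lookup_single when_def)
      show "snd (loop_scale b ?w + y) = 0" if "0 \<notin> M"
        using that m(1) y(4) u(3) by (auto simp: snd_loop_scale zpow_def)
    qed (intro loop_algebra_add loop_algebra_scale w y(1))
  qed
  then show ?thesis using that by blast
qed

text \<open>The two loops that represent \<open>x\<close> agree because the realization is
  injective, but their supports are disjoint. The central term vanishes since it cannot occur on the
  negative side.\<close>

lemma neg_nonneg_space_disjoint:
  assumes "x \<in> neg_space \<A> s" "x \<in> nonneg_space \<A> s"
  shows "x = 0"
proof -
  obtain y where y: "y \<in> loop_algebra \<A> s" "x = loop_iso \<A> s y"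
      "\<And>m. m \<notin> {m. m < 0} \<Longrightarrow> Poly_Mapping.lookup (fst y) m = 0" "0 \<notin> {m::int. m < 0} \<Longrightarrow> snd y = 0"
    using span_graded_loop[OF assms(1)[unfolded neg_space_def]] by blast
  obtain z where z: "z \<in> loop_algebra \<A> s" "x = loop_iso \<A> s z"
      "\<And>m. m \<notin> {m. m \<ge> 0} \<Longrightarrow> Poly_Mapping.lookup (fst z) m = 0"
    using span_graded_loop[OF assms(2)[unfolded nonneg_space_def]] by blast
  have "y = z" using y z by (intro loop_iso_eqD[OF s]) auto
  with y z have "Poly_Mapping.lookup (fst y) m = 0" for m by (cases "m < 0") auto
  then have "y = 0"
    using y(4) by (intro prod_eqI poly_mapping_eqI) auto
  then show ?thesis using y(2) loop_iso_zero[OF s] by simp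
qed

lemma derived_decompose:
  assumes "x \<in> \<g>"
  obtains y z where "y \<in> neg_space \<A> s" "z \<in> nonneg_space \<A> s" "x = y + z"
proof -
  obtain w where w: "w \<in> loop_algebra \<A> s" "x = loop_iso \<A> s w"
    using derived_loop_iso[OF s assms] .
  let ?p = "Poly_Mapping.lookup (fst w)" and ?K = "Poly_Mapping.keys (fst w)"
  have deg: "loop_degree \<A> s m (?p m)" for m
    using w(1) by (cases w) (auto simp: loop_algebra_def)
  have fst_sum: "fst (sum g I) = (\<Sum>i\<in>I. fst (g i))" "snd (sum g I) = (\<Sum>i\<in>I. snd (g i))"
    for g :: "int \<Rightarrow> 'b loop" and I
    by (induction I rule: infinite_finite_induct) auto
  have "w = (\<Sum>m\<in>?K. zpow m (?p m)) + (0, snd w)"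
  proof (intro prod_eqI poly_mapping_eqI)
    fix n
    have "(\<Sum>m\<in>?K. Poly_Mapping.lookup (Poly_Mapping.single m (?p m)) n) = (\<Sum>m\<in>?K. if m = n then ?p n else 0)"
      by (rule sum.cong) (auto simp: lookup_single when_def)
    then show "?p n = Poly_Mapping.lookup (fst ((\<Sum>m\<in>?K. zpow m (?p m)) + (0, snd w))) n"
      by (simp add: fst_sum zpow_def lookup_sum in_keys_iff)
  qed (simp add: fst_sum zpow_def)
  then have "x = loop_iso \<A> s ((\<Sum>m\<in>?K. zpow m (?p m)) + (0, snd w))"
    using w(2) by simp
  also have "\<dots> = (\<Sum>m\<in>?K. loop_iso \<A> s (zpow m (?p m))) + snd w *\<^sub>C c"
    using loop_iso_sum[OF s, of ?K "\<lambda>m. zpow m (?p m)"] zpow_in_loop_algebra[OF deg]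
    by (simp add: loop_iso_add[OF s] constant_in_loop_algebra loop_iso_constant[OF s])
  also have "(\<Sum>m\<in>?K. loop_iso \<A> s (zpow m (?p m))) =
      (\<Sum>m\<in>?K \<inter> {m. m < 0}. loop_iso \<A> s (zpow m (?p m))) +
      (\<Sum>m\<in>?K - {m. m < 0}. loop_iso \<A> s (zpow m (?p m)))"
    by (rule sum.Int_Diff) simp
  finally have "x = (\<Sum>m\<in>?K \<inter> {m. m < 0}. loop_iso \<A> s (zpow m (?p m))) +
      ((\<Sum>m\<in>?K - {m. m < 0}. loop_iso \<A> s (zpow m (?p m))) + snd w *\<^sub>C c)"
    by (simp add: add.assoc)
  moreover have "(\<Sum>m\<in>?K \<inter> {m. m < 0}. loop_iso \<A> s (zpow m (?p m))) \<in> neg_space \<A> s"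
    by (intro complex_vector.subspace_sum subspace_neg_space)
      (auto intro: graded_part_neg_space zpow_graded_part deg)
  moreover have "(\<Sum>m\<in>?K - {m. m < 0}. loop_iso \<A> s (zpow m (?p m))) \<in> nonneg_space \<A> s"
    by (intro complex_vector.subspace_sum subspace_nonneg_space)
      (auto intro: graded_part_nonneg_space[OF _ zpow_graded_part[OF deg]])
  moreover have "snd w *\<^sub>C c \<in> nonneg_space \<A> s"
    by (intro complex_vector.subspace_scale subspace_nonneg_space graded_part_nonneg_space[OF order_refl]
        cartan_graded_part central_in_cartan central_in_derived)
  ultimately show ?thesis
    using that complex_vector.subspace_add[OF subspace_nonneg_space] by blast
qed

lemma projections:
  assumes "y \<in> neg_space \<A> s" "z \<in> nonneg_space \<A> s"
  shows "neg_proj \<A> s (y + z) = y" "nonneg_proj \<A> s (y + z) = z"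
proof -
  have unique: "y' = y \<and> z' = z" if "y' \<in> neg_space \<A> s" "z' \<in> nonneg_space \<A> s" "y' + z' = y + z" for y' z'
  proof -
    have eq: "y' - y = z - z'" using that(3) by (simp add: algebra_simps)
    have "y' - y \<in> neg_space \<A> s" "z - z' \<in> nonneg_space \<A> s"
      using that assms subspace_neg_space subspace_nonneg_space by (auto intro: complex_vector.subspace_diff)
    then have "y' - y = 0" unfolding eq by (rule neg_nonneg_space_disjoint)
    then show ?thesis using that(3) by simp
  qed
  show "neg_proj \<A> s (y + z) = y"
    unfolding neg_proj_def
  proof (rule the_equality)
    show "w = y" if "w \<in> neg_space \<A> s \<and> y + z - w \<in> nonneg_space \<A> s" for w
      by (rule unique[of w "y + z - w", THEN conjunct1]) (use that in simp_all)
  qed (use assms in simp)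
  show "nonneg_proj \<A> s (y + z) = z"
    unfolding nonneg_proj_def
  proof (rule the_equality)
    show "w = z" if "w \<in> nonneg_space \<A> s \<and> y + z - w \<in> neg_space \<A> s" for w
      by (rule unique[of "y + z - w" w, THEN conjunct2]) (use that in simp_all)
  qed (use assms in simp)
qed

text \<open>Being a definite description, \<open>neg_proj\<close> is controlled only on
  \<open>\<g>\<close>. Composing it with a linear projection onto \<open>\<g>\<close> gives a linear
  map on the whole ambient space, the form in which \<open>has_curve_derivative_linear\<close> can
  use it.\<close>

lemma linear_projection:
  obtains Q where "Vector_Spaces.linear scaleC scaleC Q"
    "\<And>x. x \<in> \<g> \<Longrightarrow> neg_proj \<A> s x = Q x" "\<And>x. x \<in> \<g> \<Longrightarrow> nonneg_proj \<A> s x = x - Q x"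
    "\<And>x. x \<in> neg_space \<A> s \<Longrightarrow> Q x = x" "\<And>x. x \<in> nonneg_space \<A> s \<Longrightarrow> Q x = 0"
    "\<And>x. Q x \<in> neg_space \<A> s" "\<And>x. x \<in> \<g> \<Longrightarrow> x - Q x \<in> nonneg_space \<A> s"
proof -
  have pair: "vector_space_pair (scaleC :: complex \<Rightarrow> 'a \<Rightarrow> 'a) (scaleC :: complex \<Rightarrow> 'a \<Rightarrow> 'a)"
    by unfold_locales
  have "Vector_Spaces.linear scaleC scaleC (id :: 'a \<Rightarrow> 'a)"
    by (simp add: linear_scaleC_iff)
  from vector_space_pair.linear_exists_left_inverse_on[OF pair this subspace_derived]
  obtain \<pi> :: "'a \<Rightarrow> 'a" where \<pi>: "range \<pi> \<subseteq> \<g>" "Vector_Spaces.linear scaleC scaleC \<pi>" "\<And>x. x \<in> \<g> \<Longrightarrow> \<pi> x = x"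
    by auto
  define Q where "Q x = neg_proj \<A> s (\<pi> x)" for x
  have \<pi>g: "\<pi> x \<in> \<g>" for x using \<pi>(1) by auto
  have add: "neg_proj \<A> s (x + y) = neg_proj \<A> s x + neg_proj \<A> s y" if xy: "x \<in> \<g>" "y \<in> \<g>" for x y
  proof -
    obtain x1 x2 where x: "x1 \<in> neg_space \<A> s" "x2 \<in> nonneg_space \<A> s" "x = x1 + x2"
      using derived_decompose[OF xy(1)] .
    obtain y1 y2 where y: "y1 \<in> neg_space \<A> s" "y2 \<in> nonneg_space \<A> s" "y = y1 + y2"
      using derived_decompose[OF xy(2)] .
    have "neg_proj \<A> s ((x1 + y1) + (x2 + y2)) = x1 + y1"
      by (intro projections complex_vector.subspace_add subspace_neg_space subspace_nonneg_space x y)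
    then show ?thesis using x y by (simp add: projections algebra_simps)
  qed
  have scale: "neg_proj \<A> s (t *\<^sub>C x) = t *\<^sub>C neg_proj \<A> s x" if xg: "x \<in> \<g>" for x t
  proof -
    obtain x1 x2 where x: "x1 \<in> neg_space \<A> s" "x2 \<in> nonneg_space \<A> s" "x = x1 + x2"
      using derived_decompose[OF xg] .
    have "neg_proj \<A> s (t *\<^sub>C x1 + t *\<^sub>C x2) = t *\<^sub>C x1"
      by (intro projections complex_vector.subspace_scale subspace_neg_space subspace_nonneg_space x)
    then show ?thesis using x by (simp add: projections scaleC_add_right)
  qed
  have lin: "Vector_Spaces.linear scaleC scaleC Q"
    using \<pi>(2) add[OF \<pi>g \<pi>g] scale[OF \<pi>g] unfolding Q_def linear_scaleC_iff by simp
  have proj: "neg_proj \<A> s x \<in> neg_space \<A> s \<and> nonneg_proj \<A> s x = x - neg_proj \<A> s x \<and>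
      x - neg_proj \<A> s x \<in> nonneg_space \<A> s" if "x \<in> \<g>" for x
    using derived_decompose[OF that] projections by (metis add_diff_cancel_left')
  show ?thesis
  proof (rule that[OF lin])
    show "Q x = x" if "x \<in> neg_space \<A> s" for x
      using projections(1)[OF that complex_vector.subspace_0[OF subspace_nonneg_space]]
        \<pi>(3)[OF neg_space_derived[OF that]] by (simp add: Q_def)
    show "Q x = 0" if "x \<in> nonneg_space \<A> s" for x
      using projections(1)[OF complex_vector.subspace_0[OF subspace_neg_space] that]
        \<pi>(3)[OF nonneg_space_derived[OF that]] by (simp add: Q_def)
    show "Q x \<in> neg_space \<A> s" for x unfolding Q_def using proj[OF \<pi>g] by blast
  qed (use \<pi>(3) proj in \<open>auto simp: Q_def\<close>)
qed

text \<open>In case (I), \<open>d\<^sub>- \<^sub>1\<^sup>s\<close> lowers degrees by \<open>1\<close>, but it annihilates degree \<open>0\<close>.\<close>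

lemma virasoro_nonneg_space:
  assumes "j \<in> vir_indices \<A> s" "x \<in> nonneg_space \<A> s"
  shows "lie x (virasoro \<A> s j) \<in> nonneg_space \<A> s"
proof -
  have "lie (virasoro \<A> s j) x \<in> nonneg_space \<A> s"
  proof (rule lie_span_right_mem[OF assms(2)[unfolded nonneg_space_def] subspace_nonneg_space])
    fix y assume "y \<in> (\<Union>m\<in>{m. m \<ge> 0}. graded_part \<A> s m)"
    then obtain m where m: "m \<ge> 0" "y \<in> graded_part \<A> s m" by auto
    obtain u t where u: "loop_degree \<A> s m u" "y = loop_iso \<A> s (zpow m u) + t *\<^sub>C c"
      using graded_part_loop[OF m(2)] by blast
    let ?n = "m + int (period \<A> s) * j"
    have deg: "loop_degree \<A> s ?n u"
      using u(1) by (rule loop_degree.period) simp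
    have "t *\<^sub>C c = loop_iso \<A> s (0, t)" by (simp add: loop_iso_constant[OF s])
    then have "lie (virasoro \<A> s j) (t *\<^sub>C c) = loop_iso \<A> s (loop_derivation \<A> s j (0, t))"
      using virasoro_loop[OF s constant_in_loop_algebra] by simp
    also have "\<dots> = 0" by (simp add: loop_derivation_def loop_iso_zero[OF s] flip: zero_prod_def)
    finally have y: "lie (virasoro \<A> s j) y = (- of_int m / of_nat (period \<A> s)) *\<^sub>C loop_iso \<A> s (zpow ?n u)"
      by (simp add: u lie_add_right virasoro_zpow[OF s u(1)])
    show "lie (virasoro \<A> s j) y \<in> nonneg_space \<A> s"
    proof (cases "m = 0")
      case True
      then show ?thesis using y complex_vector.subspace_0[OF subspace_nonneg_space] by simp
    next
      case False
      have "?n \<ge> 0"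
      proof (cases "period \<A> s = 1")
        case True
        then show ?thesis using assms(1) False m(1) by (simp add: vir_indices_def)
      next
        case False
        then have "j \<ge> 0" using assms(1) by (simp only: vir_indices_def if_False) simp
        then show ?thesis using m(1) by simp
      qed
      then show ?thesis
        unfolding y
        by (intro complex_vector.subspace_scale subspace_nonneg_space
            graded_part_nonneg_space[OF _ zpow_graded_part[OF deg]])
    qed
  qed
  then show ?thesis
    using lie_antisym[of x "virasoro \<A> s j"] complex_vector.subspace_neg[OF subspace_nonneg_space] by simp
qed

text \<open>Up to multiples of \<open>c\<close>, a graded part is the image of a subspace of the
  finite-dimensional simple algebra. For the principal gradation this is what upgrades the flow
  derivative of \<open>V\<close> to a strong one.\<close>

lemma finite_dim_graded_part: "\<exists>B. finite B \<and> graded_part \<A> s m \<subseteq> complex_vector.span B"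
proof -
  obtain T :: "'b set" where T: "finite T" "complex_vector.span T = UNIV"
    using simple_data[unfolded simple_algebra_data_def Let_def, THEN conjunct1]
    unfolding simple_fin_dim_def by blast
  let ?U = "{u. loop_degree \<A> s m u}"
  obtain B where B: "B \<subseteq> ?U" "complex_vector.independent B" "?U \<subseteq> complex_vector.span B"
    using complex_vector.maximal_independent_subset[of ?U] by blast
  have "finite B"
    using complex_vector.independent_span_bound[OF T(1) B(2)] T(2) by simp
  let ?R = "\<lambda>u. loop_iso \<A> s (zpow m u)"
  have span: "loop_degree \<A> s m u \<and> ?R u \<in> complex_vector.span (insert c (?R ` B))"
    if "u \<in> complex_vector.span B" for u
    using that
  proof (induction rule: complex_vector.span_induct_alt)
    case base
    have "zpow m 0 = (0 :: 'b loop)" by (simp add: zpow_def zero_prod_def)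
    then show ?case
      using loop_degree.zero loop_iso_zero[OF s] by (simp add: complex_vector.span_zero)
  next
    case (step b x y)
    have "zpow m (b *\<^sub>C x + y) = loop_scale b (zpow m x) + zpow m y"
      by (intro prod_eqI poly_mapping_eqI)
        (auto simp: zpow_def lookup_add lookup_loop_scale snd_loop_scale lookup_single when_def
          loop_scale_def map.rep_eq)
    then have "?R (b *\<^sub>C x + y) = b *\<^sub>C ?R x + ?R y"
      using step B(1) zpow_in_loop_algebra[of s m x] zpow_in_loop_algebra[of s m y]
      by (auto simp: loop_iso_add[OF s] loop_iso_scale[OF s] loop_algebra_scale)
    moreover have "?R x \<in> complex_vector.span (insert c (?R ` B))"
      using step(1) by (intro complex_vector.span_base) simp
    moreover have "loop_degree \<A> s m x" using step(1) B(1) by blast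
    ultimately show ?case
      using step(2) by (simp add: loop_degree.add loop_degree.scale complex_vector.span_add
          complex_vector.span_scale)
  qed
  have "graded_part \<A> s m \<subseteq> complex_vector.span (insert c (?R ` B))"
  proof
    fix x assume "x \<in> graded_part \<A> s m"
    then obtain u t where u: "loop_degree \<A> s m u" "x = ?R u + t *\<^sub>C c"
      by (rule graded_part_loop)
    moreover have "c \<in> complex_vector.span (insert c (?R ` B))"
      by (rule complex_vector.span_base) simp
    moreover have "?R u \<in> complex_vector.span (insert c (?R ` B))"
      using span B(3) u(1) by blast
    ultimately show "x \<in> complex_vector.span (insert c (?R ` B))"
      by (simp add: complex_vector.span_add complex_vector.span_scale)
  qed
  with \<open>finite B\<close> show ?thesis by (intro exI[of _ "insert c (?R ` B)"]) auto
qed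

lemma brackets_e_graded: "x \<in> brackets l e \<Longrightarrow> \<exists>m\<ge>0. x \<in> graded_part \<A> s m"
proof (induction rule: brackets.induct)
  case (generator i)
  then show ?case
    by (intro exI[of _ "int (s i)"]) (simp add: graded_part_def degree_elt_generators[OF s] e_in_derived)
next
  case (bracket i x)
  then obtain m where "m \<ge> 0" "x \<in> graded_part \<A> s m" by blast
  moreover have "e i \<in> graded_part \<A> s (int (s i))"
    using bracket(1) by (simp add: graded_part_def degree_elt_generators[OF s] e_in_derived)
  ultimately show ?case by (intro exI[of _ "int (s i) + m"]) (simp add: lie_graded_part)
qed

end

lemma brackets_f_graded: "x \<in> brackets l f \<Longrightarrow> \<exists>m<0. x \<in> graded_part \<A> principal_grad m"
proof -
  have f: "f i \<in> graded_part \<A> principal_grad (-1)" if "i \<le> l" for i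
    using that by (simp add: graded_part_def degree_elt_principal scaling_generators f_in_derived)
  show "x \<in> brackets l f \<Longrightarrow> \<exists>m<0. x \<in> graded_part \<A> principal_grad m"
  proof (induction rule: brackets.induct)
    case (bracket i x)
    then obtain m where "m < 0" "x \<in> graded_part \<A> principal_grad m" by blast
    then show ?case
      using lie_graded_part[OF gradation_principal f[OF bracket(1)]]
      by (intro exI[of _ "-1 + m"]) simp
  qed (use f in \<open>auto intro: exI[of _ "-1"]\<close>)
qed

text \<open>Bracketing with a generator preserves the span, the mixed cases being
  \<open>lie_opposite_brackets\<close>. The stabilizer of the span is a subalgebra, so it contains
  \<open>L\<close>; since the span lies in \<open>L\<close>, it is itself a subalgebra, and it
  contains the generators.\<close>

lemma triangular_decomposition:
  "L \<subseteq> complex_vector.span (brackets l e \<union> brackets l f \<union> H)"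
proof -
  let ?T = "brackets l e \<union> brackets l f \<union> H"
  let ?S = "complex_vector.span ?T"
  have weight_e: "\<exists>w. lie h (e i) = w *\<^sub>C e i" and weight_f: "\<exists>w. lie h (f i) = w *\<^sub>C f i"
    if "h \<in> H" "i \<le> l" for h i
    using cartan_generators[OF that] by (metis complex_vector.scale_minus_left)+
  have ef: "lie (e i) (f j) \<in> H" if "i \<le> l" "j \<le> l" for i j
  proof (cases "i = j")
    case True
    then show ?thesis using coroot_in_cartan[OF that(1)] by (simp add: coroot_def)
  next
    case False
    then show ?thesis using chevalley(1)[OF that] complex_vector.subspace_0[OF subspace_cartan] by simp
  qed
  then have fe: "lie (f i) (e j) \<in> H" if "i \<le> l" "j \<le> l" for i j
    using that lie_antisym[of "f i" "e j"] complex_vector.subspace_neg[OF subspace_cartan] by simp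
  have e: "lie (e i) y \<in> ?S" if i: "i \<le> l" and y: "y \<in> ?T" for i y
  proof -
    consider "y \<in> brackets l e" | "y \<in> brackets l f" | "y \<in> H" using y by blast
    then show ?thesis
    proof cases
      case 1
      then show ?thesis using brackets.bracket[OF i] by (auto intro: complex_vector.span_base)
    next
      case 2
      have "lie (e i) y \<in> complex_vector.span (brackets l f \<union> H)"
        by (rule lie_opposite_brackets[OF 2 i]) (use weight_f ef i in auto)
      then show ?thesis using complex_vector.span_mono[of "brackets l f \<union> H" ?T] by blast
    next
      case 3
      then obtain w where "lie y (e i) = w *\<^sub>C e i" using weight_e i by blast
      then have "lie (e i) y = (- w) *\<^sub>C e i" by (simp add: lie_antisym[of "e i" y])
      moreover have "e i \<in> ?S" using brackets.generator[OF i] by (auto intro: complex_vector.span_base)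
      ultimately show ?thesis by (simp only: complex_vector.span_scale)
    qed
  qed
  have f: "lie (f i) y \<in> ?S" if i: "i \<le> l" and y: "y \<in> ?T" for i y
  proof -
    consider "y \<in> brackets l e" | "y \<in> brackets l f" | "y \<in> H" using y by blast
    then show ?thesis
    proof cases
      case 2
      then show ?thesis using brackets.bracket[OF i] by (auto intro: complex_vector.span_base)
    next
      case 1
      have "lie (f i) y \<in> complex_vector.span (brackets l e \<union> H)"
        by (rule lie_opposite_brackets[OF 1 i]) (use weight_e fe i in auto)
      then show ?thesis using complex_vector.span_mono[of "brackets l e \<union> H" ?T] by blast
    next
      case 3
      then obtain w where "lie y (f i) = w *\<^sub>C f i" using weight_f i by blast
      then have "lie (f i) y = (- w) *\<^sub>C f i" by (simp add: lie_antisym[of "f i" y])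
      moreover have "f i \<in> ?S" using brackets.generator[OF i] by (auto intro: complex_vector.span_base)
      ultimately show ?thesis by (simp only: complex_vector.span_scale)
    qed
  qed
  have h: "lie h y \<in> ?S" if h: "h \<in> H" and y: "y \<in> ?T" for h y
  proof (cases "y \<in> H")
    case True
    then show ?thesis using h by (simp add: cartan_abelian complex_vector.span_zero)
  next
    case False
    then have "\<exists>w. lie h y = w *\<^sub>C y"
      using y brackets_weight[of y l e h] brackets_weight[of y l f h] weight_e[OF h] weight_f[OF h] by blast
    moreover have "y \<in> ?S" using y by (rule complex_vector.span_base)
    ultimately show ?thesis by (auto intro: complex_vector.span_scale)
  qed
  let ?N = "{x. \<forall>y\<in>?S. lie x y \<in> ?S}"
  have "lie_subalgebra ?N"
    unfolding lie_subalgebra_def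
  proof (intro conjI ballI)
    show "complex_vector.subspace ?N"
      unfolding complex_vector.subspace_def
      by (auto simp: lie_add_left lie_scale_left complex_vector.span_zero
          intro: complex_vector.span_add complex_vector.span_scale)
    fix x x' assume x: "x \<in> ?N" "x' \<in> ?N"
    have "lie (lie x x') y = lie x (lie x' y) - lie x' (lie x y)" for y
      using lie_derivation[of x x' y] by simp
    with x show "lie x x' \<in> ?N" by (auto intro: complex_vector.span_diff)
  qed
  moreover have "e ` {..l} \<union> f ` {..l} \<union> H \<subseteq> ?N"
    using lie_span_right_mem[OF _ complex_vector.subspace_span, of _ ?T _ ?T] e f h by blast
  ultimately have LN: "L \<subseteq> ?N"
    unfolding affine_algebra_def by (intro hull_minimal)
  have "x \<in> L" if "x \<in> brackets l e \<or> x \<in> brackets l f" for x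
  proof -
    have "x \<in> L" if "x \<in> brackets l g" "\<And>i. i \<le> l \<Longrightarrow> g i \<in> L" for g
      using that by induction (auto intro: lie_affine)
    then show ?thesis using that e_in_affine f_in_affine by blast
  qed
  then have SL: "?S \<subseteq> L"
    by (intro complex_vector.span_minimal subspace_affine) (use cartan_in_affine in blast)
  have "lie_subalgebra ?S"
    unfolding lie_subalgebra_def using SL LN complex_vector.subspace_span by blast
  moreover have "e ` {..l} \<union> f ` {..l} \<union> H \<subseteq> ?S"
    using brackets.generator by (fast intro: complex_vector.span_base)
  ultimately show ?thesis
    unfolding affine_algebra_def by (intro hull_minimal)
qed

lemma principal_part_eq: "principal_part \<A> n = graded_part \<A> principal_grad n"
  by (simp add: principal_part_def graded_part_def degree_elt_principal)

text \<open>Split \<open>x\<close> into parts coming from the \<open>e i\<close>, the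
  \<open>f i\<close> and \<open>H\<close>. Nonnegative principal degree removes the part of the
  \<open>f i\<close>, and the rest is nonnegative for every gradation. Consequently \<open>V\<close>
  has only negative principal degrees, which its series rely on.\<close>

lemma neg_space_principal_degree:
  assumes s: "gradation \<A> s" and x: "x \<in> principal_part \<A> n" "x \<in> neg_space \<A> s" and n: "n \<ge> 0"
  shows "x = 0"
proof -
  let ?E = "complex_vector.span (brackets l e)" and ?F = "complex_vector.span (brackets l f)"
  note p = gradation_principal
  have xg: "x \<in> \<g>" using x(1) by (simp add: principal_part_def)
  then have "x \<in> complex_vector.span (brackets l e \<union> brackets l f \<union> H)"
    using triangular_decomposition derived_in_affine by blast
  then obtain u v h where uvh: "u \<in> ?E" "v \<in> ?F" "h \<in> H" "x = u + v + h"
    unfolding complex_vector.span_Un complex_vector.span_eq_iff[THEN iffD2, OF subspace_cartan] by blast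
  have E: "?E \<subseteq> nonneg_space \<A> s'" if s': "gradation \<A> s'" for s'
    using brackets_e_graded[OF s'] graded_part_nonneg_space[OF s']
    by (intro complex_vector.span_minimal subspace_nonneg_space[OF s']) blast
  have F: "?F \<subseteq> neg_space \<A> principal_grad"
    using brackets_f_graded graded_part_neg_space[OF p]
    by (intro complex_vector.span_minimal subspace_neg_space[OF p]) blast
  have "h = x - u - v" using uvh(4) by (simp add: algebra_simps)
  moreover have "u \<in> \<g>" "v \<in> \<g>"
    using E[OF p] F uvh nonneg_space_derived[OF p] neg_space_derived[OF p] by auto
  ultimately have hg: "h \<in> \<g>"
    using xg by (auto intro: complex_vector.subspace_diff[OF subspace_derived])
  have h: "h \<in> nonneg_space \<A> s'" if s': "gradation \<A> s'" for s'
    using graded_part_nonneg_space[OF s' order_refl cartan_graded_part[OF s' uvh(3) hg]] .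
  have "v = x - u - h" using uvh(4) by (simp add: algebra_simps)
  moreover have "x \<in> nonneg_space \<A> principal_grad"
    using graded_part_nonneg_space[OF p n] x(1) by (simp add: principal_part_eq)
  ultimately have "v \<in> nonneg_space \<A> principal_grad"
    using E[OF p] uvh(1) h[OF p] by (auto intro!: complex_vector.subspace_diff[OF subspace_nonneg_space[OF p]])
  then have "v = 0" using F uvh(2) neg_nonneg_space_disjoint[OF p] by blast
  then have "x \<in> nonneg_space \<A> s"
    using E[OF s] uvh(1,4) h[OF s] by (auto intro!: complex_vector.subspace_add[OF subspace_nonneg_space[OF s]])
  with x(2) show ?thesis by (rule neg_nonneg_space_disjoint[OF s])
qed

text \<open>Each of the two elements differs from the one of the homogeneous gradation by an
  explicit element of \<open>\<g>\<close>. This is the reason why \<open>B_elt\<close> takes its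
  values in \<open>\<g>\<close>.\<close>

lemma virasoro_diff_derived:
  assumes s: "gradation \<A> s" and s': "gradation \<A> s'"
  shows "virasoro \<A> s j - virasoro \<A> s' j \<in> \<g>"
proof -
  have "virasoro \<A> homogeneous_grad j - virasoro \<A> s j \<in> \<g>" if s: "gradation \<A> s" for s
  proof (cases "j = 0")
    case True
    have "rho \<A> s \<in> \<g>"
      unfolding rho_def
      by (intro complex_vector.subspace_sum complex_vector.subspace_scale subspace_derived coroot_in_derived) auto
    then show ?thesis
      using central_in_derived unfolding True virasoro_zero[OF s]
      by (auto intro!: complex_vector.subspace_diff[OF subspace_derived]
          complex_vector.subspace_scale[OF subspace_derived] simp: algebra_simps diff_diff_eq2)
  next
    case False
    \<comment> \<open>The element \<open>gen_H \<A> i\<close> has degree 0, and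
      \<open>twist \<A> * k 0\<close> is the period of the homogeneous gradation.\<close>
    have "loop_degree \<A> homogeneous_grad (int (twist \<A> * k 0) * j) (gen_H \<A> i)" if "i \<le> l" for i
      using loop_degree.lie[OF loop_degree.gen_E[OF that] loop_degree.gen_F[OF that], of homogeneous_grad]
      unfolding gen_H_def by (rule loop_degree.period) (simp add: coxeter_homogeneous)
    then show ?thesis
      unfolding virasoro_nonzero[OF s False]
      by (auto intro!: complex_vector.subspace_sum[OF subspace_derived]
          complex_vector.subspace_scale[OF subspace_derived] loop_iso_derived[OF gradation_homogeneous]
          zpow_in_loop_algebra)
  qed
  from complex_vector.subspace_diff[OF subspace_derived this[OF s'] this[OF s]]
  show ?thesis by simp
qed

section \<open>Relations in the principal Heisenberg subalgebra\<close>

lemma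
  assumes "j \<in> exponents \<A>"
  shows heis_shift: "(fst j + int (period \<A> principal_grad) * m, snd j) \<in> exponents \<A>"
    and heis_principal: "heis \<A> j \<in> principal_part \<A> (fst j)"
    and lie_heis: "i \<in> exponents \<A> \<Longrightarrow> lie (heis \<A> i) (heis \<A> j) =
      (if fst i = - fst j \<and> snd i = snd j then of_int (fst i) *\<^sub>C c else 0)"
    and virasoro_heis: "lie (virasoro \<A> principal_grad m) (heis \<A> j) =
      (- of_int (fst j) / of_int (int (period \<A> principal_grad))) *\<^sub>C
        heis \<A> (fst j + int (period \<A> principal_grad) * m, snd j)"
proof -
  note data = heisenberg_data[unfolded principal_heisenberg_def Let_def]
  show "(fst j + int (period \<A> principal_grad) * m, snd j) \<in> exponents \<A>"
    using data[THEN conjunct1] assms by (metis prod.collapse)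
  show "heis \<A> j \<in> principal_part \<A> (fst j)"
    using data[THEN conjunct2, THEN conjunct1] assms by blast
  show "i \<in> exponents \<A> \<Longrightarrow> lie (heis \<A> i) (heis \<A> j) =
      (if fst i = - fst j \<and> snd i = snd j then of_int (fst i) *\<^sub>C c else 0)"
    using data[THEN conjunct2, THEN conjunct2, THEN conjunct2, THEN conjunct2, THEN conjunct2, THEN conjunct1] assms
    by blast
  show "lie (virasoro \<A> principal_grad m) (heis \<A> j) =
      (- of_int (fst j) / of_int (int (period \<A> principal_grad))) *\<^sub>C
        heis \<A> (fst j + int (period \<A> principal_grad) * m, snd j)"
    using data[THEN conjunct2, THEN conjunct2, THEN conjunct2, THEN conjunct2, THEN conjunct2, THEN conjunct2] assms
    by blast
qed

end

section \<open>The flows\<close>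

lemma clie_funpow_clie:
  assumes "bounded_above V" "bounded_above X" "bounded_above Y"
  shows "(clie V ^^ m) (clie X Y) =
    (\<Sum>i\<le>m. cscale (of_nat (m choose i)) (clie ((clie V ^^ i) X) ((clie V ^^ (m - i)) Y)))"
proof (induction m)
  case 0
  show ?case by (simp add: cscale_one)
next
  case (Suc m)
  define b where "b i j = clie ((clie V ^^ i) X) ((clie V ^^ j) Y)" for i j
  note bd = assms bounded_above_funpow[OF assms(1)] bounded_above_clie bounded_above_cscale
  have b: "clie V (b i j) = b (Suc i) j + b i (Suc j)" for i j
    unfolding b_def by (subst clie_derivation) (auto intro: bd)
  have "(clie V ^^ Suc m) (clie X Y) = (\<Sum>i\<le>m. cscale (of_nat (m choose i)) (clie V (b i (m - i))))"
    unfolding funpow.simps comp_apply Suc.IH b_def[symmetric]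
    by (subst clie_sum_right) (auto intro!: bd clie_cscale_right simp: b_def clie_cscale_right bd)
  also have "\<dots> = (\<Sum>i\<le>m. cscale (of_nat (m choose i)) (b (Suc i) (m - i))) +
      (\<Sum>i\<le>m. cscale (of_nat (m choose i)) (b i (Suc m - i)))"
    unfolding b cscale_add sum.distrib
    by (intro arg_cong2[where f = "(+)"] sum.cong) (auto simp: Suc_diff_le)
  also have "(\<Sum>i\<le>m. cscale (of_nat (m choose i)) (b i (Suc m - i))) =
      (\<Sum>i\<le>Suc m. cscale (of_nat (m choose i)) (b i (Suc m - i)))"
    by (simp add: cscale_def zero_fun_def binomial_eq_0)
  also have "\<dots> = b 0 (Suc m) + (\<Sum>i\<le>m. cscale (of_nat (m choose Suc i)) (b (Suc i) (m - i)))"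
    by (subst sum.atMost_Suc_shift) (simp add: cscale_one)
  also have "(\<Sum>i\<le>m. cscale (of_nat (m choose i)) (b (Suc i) (m - i))) + \<dots> =
      b 0 (Suc m) + (\<Sum>i\<le>m. cscale (of_nat (Suc m choose Suc i)) (b (Suc i) (m - i)))"
    unfolding add.left_commute[of _ "b 0 (Suc m)"] sum.distrib[symmetric] cscale_add_left[symmetric]
      of_nat_add[symmetric] by simp
  also have "\<dots> = (\<Sum>i\<le>Suc m. cscale (of_nat (Suc m choose i)) (b i (Suc m - i)))"
    by (subst sum.atMost_Suc_shift) (simp add: cscale_one)
  finally show ?case by (simp only: b_def)
qed

text \<open>In Leibniz' rule \<open>clie_funpow_clie\<close>, dividing \<open>m choose i\<close> by
  \<open>fact m\<close> leaves the product of \<open>1 / fact i\<close> and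
  \<open>1 / fact (m - i)\<close>, the coefficient in the Cauchy product of the two exponential
  series.\<close>

lemma exp_ad_clie:
  assumes "vanishes_above (-1) V" "vanishes_above N X" "vanishes_above M Y"
  shows "exp_ad V (clie X Y) = clie (exp_ad V X) (exp_ad V Y)"
proof -
  have bd: "bounded_above V" "bounded_above X" "bounded_above Y"
    using assms by (auto intro: bounded_aboveI)
  have coeff: "1 / fact m * of_nat (m choose i) = 1 / fact (m - i) * (1 / fact i :: complex)" if "i \<le> m" for i m
    using that by (simp add: binomial_fact)
  show ?thesis
    unfolding exp_ad_graded_sum
    by (subst clie_graded_sum[OF falling_funpow[OF assms(1,2)] falling_funpow[OF assms(1,3)]],
        intro arg_cong[where f = graded_sum], rule ext)
      (auto simp: clie_funpow_clie[OF bd] cscale_sum clie_cscale_left clie_cscale_right bd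
        bounded_above_intros cscale_cscale coeff
        simp del: times_divide_eq_left times_divide_eq_right times_divide_times_eq intro!: sum.cong)
qed

lemma clie_funpow_zero: "(clie V ^^ m) 0 = 0"
  by (induction m) (simp_all only: funpow.simps id_apply comp_apply clie_zero_right)

lemma exp_ad_zero [simp]: "exp_ad V 0 = 0"
  using clie_funpow_zero[of _ V] by (simp add: exp_ad_def fun_eq_iff)

lemma Sum_any_mem:
  assumes "complex_vector.subspace U" "\<And>i. g i \<in> U"
  shows "Sum_any g \<in> U"
  unfolding Sum_any.expand_set using assms by (intro complex_vector.subspace_sum) auto

lemma clie_mem:
  assumes "complex_vector.subspace U" "\<And>i. X i \<in> S" "\<And>i. Y i \<in> T"
    and "\<And>x y. x \<in> S \<Longrightarrow> y \<in> T \<Longrightarrow> lie x y \<in> U"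
  shows "clie X Y n \<in> U"
  unfolding clie_def using assms by (intro Sum_any_mem) auto

lemma homogeneous_vanishes: "vanishes_above n (homogeneous n x)"
  by (simp add: vanishes_above_def homogeneous_def)

section \<open>The function \<open>V\<close> and the inner exponential with
  \<open>Xi\<close>\<close>

locale commuting_flows = affine_realization \<A>
  for \<A> :: "('a::complex_lie_algebra, 'b::complex_lie_algebra) affine_data" +
  fixes s :: "nat \<Rightarrow> nat"
    and t :: "'p \<Rightarrow> int \<times> nat \<Rightarrow> complex"
    and V :: "'p \<Rightarrow> int \<Rightarrow> 'a"
  assumes s: "gradation \<A> s"
    and times_finite: "finite {j \<in> pos_exponents \<A>. t p j \<noteq> 0}"
    and V_neg: "neg_valued \<A> s V"
begin

lemma V_vanishes: "vanishes_above (-1) (V p)"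
  using neg_space_principal_degree[OF s, of "V p n" n for n] V_neg
  by (simp add: vanishes_above_def neg_valued_def)

lemma V_derived: "V p n \<in> \<g>"
  using V_neg by (auto simp: neg_valued_def principal_part_def)

lemma V_curve_derivative:
  assumes "has_flow_derivative \<gamma> V V'"
  shows "has_curve_derivative (-1) (\<lambda>\<epsilon>. V (\<gamma> p \<epsilon>)) (V' p)"
  unfolding has_curve_derivative_def
proof (intro conjI allI always_eventually V_vanishes)
  fix n
  obtain S where S: "finite S" "principal_part \<A> n \<subseteq> complex_vector.span S"
    using finite_dim_graded_part[OF gradation_principal, of n] by (auto simp: principal_part_eq)
  show "has_strong_derivative (\<lambda>\<epsilon>. V (\<gamma> p \<epsilon>) n) (V' p n)"
  proof (rule has_strong_derivativeI[OF S(1)])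
    show "V (\<gamma> p \<epsilon>) n \<in> complex_vector.span S" for \<epsilon>
      using V_neg S(2) unfolding neg_valued_def by blast
  qed (use assms in \<open>simp add: has_flow_derivative_def\<close>)
qed

lemma has_flow_derivativeI:
  assumes "\<And>p. has_curve_derivative (N p) (\<lambda>\<epsilon>. F (\<gamma> p \<epsilon>)) (F' p)"
  shows "has_flow_derivative \<gamma> F F'"
  using assms unfolding has_flow_derivative_def has_curve_derivative_def
  by (auto intro: has_strong_derivative_functional)

text \<open>Covers both \<open>- Xi \<A> u\<close> and \<open>heis_elt \<A> j\<close>. With positive
  exponents only, no two opposite degrees occur, so elements of this kind commute.\<close>

definition heis_valued :: "(int \<Rightarrow> 'a) \<Rightarrow> bool" where
  "heis_valued X \<longleftrightarrow> bounded_above X \<and> (\<forall>n. X n \<in> complex_vector.span (heis \<A> ` pos_exponents \<A>))"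

abbreviation "\<delta> q \<equiv> vir_elt \<A> principal_grad q"

lemma vir_elt_vanishes: "vanishes_above (int (period \<A> principal_grad) * q) (vir_elt \<A> s' q)"
  unfolding vir_elt_def by (rule homogeneous_vanishes)

lemma vir_elt_bounded: "bounded_above (vir_elt \<A> s' q)"
  using vir_elt_vanishes by (rule bounded_aboveI)

lemma heis_derived: "j \<in> exponents \<A> \<Longrightarrow> heis \<A> j \<in> \<g>"
  using heis_principal by (auto simp: principal_part_def)

lemma pos_exponents_exponents: "j \<in> pos_exponents \<A> \<Longrightarrow> j \<in> exponents \<A>"
  by (simp add: pos_exponents_def)

lemma span_heis_derived: "complex_vector.span (heis \<A> ` exponents \<A>) \<subseteq> \<g>"
  by (intro complex_vector.span_minimal subspace_derived) (auto intro: heis_derived)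

lemma heis_valued_derived: "heis_valued X \<Longrightarrow> X n \<in> \<g>"
proof -
  have "complex_vector.span (heis \<A> ` pos_exponents \<A>) \<subseteq> complex_vector.span (heis \<A> ` exponents \<A>)"
    by (intro complex_vector.span_mono image_mono) (auto simp: pos_exponents_def)
  then show "heis_valued X \<Longrightarrow> X n \<in> \<g>"
    using span_heis_derived unfolding heis_valued_def by blast
qed

lemma heis_valued_commute:
  assumes "heis_valued X" "heis_valued Y"
  shows "clie X Y = 0"
proof
  fix n
  have "clie X Y n \<in> {0}"
  proof (rule clie_mem)
    show "lie x y \<in> {0}" if "x \<in> complex_vector.span (heis \<A> ` pos_exponents \<A>)"
      "y \<in> complex_vector.span (heis \<A> ` pos_exponents \<A>)" for x y
      using that by (rule lie_span_mem) (auto simp: lie_heis pos_exponents_def complex_vector.subspace_def)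
  qed (use assms in \<open>auto simp: heis_valued_def complex_vector.subspace_def\<close>)
  then show "clie X Y n = 0 n" by simp
qed

text \<open>The Virasoro element shifts exponents by a multiple of the period. For negative
  \<open>q\<close> the shift can leave the positive exponents, so the span runs over all of them,
  and the next bracket may produce \<open>c\<close>.\<close>

lemma clie_vir_mem: "heis_valued X \<Longrightarrow> clie X (\<delta> q) n \<in> complex_vector.span (heis \<A> ` exponents \<A>)"
proof (rule clie_mem)
  let ?S = "complex_vector.span (heis \<A> ` pos_exponents \<A>)"
  let ?U = "complex_vector.span (heis \<A> ` exponents \<A>)"
  assume X: "heis_valued X"
  show "X i \<in> ?S" for i using X by (simp add: heis_valued_def)
  show "\<delta> q i \<in> {0, virasoro \<A> principal_grad q}" for i
    by (simp add: vir_elt_def homogeneous_def)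
  fix x y assume xy: "x \<in> ?S" "y \<in> {0, virasoro \<A> principal_grad q}"
  have "lie (virasoro \<A> principal_grad q) x \<in> ?U"
  proof (rule lie_span_right_mem[OF xy(1) complex_vector.subspace_span])
    fix z assume "z \<in> heis \<A> ` pos_exponents \<A>"
    then obtain j where "z = heis \<A> j" "j \<in> exponents \<A>" by (auto simp: pos_exponents_def)
    then show "lie (virasoro \<A> principal_grad q) z \<in> ?U"
      by (simp only: virasoro_heis) (intro complex_vector.span_scale complex_vector.span_base imageI heis_shift)
  qed
  with xy(2) show "lie x y \<in> ?U"
    using lie_antisym[of x y] by (auto simp: complex_vector.span_zero complex_vector.span_neg)
qed (rule complex_vector.subspace_span)

lemma clie_vir_central: "heis_valued X \<Longrightarrow> heis_valued Y \<Longrightarrow> clie X (clie Y (\<delta> q)) n \<in> complex_vector.span {c}"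
proof (rule clie_mem)
  assume "heis_valued X" "heis_valued Y"
  then show "X i \<in> complex_vector.span (heis \<A> ` pos_exponents \<A>)"
    "clie Y (\<delta> q) i \<in> complex_vector.span (heis \<A> ` exponents \<A>)" for i
    by (auto simp: heis_valued_def intro: clie_vir_mem)
  show "lie x y \<in> complex_vector.span {c}" if "x \<in> complex_vector.span (heis \<A> ` pos_exponents \<A>)"
      "y \<in> complex_vector.span (heis \<A> ` exponents \<A>)" for x y
    using that
  proof (rule lie_span_mem)
    have "lie (heis \<A> i) (heis \<A> j) \<in> complex_vector.span {c}"
      if "i \<in> exponents \<A>" "j \<in> exponents \<A>" for i j
      using that by (simp add: lie_heis complex_vector.span_zero complex_vector.span_neg
          complex_vector.span_scale complex_vector.span_base)
    then show "lie x y \<in> complex_vector.span {c}"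
      if "x \<in> heis \<A> ` pos_exponents \<A>" "y \<in> heis \<A> ` exponents \<A>" for x y
      using that pos_exponents_exponents by blast
  qed (rule complex_vector.subspace_span)
qed (rule complex_vector.subspace_span)

lemma clie_vir_nilpotent:
  assumes "heis_valued X" "heis_valued Y" "heis_valued Z"
  shows "clie X (clie Y (clie Z (\<delta> q))) = 0"
proof
  fix n
  have "clie X (clie Y (clie Z (\<delta> q))) n \<in> {0}"
  proof (rule clie_mem)
    show "X i \<in> \<g>" for i using assms(1) by (rule heis_valued_derived)
    show "clie Y (clie Z (\<delta> q)) i \<in> complex_vector.span {c}" for i
      using assms(2,3) by (rule clie_vir_central)
    show "lie x y \<in> {0}" if "x \<in> \<g>" "y \<in> complex_vector.span {c}" for x y
      using that lie_central[OF gradation_principal, of x] lie_antisym[of x c]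
      by (auto simp: complex_vector.span_singleton lie_scale_right)
  qed (simp add: complex_vector.subspace_def)
  then show "clie X (clie Y (clie Z (\<delta> q))) n = 0 n" by simp
qed

text \<open>As \<open>X\<close> has positive degrees, the exponential cannot be controlled by
  lowering degrees. It terminates instead: one bracket with the Virasoro element gives Heisenberg
  elements, two give multiples of \<open>c\<close>, and three give zero.\<close>

lemma exp_ad_vir:
  assumes "heis_valued X"
  shows "exp_ad X (\<delta> q) = \<delta> q + clie X (\<delta> q) + cscale (1 / 2) (clie X (clie X (\<delta> q)))"
proof
  fix n
  have "(clie X ^^ 3) (\<delta> q) = 0"
    using clie_vir_nilpotent[OF assms assms assms] by (simp only: numeral_3_eq_3 funpow.simps comp_apply id_apply)
  then have "(clie X ^^ (m + 3)) (\<delta> q) = 0" for m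
    unfolding funpow_add comp_apply by (simp only: clie_funpow_zero)
  then have zero: "(clie X ^^ m) (\<delta> q) = 0" if "m \<ge> 3" for m
    using that by (metis le_add_diff_inverse2)
  have "exp_ad X (\<delta> q) n = (\<Sum>m<3. (1 / fact m) *\<^sub>C (clie X ^^ m) (\<delta> q) n)"
    unfolding exp_ad_def
    by (rule Sum_any.expand_superset) (auto, metis zero linorder_not_le zero_fun_apply)
  also have "\<dots> = (\<delta> q + clie X (\<delta> q) + cscale (1 / 2) (clie X (clie X (\<delta> q)))) n"
    by (simp add: numeral_3_eq_3 cscale_apply add.assoc)
  finally show "exp_ad X (\<delta> q) n = (\<delta> q + clie X (\<delta> q) + cscale (1 / 2) (clie X (clie X (\<delta> q)))) n" .
qed

text \<open>Since \<open>has_curve_derivative_exp_ad\<close> requires negative degrees, the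
  quadratic polynomial of \<open>exp_ad_vir\<close> is differentiated directly. \<open>Y\<close>
  commutes with \<open>X 0\<close>, so the two terms from the quadratic part are equal and absorb
  the factor \<open>1 / 2\<close>; on the other side the quadratic term disappears because a triple
  bracket is zero.\<close>

lemma exp_ad_vir_curve_derivative:
  assumes X: "has_curve_derivative N X Y" and hX: "\<forall>\<^sub>F \<epsilon> in nhds 0. heis_valued (X \<epsilon>)" and hY: "heis_valued Y"
  obtains M where "has_curve_derivative M (\<lambda>\<epsilon>. exp_ad (X \<epsilon>) (\<delta> q)) (clie Y (exp_ad (X 0) (\<delta> q)))"
proof -
  have hX0: "heis_valued (X 0)" using hX eventually_nhds_x_imp_x by blast
  have bd: "bounded_above (X 0)" "bounded_above Y" using hX0 hY by (auto simp: heis_valued_def)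
  let ?K = "int (period \<A> principal_grad) * q"
  note \<delta> = has_curve_derivative_const[OF vir_elt_vanishes[of q principal_grad]]
  note 1 = has_curve_derivative_clie[OF X \<delta>]
  note 2 = has_curve_derivative_clie[OF X 1]
  define M where "M = max ?K (max (N + ?K) (N + (N + ?K)))"
  have D: "has_curve_derivative M (\<lambda>\<epsilon>. \<delta> q + clie (X \<epsilon>) (\<delta> q) + cscale (1 / 2) (clie (X \<epsilon>) (clie (X \<epsilon>) (\<delta> q))))
      (0 + (clie Y (\<delta> q) + clie (X 0) 0) +
        cscale (1 / 2) (clie Y (clie (X 0) (\<delta> q)) + clie (X 0) (clie Y (\<delta> q) + clie (X 0) 0)))"
    by (intro has_curve_derivative_add has_curve_derivative_cscale
        has_curve_derivative_mono[OF \<delta>] has_curve_derivative_mono[OF 1] has_curve_derivative_mono[OF 2])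
      (auto simp: M_def)
  have comm: "clie (X 0) (clie Y (\<delta> q)) = clie Y (clie (X 0) (\<delta> q))"
    by (subst clie_derivation) (auto simp: bd vir_elt_bounded heis_valued_commute[OF hX0 hY])
  have "clie Y (exp_ad (X 0) (\<delta> q)) = clie Y (\<delta> q) + clie Y (clie (X 0) (\<delta> q))"
    unfolding exp_ad_vir[OF hX0]
    by (simp add: clie_add_right clie_cscale_right bd vir_elt_bounded bounded_above_intros
        clie_vir_nilpotent hX0 hY cscale_zero)
  also have "\<dots> = 0 + (clie Y (\<delta> q) + clie (X 0) 0) +
        cscale (1 / 2) (clie Y (clie (X 0) (\<delta> q)) + clie (X 0) (clie Y (\<delta> q) + clie (X 0) 0))"
    by (simp add: comm cscale_add cscale_add_left[symmetric] cscale_one)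
  finally have eq: "0 + (clie Y (\<delta> q) + clie (X 0) 0) +
        cscale (1 / 2) (clie Y (clie (X 0) (\<delta> q)) + clie (X 0) (clie Y (\<delta> q) + clie (X 0) 0)) =
      clie Y (exp_ad (X 0) (\<delta> q))" ..
  have "\<forall>\<^sub>F \<epsilon> in nhds 0. \<delta> q + clie (X \<epsilon>) (\<delta> q) + cscale (1 / 2) (clie (X \<epsilon>) (clie (X \<epsilon>) (\<delta> q))) =
      exp_ad (X \<epsilon>) (\<delta> q)"
    using hX by (rule eventually_mono) (simp add: exp_ad_vir)
  from that has_curve_derivative_cong[OF has_curve_derivative_eq[OF D eq] this] show ?thesis by blast
qed

text \<open>The set \<open>F\<close> may be larger than the support, so that the times at nearby
  points of a flow can be summed over one and the same index set.\<close>

lemma Xi_eq_sum: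
  assumes "finite F" "F \<subseteq> pos_exponents \<A>" "{j \<in> pos_exponents \<A>. u j \<noteq> 0} \<subseteq> F"
  shows "Xi \<A> u n = (\<Sum>j\<in>F. if fst j = n then u j *\<^sub>C heis \<A> j else 0)"
proof -
  have "Xi \<A> u n = (\<Sum>j\<in>{j \<in> pos_exponents \<A>. u j \<noteq> 0 \<and> fst j = n}. if fst j = n then u j *\<^sub>C heis \<A> j else 0)"
    unfolding Xi_def by (rule sum.cong) auto
  also have "\<dots> = (\<Sum>j\<in>F. if fst j = n then u j *\<^sub>C heis \<A> j else 0)"
    by (rule sum.mono_neutral_left) (use assms in auto)
  finally show ?thesis .
qed

lemma heis_valued_Xi:
  assumes "finite {j \<in> pos_exponents \<A>. u j \<noteq> 0}"
  shows "heis_valued (- Xi \<A> u)"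
proof -
  let ?F = "{j \<in> pos_exponents \<A>. u j \<noteq> 0}"
  note eq = Xi_eq_sum[OF assms, of u]
  obtain N where N: "\<And>j. j \<in> ?F \<Longrightarrow> fst j \<le> N"
    using assms by (metis (no_types, lifting) Max_ge finite_imageI imageI)
  have "vanishes_above N (Xi \<A> u)"
    unfolding vanishes_above_def
  proof (intro allI impI)
    fix n assume "N < n"
    then have "(\<Sum>j\<in>?F. if fst j = n then u j *\<^sub>C heis \<A> j else 0) = 0"
      using N by (intro sum.neutral) force
    then show "Xi \<A> u n = 0" using eq by simp
  qed
  moreover have "Xi \<A> u n \<in> complex_vector.span (heis \<A> ` pos_exponents \<A>)" for n
    unfolding Xi_def
    by (intro complex_vector.span_sum complex_vector.span_scale complex_vector.span_base) auto
  ultimately show ?thesis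
    by (auto simp: heis_valued_def bounded_above_def intro: vanishes_above_minus complex_vector.span_neg)
qed

lemma heis_valued_heis_elt: "j \<in> pos_exponents \<A> \<Longrightarrow> heis_valued (heis_elt \<A> j)"
  unfolding heis_valued_def heis_elt_def
  using bounded_aboveI[OF homogeneous_vanishes]
  by (auto simp: homogeneous_def complex_vector.span_zero intro: complex_vector.span_base)

lemma of_real_vector_derivative: "(complex_of_real has_vector_derivative 1) (at 0)"
  by (rule has_vector_derivative_of_real[of "\<lambda>x. x" 1, simplified])

lemma Xi_curve_derivative:
  assumes \<gamma>: "flow_of_times (pos_exponents \<A>) t \<gamma> w" and i: "i \<in> pos_exponents \<A>"
    and w: "w = (\<lambda>j. if j = i then b else 0)"
  obtains N where "has_curve_derivative N (\<lambda>\<epsilon>. - Xi \<A> (t (\<gamma> p \<epsilon>))) (- cscale b (heis_elt \<A> i))"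
proof -
  \<comment> \<open>The index \<open>i\<close> is added because its time may be zero at
    \<open>p\<close> and nonzero at nearby points of the flow.\<close>
  define F where "F = insert i {j \<in> pos_exponents \<A>. t p j \<noteq> 0}"
  have F: "finite F" "F \<subseteq> pos_exponents \<A>"
    using times_finite i by (auto simp: F_def)
  have line: "Xi \<A> u = Xi \<A> (t p) + cscale (of_real \<epsilon> * b) (heis_elt \<A> i)"
    if u: "\<forall>j\<in>pos_exponents \<A>. u j = t p j + of_real \<epsilon> * w j" for u \<epsilon>
  proof
    fix n
    have "{j \<in> pos_exponents \<A>. u j \<noteq> 0} \<subseteq> F" using u by (auto simp: F_def w split: if_splits)
    from Xi_eq_sum[OF F this, of n]
    have "Xi \<A> u n = (\<Sum>j\<in>F. if fst j = n then u j *\<^sub>C heis \<A> j else 0)" .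
    also have "\<dots> = (\<Sum>j\<in>F. (if fst j = n then t p j *\<^sub>C heis \<A> j else 0) +
        (if j = i then (if fst i = n then (of_real \<epsilon> * b) *\<^sub>C heis \<A> i else 0) else 0))"
    proof (rule sum.cong[OF refl])
      fix j assume "j \<in> F"
      then have "u j = t p j + of_real \<epsilon> * w j" using u F by blast
      then show "(if fst j = n then u j *\<^sub>C heis \<A> j else 0) = (if fst j = n then t p j *\<^sub>C heis \<A> j else 0) +
        (if j = i then (if fst i = n then (of_real \<epsilon> * b) *\<^sub>C heis \<A> i else 0) else 0)"
        by (simp add: w scaleC_add_left)
    qed
    also have "\<dots> = (\<Sum>j\<in>F. if fst j = n then t p j *\<^sub>C heis \<A> j else 0) +
        (if fst i = n then (of_real \<epsilon> * b) *\<^sub>C heis \<A> i else 0)"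
      using F(1) by (simp add: sum.distrib F_def)
    also have "(\<Sum>j\<in>F. if fst j = n then t p j *\<^sub>C heis \<A> j else 0) = Xi \<A> (t p) n"
      by (rule Xi_eq_sum[OF F, symmetric]) (auto simp: F_def)
    finally show "Xi \<A> u n = (Xi \<A> (t p) + cscale (of_real \<epsilon> * b) (heis_elt \<A> i)) n"
      by (simp add: cscale_def heis_elt_def homogeneous_def)
  qed
  have "\<forall>\<^sub>F \<epsilon> in nhds 0. \<forall>j\<in>pos_exponents \<A>. t (\<gamma> p \<epsilon>) j = t p j + of_real \<epsilon> * w j"
    using \<gamma> by (simp add: flow_of_times_def)
  then have ev: "\<forall>\<^sub>F \<epsilon> in nhds 0.
      - Xi \<A> (t p) + cscale (of_real \<epsilon>) (- cscale b (heis_elt \<A> i)) = - Xi \<A> (t (\<gamma> p \<epsilon>))"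
    by (rule eventually_mono) (drule line, simp add: cscale_minus cscale_cscale)
  have bd: "bounded_above (- Xi \<A> (t p))" "bounded_above (- cscale b (heis_elt \<A> i))"
    using heis_valued_Xi[OF times_finite] heis_valued_heis_elt[OF i]
    by (auto simp: heis_valued_def intro: bounded_above_intros)
  obtain N where N: "vanishes_above N (- Xi \<A> (t p))" "vanishes_above N (- cscale b (heis_elt \<A> i))"
    using bounded_above_common[OF bd] .
  have lin: "has_curve_derivative N (\<lambda>\<epsilon>. cscale (of_real \<epsilon>) Z) Z" if "vanishes_above N Z" for Z
    unfolding has_curve_derivative_def cscale_def
    using that has_strong_derivative.line[OF of_real_vector_derivative]
    by (auto simp: vanishes_above_def)
  from has_curve_derivative_cong[OF has_curve_derivative_add[OF has_curve_derivative_const[OF N(1)] lin[OF N(2)]] ev]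
  show ?thesis using that by simp
qed

end

lemma exp_ad_minus: "exp_ad V (- X) = - exp_ad V X" if "vanishes_above (-1) V" "vanishes_above N X"
proof -
  have "exp_ad V X + exp_ad V (- X) = 0"
    using exp_ad_add[of V N X "- X"] that by (simp add: vanishes_above_minus)
  then show ?thesis by (metis add_eq_0_iff)
qed

lemma graded_sum_mem: "complex_vector.subspace U \<Longrightarrow> (\<And>m. F m n \<in> U) \<Longrightarrow> graded_sum F n \<in> U"
  unfolding graded_sum_def by (rule Sum_any_mem)

section \<open>The dressed elements and the commutation of the flows\<close>

context commuting_flows
begin

lemma funpow_derived:
  assumes "\<And>n. X n \<in> \<g>" "\<And>n. W n \<in> \<g>"
  shows "(clie W ^^ m) X n \<in> \<g>"
proof (induction m arbitrary: n)
  case (Suc m)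
  then show ?case
    using clie_mem[OF subspace_derived assms(2) Suc lie_derived] by simp
qed (use assms in simp)

lemma exp_ad_derived:
  assumes "\<And>n. X n \<in> \<g>" "\<And>n. W n \<in> \<g>"
  shows "exp_ad W X n \<in> \<g>"
  unfolding exp_ad_graded_sum cscale_def
  by (intro graded_sum_mem subspace_derived complex_vector.subspace_scale funpow_derived assms)

definition dressed_heis :: "int \<times> nat \<Rightarrow> 'p \<Rightarrow> int \<Rightarrow> 'a" where
  "dressed_heis j p = exp_ad (V p) (heis_elt \<A> j)"

definition dressed_vir :: "int \<Rightarrow> 'p \<Rightarrow> int \<Rightarrow> 'a" where
  "dressed_vir q p = exp_ad (V p) (exp_ad (- Xi \<A> (t p)) (\<delta> q))"

lemma B_elt_eq: "B_elt \<A> s q (t p) (V p) = dressed_vir q p - vir_elt \<A> s q"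
  by (simp add: B_elt_def dressed_vir_def)

lemma dressed_heis_bounded: "bounded_above (dressed_heis j p)"
  unfolding dressed_heis_def heis_elt_def
  using vanishes_above_exp_ad[OF V_vanishes homogeneous_vanishes] by (rule bounded_aboveI)

lemma dressed_heis_derived: "j \<in> pos_exponents \<A> \<Longrightarrow> dressed_heis j p n \<in> \<g>"
  unfolding dressed_heis_def
  by (intro exp_ad_derived V_derived heis_valued_derived heis_valued_heis_elt)

lemma exp_ad_Xi_bounded: "bounded_above (exp_ad (- Xi \<A> (t p)) (\<delta> q))"
proof -
  have X: "heis_valued (- Xi \<A> (t p))" by (rule heis_valued_Xi[OF times_finite])
  then have "bounded_above (- Xi \<A> (t p))" by (simp add: heis_valued_def)
  then show ?thesis
    unfolding exp_ad_vir[OF X]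
    by (intro bounded_above_add bounded_above_cscale bounded_above_clie vir_elt_bounded)
qed

lemma dressed_vir_bounded: "bounded_above (dressed_vir q p)"
  using exp_ad_Xi_bounded[of p q] vanishes_above_exp_ad[OF V_vanishes]
  unfolding dressed_vir_def bounded_above_def by blast

lemma virasoro_elt_derived: "X n \<in> \<g> \<Longrightarrow> lie (X n) (virasoro \<A> principal_grad q) \<in> \<g>"
  using virasoro_derived[OF gradation_principal, of "X n" q] lie_antisym[of "X n"]
    complex_vector.subspace_neg[OF subspace_derived] by simp

lemma clie_vir_derived:
  assumes "\<And>n. X n \<in> \<g>"
  shows "clie X (\<delta> q) n \<in> \<g>"
proof (rule clie_mem[OF subspace_derived assms])
  show "\<delta> q i \<in> {0, virasoro \<A> principal_grad q}" for i
    by (simp add: vir_elt_def homogeneous_def)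
  show "lie x y \<in> \<g>" if "x \<in> \<g>" "y \<in> {0, virasoro \<A> principal_grad q}" for x y
    using that virasoro_elt_derived[of "\<lambda>_. x"] complex_vector.subspace_0[OF subspace_derived] by auto
qed

text \<open>Every term of the two exponentials lies in \<open>\<g>\<close> as soon as it contains a
  bracket. The only remaining term is the Virasoro element itself, and its difference from
  \<open>vir_elt \<A> s q\<close> is again in \<open>\<g>\<close>.\<close>

lemma B_elt_derived: "B_elt \<A> s q (t p) (V p) n \<in> \<g>"
proof -
  define X where "X = - Xi \<A> (t p)"
  have X: "heis_valued X" unfolding X_def by (rule heis_valued_Xi[OF times_finite])
  have Xg: "X n \<in> \<g>" for n using X by (rule heis_valued_derived)
  define E' where "E' = clie X (\<delta> q) + cscale (1 / 2) (clie X (clie X (\<delta> q)))"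
  have E'g: "E' n \<in> \<g>" for n
    unfolding E'_def plus_fun_apply cscale_apply
    by (intro complex_vector.subspace_add complex_vector.subspace_scale subspace_derived
        clie_mem[OF subspace_derived Xg clie_vir_derived[OF Xg]] clie_vir_derived Xg lie_derived)
  have "bounded_above E'"
    unfolding E'_def using X by (intro bounded_above_intros vir_elt_bounded) (auto simp: heis_valued_def)
  then obtain N where N: "vanishes_above N E'" "vanishes_above N (\<delta> q)"
    using bounded_above_common vir_elt_bounded by metis
  have E: "exp_ad X (\<delta> q) = \<delta> q + E'"
    unfolding exp_ad_vir[OF X] E'_def by (simp add: add.assoc)
  \<comment> \<open>The term of order 0 is the only one without a bracket; it is split off to be
    paired with \<open>vir_elt \<A> s q\<close>.\<close>
  have "exp_ad (V p) (\<delta> q) = \<delta> q + graded_sum (\<lambda>m. cscale (1 / fact (Suc m)) ((clie (V p) ^^ Suc m) (\<delta> q)))"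
    unfolding exp_ad_graded_sum
    by (subst graded_sum_Suc[OF falling_funpow[OF V_vanishes N(2)]]) (simp add: cscale_one)
  moreover have "graded_sum (\<lambda>m. cscale (1 / fact (Suc m)) ((clie (V p) ^^ Suc m) (\<delta> q))) n \<in> \<g>"
  proof (rule graded_sum_mem[OF subspace_derived])
    fix m
    have "(clie (V p) ^^ Suc m) (\<delta> q) n \<in> \<g>"
      unfolding funpow_Suc_right comp_apply
      by (intro funpow_derived clie_vir_derived V_derived)
    then show "cscale (1 / fact (Suc m)) ((clie (V p) ^^ Suc m) (\<delta> q)) n \<in> \<g>"
      unfolding cscale_apply by (intro complex_vector.subspace_scale subspace_derived)
  qed
  moreover have "\<delta> q n - vir_elt \<A> s q n \<in> \<g>"
    using virasoro_diff_derived[OF gradation_principal s] complex_vector.subspace_0[OF subspace_derived]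
    by (simp add: vir_elt_def homogeneous_def)
  moreover have "exp_ad (V p) E' n \<in> \<g>"
    by (intro exp_ad_derived V_derived E'g)
  moreover have "B_elt \<A> s q (t p) (V p) n =
      exp_ad (V p) (\<delta> q) n + exp_ad (V p) E' n - vir_elt \<A> s q n"
    unfolding B_elt_def X_def[symmetric] E exp_ad_add[OF V_vanishes N(2,1)] by simp
  ultimately have "B_elt \<A> s q (t p) (V p) n = (\<delta> q n - vir_elt \<A> s q n) +
      graded_sum (\<lambda>m. cscale (1 / fact (Suc m)) ((clie (V p) ^^ Suc m) (\<delta> q))) n + exp_ad (V p) E' n"
    "(\<delta> q n - vir_elt \<A> s q n) +
      graded_sum (\<lambda>m. cscale (1 / fact (Suc m)) ((clie (V p) ^^ Suc m) (\<delta> q))) n + exp_ad (V p) E' n \<in> \<g>"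
    by (simp, intro complex_vector.subspace_add subspace_derived)
  then show ?thesis by simp
qed

text \<open>The inner exponential contributes a bracket with
  \<open>- cscale b (heis_elt \<A> i)\<close>. As \<open>exp_ad (V p)\<close> preserves brackets, by
  \<open>exp_ad_clie\<close>, this becomes a bracket with \<open>dressed_vir q p\<close> and
  combines with the one produced by the variation of \<open>V\<close>.\<close>

lemma dressed_vir_curve_derivative:
  assumes V': "has_flow_derivative \<gamma> V V'"
    and \<gamma>: "flow_of_times (pos_exponents \<A>) t \<gamma> w" and i: "i \<in> pos_exponents \<A>"
    and w: "w = (\<lambda>j. if j = i then b else 0)"
  obtains N where "has_curve_derivative N (\<lambda>\<epsilon>. dressed_vir q (\<gamma> p \<epsilon>))
    (clie (nabla (V p) (V' p) - exp_ad (V p) (cscale b (heis_elt \<A> i))) (dressed_vir q p))"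
proof -
  have \<gamma>0: "\<gamma> p 0 = p" using \<gamma> by (simp add: flow_of_times_def)
  let ?h = "cscale b (heis_elt \<A> i)"
  note VV = V_curve_derivative[OF V', of p]
  obtain N where N: "has_curve_derivative N (\<lambda>\<epsilon>. - Xi \<A> (t (\<gamma> p \<epsilon>))) (- ?h)"
    using Xi_curve_derivative[OF \<gamma> i w] .
  have "heis_valued (- ?h)"
    using heis_valued_heis_elt[OF i] unfolding heis_valued_def
    by (simp add: bounded_above_minus bounded_above_cscale)
      (simp add: cscale_apply complex_vector.span_neg complex_vector.span_scale)
  moreover have "\<forall>\<^sub>F \<epsilon> in nhds 0. heis_valued (- Xi \<A> (t (\<gamma> p \<epsilon>)))"
    by (intro always_eventually allI heis_valued_Xi times_finite)
  ultimately obtain M where M: "has_curve_derivative M (\<lambda>\<epsilon>. exp_ad (- Xi \<A> (t (\<gamma> p \<epsilon>))) (\<delta> q))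
      (clie (- ?h) (exp_ad (- Xi \<A> (t p)) (\<delta> q)))"
    using exp_ad_vir_curve_derivative[OF N, of q] unfolding \<gamma>0 by metis
  have "vanishes_above (fst i) ?h"
    unfolding heis_elt_def by (intro vanishes_above_cscale homogeneous_vanishes)
  note h = this vanishes_above_minus[OF this]
  obtain K where K: "vanishes_above K (exp_ad (- Xi \<A> (t p)) (\<delta> q))"
    using exp_ad_Xi_bounded by (auto simp: bounded_above_def)
  have V'van: "vanishes_above (-1) (V' p)" using has_curve_derivative_vanishes(2)[OF VV] .
  have "exp_ad (V p) (clie (- ?h) (exp_ad (- Xi \<A> (t p)) (\<delta> q))) + clie (nabla (V p) (V' p)) (dressed_vir q p) =
      clie (- exp_ad (V p) ?h) (dressed_vir q p) + clie (nabla (V p) (V' p)) (dressed_vir q p)"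
    unfolding dressed_vir_def exp_ad_clie[OF V_vanishes h(2) K] exp_ad_minus[OF V_vanishes h(1)] ..
  also have "\<dots> = clie (nabla (V p) (V' p) + - exp_ad (V p) ?h) (dressed_vir q p)"
    using vanishes_above_nabla[OF V_vanishes V'van] vanishes_above_exp_ad[OF V_vanishes h(1)]
    by (subst clie_add_left) (auto intro: bounded_aboveI bounded_above_minus dressed_vir_bounded simp: add.commute)
  finally have eq: "exp_ad (V p) (clie (- ?h) (exp_ad (- Xi \<A> (t p)) (\<delta> q))) +
      clie (nabla (V p) (V' p)) (dressed_vir q p) =
      clie (nabla (V p) (V' p) - exp_ad (V p) ?h) (dressed_vir q p)" by simp
  have "has_curve_derivative M (\<lambda>\<epsilon>. dressed_vir q (\<gamma> p \<epsilon>))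
      (exp_ad (V p) (clie (- ?h) (exp_ad (- Xi \<A> (t p)) (\<delta> q))) + clie (nabla (V p) (V' p)) (dressed_vir q p))"
    using has_curve_derivative_exp_ad[OF VV M] unfolding \<gamma>0 dressed_vir_def .
  with that show ?thesis unfolding eq .
qed

lemma dressed_heis_curve_derivative:
  assumes "has_flow_derivative \<gamma> V V'" "\<gamma> p 0 = p"
  shows "has_curve_derivative (fst j) (\<lambda>\<epsilon>. dressed_heis j (\<gamma> p \<epsilon>))
    (clie (nabla (V p) (V' p)) (dressed_heis j p))"
  using has_curve_derivative_exp_ad[OF V_curve_derivative[OF assms(1), of p]
      has_curve_derivative_const[OF homogeneous_vanishes[of "fst j" "heis \<A> j"]]] assms(2)
  by (simp only: dressed_heis_def heis_elt_def exp_ad_zero add_0)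

lemma B_elt_curve_derivative:
  assumes "has_curve_derivative N (\<lambda>\<epsilon>. dressed_vir q (\<gamma> p \<epsilon>)) D'"
  obtains M where "has_curve_derivative M (\<lambda>\<epsilon>. B_elt \<A> s q (t (\<gamma> p \<epsilon>)) (V (\<gamma> p \<epsilon>))) D'"
proof -
  define M where "M = max N (int (period \<A> principal_grad) * q)"
  have "has_curve_derivative M (\<lambda>\<epsilon>. dressed_vir q (\<gamma> p \<epsilon>) - vir_elt \<A> s q) (D' - 0)"
    by (intro has_curve_derivative_diff has_curve_derivative_mono[OF assms]
        has_curve_derivative_mono[OF has_curve_derivative_const[OF vir_elt_vanishes]]) (auto simp: M_def)
  with that show ?thesis by (simp only: B_elt_eq diff_zero)
qed

lemma flows_commute:
  assumes j: "j \<in> pos_exponents \<A>" and q: "q \<in> vir_indices \<A> s"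
    and t_flow: "flow_of_times (pos_exponents \<A>) t \<tau> (\<lambda>i. if i = j then 1 else 0)"
    and \<beta>_flow: "flow_of_times (pos_exponents \<A>) t \<gamma> (\<lambda>i. 0)"
    and Vt: "has_flow_derivative \<tau> V Vt" and V\<beta>: "has_flow_derivative \<gamma> V V\<beta>"
    and t_eq: "\<And>p. nabla (V p) (Vt p) = cneg \<A> s (dressed_heis j p)"
    and \<beta>_eq: "\<And>p. nabla (V p) (V\<beta> p) = - cneg \<A> s (B_elt \<A> s q (t p) (V p))"
  shows "has_flow_derivative \<tau> (\<lambda>p. B_elt \<A> s q (t p) (V p))
      (\<lambda>p. clie (- cnonneg \<A> s (dressed_heis j p)) (B_elt \<A> s q (t p) (V p) + vir_elt \<A> s q))"
    and "\<exists>W. has_flow_derivative \<tau> V\<beta> W \<and> has_flow_derivative \<gamma> Vt W"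
proof -
  let ?B = "\<lambda>p. B_elt \<A> s q (t p) (V p)" and ?L = "dressed_heis j" and ?D = "dressed_vir q"
  let ?P = "\<lambda>p. cnonneg \<A> s (?L p)" and ?A = "\<lambda>p. cneg \<A> s (?L p)"
  let ?C = "\<lambda>p. - cneg \<A> s (?B p)"
  obtain Q where Q: "Vector_Spaces.linear scaleC scaleC Q"
    "\<And>x. x \<in> \<g> \<Longrightarrow> neg_proj \<A> s x = Q x" "\<And>x. x \<in> \<g> \<Longrightarrow> nonneg_proj \<A> s x = x - Q x"
    "\<And>x. x \<in> neg_space \<A> s \<Longrightarrow> Q x = x" "\<And>x. x \<in> nonneg_space \<A> s \<Longrightarrow> Q x = 0"
    "\<And>x. Q x \<in> neg_space \<A> s" "\<And>x. x \<in> \<g> \<Longrightarrow> x - Q x \<in> nonneg_space \<A> s"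
    by (rule linear_projection[OF s], rule that)
  have Q0: "Q 0 = 0"
    by (rule Q(5)) (rule complex_vector.subspace_0[OF subspace_nonneg_space[OF s]])
  have Qadd: "Q (x + y) = Q x + Q y" for x y using Q(1) by (simp add: linear_scaleC_iff)
  have Qneg: "Q (- x) = - Q x" for x using Qadd[of x "- x"] Q0 by (simp add: eq_neg_iff_add_eq_0 add.commute)
  have Lg: "?L p n \<in> \<g>" for p n using j by (rule dressed_heis_derived)
  have Bg: "?B p n \<in> \<g>" for p n by (rule B_elt_derived)
  have A: "?A p = (\<lambda>n. Q (?L p n))" and P: "?P p = (\<lambda>n. ?L p n - Q (?L p n))"
    and negB: "cneg \<A> s (?B p) = (\<lambda>n. Q (?B p n))"
    and nonnegB: "cnonneg \<A> s (?B p) = (\<lambda>n. ?B p n - Q (?B p n))" for p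
    using Lg Bg by (auto simp: cneg_def cnonneg_def Q(2,3))
  have C: "?C p = (\<lambda>n. - Q (?B p n))" for p by (simp add: negB fun_Compl_def)
  have bdQ: "bounded_above (\<lambda>n. Q (X n))" if X: "bounded_above X" for X
  proof -
    obtain N where "vanishes_above N X" using X by (auto simp: bounded_above_def)
    then have "vanishes_above N (\<lambda>n. Q (X n))" using Q0 by (simp add: vanishes_above_def)
    then show ?thesis by (rule bounded_aboveI)
  qed
  have bL: "bounded_above (?L p)" for p by (rule dressed_heis_bounded)
  have bB: "bounded_above (?B p)" for p
    unfolding B_elt_eq diff_conv_add_uminus
    by (intro bounded_above_intros dressed_vir_bounded vir_elt_bounded)
  have bA: "bounded_above (?A p)" for p unfolding A by (rule bdQ[OF bL])
  have bP: "bounded_above (?P p)" for p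
    using bounded_above_add[OF bL[of p] bounded_above_minus[OF bA[of p]]] by (simp add: A P fun_Compl_def plus_fun_def)
  have bC: "bounded_above (?C p)" for p unfolding negB by (rule bounded_above_minus[OF bdQ[OF bB]])
  have bN: "bounded_above (cnonneg \<A> s (?B p))" for p
    using bounded_above_add[OF bB[of p] bC[of p]]
    by (simp add: nonnegB C plus_fun_def)
  have L: "?L p = ?A p + ?P p" for p by (simp add: A P fun_eq_iff)
  have D: "?D p = ?B p + vir_elt \<A> s q" for p by (simp add: B_elt_eq)
  have B: "?B p = - ?C p + cnonneg \<A> s (?B p)" for p by (simp add: negB nonnegB fun_eq_iff)
  have \<tau>0: "\<tau> p 0 = p" and \<gamma>0: "\<gamma> p 0 = p" for p
    using t_flow \<beta>_flow by (simp_all add: flow_of_times_def)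
  \<comment> \<open>Along the t-flow, \<open>?A p\<close> stems from the variation of
    \<open>V\<close> and \<open>- ?L p\<close> from the time in \<open>Xi\<close>. Their sum is how
    the nonnegative part enters the equation for \<open>B_elt\<close>.\<close>
  have AP: "?A p - ?L p = - ?P p" for p by (simp add: A P fun_eq_iff)
  have tD: "\<exists>N. has_curve_derivative N (\<lambda>\<epsilon>. ?B (\<tau> p \<epsilon>)) (clie (- ?P p) (?D p))" for p
  proof -
    obtain N where "has_curve_derivative N (\<lambda>\<epsilon>. ?D (\<tau> p \<epsilon>))
        (clie (nabla (V p) (Vt p) - exp_ad (V p) (cscale 1 (heis_elt \<A> j))) (?D p))"
      by (rule dressed_vir_curve_derivative[OF Vt t_flow j refl])
    then have "has_curve_derivative N (\<lambda>\<epsilon>. ?D (\<tau> p \<epsilon>)) (clie (- ?P p) (?D p))"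
      unfolding cscale_one dressed_heis_def[symmetric] t_eq AP .
    then obtain M where "has_curve_derivative M (\<lambda>\<epsilon>. ?B (\<tau> p \<epsilon>)) (clie (- ?P p) (?D p))"
      by (rule B_elt_curve_derivative)
    then show ?thesis by (rule exI)
  qed
  \<comment> \<open>The degree bound depends on the point; fixing one for each \<open>p\<close>
    allows later statements to refer to it.\<close>
  define N where "N p = (SOME n. has_curve_derivative n (\<lambda>\<epsilon>. ?B (\<tau> p \<epsilon>)) (clie (- ?P p) (?D p)))" for p
  have N: "has_curve_derivative (N p) (\<lambda>\<epsilon>. ?B (\<tau> p \<epsilon>)) (clie (- ?P p) (?D p))" for p
    unfolding N_def by (rule someI_ex[OF tD])
  show "has_flow_derivative \<tau> ?B (\<lambda>p. clie (- ?P p) (?B p + vir_elt \<A> s q))"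
    unfolding D[symmetric] by (rule has_flow_derivativeI) (rule N)
  have ex: "\<exists>W. has_curve_derivative (max (N p) (-1)) (\<lambda>\<epsilon>. V\<beta> (\<tau> p \<epsilon>)) W \<and>
      has_curve_derivative (max (fst j) (-1)) (\<lambda>\<epsilon>. Vt (\<gamma> p \<epsilon>)) W" for p
  proof -
    have van: "vanishes_above M (V\<beta> p)" "vanishes_above M (Vt p)" if "-1 \<le> M" for M p
      using has_curve_derivative_vanishes(2)[OF V_curve_derivative[OF V\<beta>, of p]]
        has_curve_derivative_vanishes(2)[OF V_curve_derivative[OF Vt, of p]] vanishes_above_mono[OF _ that]
      by auto
    \<comment> \<open>These are the derivatives of \<open>?C\<close> along the t-flow and of
      \<open>?A\<close> along the \<beta>-flow: \<open>Q\<close> commutes with differentiation, and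
      by the \<beta>-equation the derivative of \<open>?L\<close> is the bracket of
      \<open>?C p\<close> with \<open>?L p\<close>.\<close>
    let ?C' = "\<lambda>n. - Q (clie (- ?P p) (?D p) n)" and ?A' = "\<lambda>n. Q (clie (?C p) (?L p) n)"
    have "has_curve_derivative (N p) (\<lambda>\<epsilon> n. - Q (?B (\<tau> p \<epsilon>) n)) ?C'"
      using has_curve_derivative_minus[OF has_curve_derivative_linear[OF N[of p] Q(1)]]
      by (simp add: fun_Compl_def)
    \<comment> \<open>\<open>has_curve_derivative_solve_nabla\<close> asks for one bound for the
      right side and the solution; the maximum with \<open>-1\<close> is also a bound for
      \<open>V\<beta>\<close>.\<close>
    then have dC: "has_curve_derivative (max (N p) (-1)) (\<lambda>\<epsilon>. ?C (\<tau> p \<epsilon>)) ?C'"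
      unfolding C by (rule has_curve_derivative_mono) simp
    obtain W1 where W1: "has_curve_derivative (max (N p) (-1)) (\<lambda>\<epsilon>. V\<beta> (\<tau> p \<epsilon>)) W1"
      "nabla (V p) W1 + nabla_deriv (V p) (Vt p) (V\<beta> p) = ?C'"
      by (rule has_curve_derivative_solve_nabla[OF V_curve_derivative[OF Vt, of p] dC van(1) \<beta>_eq, unfolded \<tau>0])
        auto
    have "has_curve_derivative (fst j) (\<lambda>\<epsilon>. ?A (\<gamma> p \<epsilon>)) ?A'"
      using has_curve_derivative_linear[OF dressed_heis_curve_derivative[OF V\<beta> \<gamma>0, of j] Q(1)]
      unfolding A \<beta>_eq by simp
    then have dA: "has_curve_derivative (max (fst j) (-1)) (\<lambda>\<epsilon>. ?A (\<gamma> p \<epsilon>)) ?A'"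
      by (rule has_curve_derivative_mono) simp
    obtain W2 where W2: "has_curve_derivative (max (fst j) (-1)) (\<lambda>\<epsilon>. Vt (\<gamma> p \<epsilon>)) W2"
      "nabla (V p) W2 + nabla_deriv (V p) (V\<beta> p) (Vt p) = ?A'"
      by (rule has_curve_derivative_solve_nabla[OF V_curve_derivative[OF V\<beta>, of p] dA van(2) t_eq, unfolded \<gamma>0])
        auto
    \<comment> \<open>Both sides are compared after splitting into negative and nonnegative parts.
      In \<open>?C'\<close>, the element \<open>?D p\<close> consists of \<open>- ?C p\<close>, a
      nonnegative part and the Virasoro element; \<open>Q\<close> annihilates the brackets of
      \<open>?P p\<close> with the last two. What survives is \<open>Q\<close> of the bracket of
      \<open>?C p\<close> with \<open>?P p\<close>, which is the mixed part of
      \<open>?A'\<close>.\<close>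
    have zero_curvature: "?A' = ?C' + clie (?C p) (?A p)"
    proof
      fix n
      have mem: "?C p i \<in> neg_space \<A> s" "?A p i \<in> neg_space \<A> s" "?P p i \<in> nonneg_space \<A> s"
        "cnonneg \<A> s (?B p) i \<in> nonneg_space \<A> s" for i
        using Q(6,7) Lg Bg complex_vector.subspace_neg[OF subspace_neg_space[OF s]]
        by (auto simp: C A P nonnegB)
      have 1: "Q (clie (?C p) (?A p) n) = clie (?C p) (?A p) n"
        by (intro Q(4) clie_mem[OF subspace_neg_space[OF s] mem(1,2)] lie_neg_space[OF s])
      have 2: "Q (clie (?P p) (cnonneg \<A> s (?B p)) n) = 0"
        by (intro Q(5) clie_mem[OF subspace_nonneg_space[OF s] mem(3,4)] lie_nonneg_space[OF s])
      have 3: "Q (clie (?P p) (vir_elt \<A> s q) n) = 0"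
      proof (intro Q(5) clie_mem[OF subspace_nonneg_space[OF s] mem(3)])
        show "vir_elt \<A> s q i \<in> {0, virasoro \<A> s q}" for i
          by (simp add: vir_elt_def homogeneous_def)
        show "lie x y \<in> nonneg_space \<A> s" if "x \<in> nonneg_space \<A> s" "y \<in> {0, virasoro \<A> s q}" for x y
          using that virasoro_nonneg_space[OF s q] complex_vector.subspace_0[OF subspace_nonneg_space[OF s]]
          by auto
      qed
      have "clie (?P p) (?D p) = clie (?P p) (?B p) + clie (?P p) (vir_elt \<A> s q)"
        unfolding D by (rule clie_add_right[OF bP bB vir_elt_bounded])
      also have "clie (?P p) (?B p) = clie (?P p) (- ?C p) + clie (?P p) (cnonneg \<A> s (?B p))"
        by (subst B) (rule clie_add_right[OF bP bounded_above_minus[OF bC] bN])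
      also have "clie (?P p) (- ?C p) = clie (?C p) (?P p)"
        unfolding clie_minus_right[OF bP bC] by (rule clie_antisym[OF bP bC, symmetric])
      finally have PD: "clie (?P p) (?D p) = clie (?C p) (?P p) +
          clie (?P p) (cnonneg \<A> s (?B p)) + clie (?P p) (vir_elt \<A> s q)" .
      have bD: "bounded_above (?D p)" by (rule dressed_vir_bounded)
      have "?C' n = Q (clie (?P p) (?D p) n)"
        unfolding clie_minus_left[OF bP bD] by (simp add: Qneg)
      also have "\<dots> = Q (clie (?C p) (?P p) n)"
        unfolding PD by (simp add: Qadd 2 3)
      finally have "?C' n = Q (clie (?C p) (?P p) n)" .
      moreover have "clie (?C p) (?L p) = clie (?C p) (?A p) + clie (?C p) (?P p)"
        by (subst L) (rule clie_add_right[OF bC bA bP])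
      ultimately show "?A' n = (?C' + clie (?C p) (?A p)) n"
        using 1 by (simp add: Qadd)
    qed
    \<comment> \<open>By the Maurer-Cartan relation the two \<open>nabla_deriv\<close> corrections
      differ by exactly the curvature term, so after cancellation \<open>nabla (V p)\<close> takes
      the same value on the two mixed derivatives \<open>W1\<close> and \<open>W2\<close>.\<close>
    have "nabla_deriv (V p) (V\<beta> p) (Vt p) - nabla_deriv (V p) (Vt p) (V\<beta> p) = clie (?C p) (?A p)"
      using nabla_deriv_antisym[OF V_vanishes van(1)[OF order_refl] van(2)[OF order_refl]]
      by (simp only: t_eq \<beta>_eq)
    then have "nabla_deriv (V p) (V\<beta> p) (Vt p) = nabla_deriv (V p) (Vt p) (V\<beta> p) + clie (?C p) (?A p)"
      by (simp only: diff_eq_eq add.commute)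
    with W1(2) W2(2) zero_curvature
    have "nabla (V p) W2 + nabla_deriv (V p) (Vt p) (V\<beta> p) + clie (?C p) (?A p) =
        nabla (V p) W1 + nabla_deriv (V p) (Vt p) (V\<beta> p) + clie (?C p) (?A p)"
      by (simp only: add.assoc)
    then have "nabla (V p) W2 = nabla (V p) W1"
      by (simp only: add_right_cancel)
    moreover define M where "M = max (max (N p) (-1)) (max (fst j) (-1))"
    then have vW: "vanishes_above M W1" "vanishes_above M W2"
      using has_curve_derivative_vanishes(2)[OF W1(1)] has_curve_derivative_vanishes(2)[OF W2(1)]
      by (auto intro: vanishes_above_mono)
    ultimately have "nabla (V p) (W2 - W1) = 0"
      using nabla_diff[OF V_vanishes vW(2,1)] by simp
    then have "W2 - W1 = 0"
      by (rule nabla_eq_zero[OF V_vanishes vanishes_above_diff[OF vW(2,1)]])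
    with W1(1) W2(1) show ?thesis by auto
  qed
  obtain W where W: "\<forall>p. has_curve_derivative (max (N p) (-1)) (\<lambda>\<epsilon>. V\<beta> (\<tau> p \<epsilon>)) (W p) \<and>
      has_curve_derivative (max (fst j) (-1)) (\<lambda>\<epsilon>. Vt (\<gamma> p \<epsilon>)) (W p)"
    using choice[OF allI, OF ex] by (rule exE)
  show "\<exists>W. has_flow_derivative \<tau> V\<beta> W \<and> has_flow_derivative \<gamma> Vt W"
  proof (intro exI[of _ W] conjI)
    show "has_flow_derivative \<tau> V\<beta> W"
      by (rule has_flow_derivativeI) (rule W[rule_format, THEN conjunct1])
    show "has_flow_derivative \<gamma> Vt W"
      by (rule has_flow_derivativeI) (rule W[rule_format, THEN conjunct2])
  qed
qed

end

theorem lemma4p2: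
  fixes \<A> :: "('a::complex_lie_algebra, 'b::complex_lie_algebra) affine_data"
    and s :: "nat \<Rightarrow> nat"
    and t :: "'p \<Rightarrow> int \<times> nat \<Rightarrow> complex"
    and V :: "'p \<Rightarrow> int \<Rightarrow> 'a"
    and t_flow :: "int \<times> nat \<Rightarrow> 'p \<Rightarrow> real \<Rightarrow> 'p"
    and \<beta>_flow :: "int \<Rightarrow> 'p \<Rightarrow> real \<Rightarrow> 'p"
    and Vt :: "int \<times> nat \<Rightarrow> 'p \<Rightarrow> int \<Rightarrow> 'a"
    and V\<beta> :: "int \<Rightarrow> 'p \<Rightarrow> int \<Rightarrow> 'a"
  assumes setting: "affine_setting \<A>"
    and s_nonzero: "gradation \<A> s"
    and s_le_1: "\<forall>i\<le>aff_rank \<A>. s i \<le> 1"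
    and times_finite: "\<forall>p. finite {j \<in> pos_exponents \<A>. t p j \<noteq> 0}"
    and t_flow: "\<forall>j\<in>pos_exponents \<A>.
          flow_of_times (pos_exponents \<A>) t (t_flow j) (\<lambda>i. if i = j then 1 else 0)"
    and \<beta>_flow: "\<forall>k\<in>vir_indices \<A> s.
          flow_of_times (pos_exponents \<A>) t (\<beta>_flow k) (\<lambda>i. 0)"
    and V_neg: "neg_valued \<A> s V"
    and Vt: "\<forall>j\<in>pos_exponents \<A>. has_flow_derivative (t_flow j) V (Vt j)"
    and V\<beta>: "\<forall>k\<in>vir_indices \<A> s. has_flow_derivative (\<beta>_flow k) V (V\<beta> k)"
    and t_eq: "\<forall>j\<in>pos_exponents \<A>. \<forall>p.
          nabla (V p) (Vt j p) = cneg \<A> s (exp_ad (V p) (heis_elt \<A> j))"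
    and \<beta>_eq: "\<forall>k\<in>vir_indices \<A> s. \<forall>p.
          nabla (V p) (V\<beta> k p) = - cneg \<A> s (B_elt \<A> s k (t p) (V p))"
  shows "\<forall>j\<in>pos_exponents \<A>. \<forall>k\<in>vir_indices \<A> s.
      has_flow_derivative (t_flow j) (\<lambda>p. B_elt \<A> s k (t p) (V p))
        (\<lambda>p. clie (- cnonneg \<A> s (exp_ad (V p) (heis_elt \<A> j)))
               (B_elt \<A> s k (t p) (V p) + vir_elt \<A> s k)) \<and>
      (\<exists>W. has_flow_derivative (t_flow j) (V\<beta> k) W \<and>
           has_flow_derivative (\<beta>_flow k) (Vt j) W)"
proof (intro ballI)
  fix j k assume j: "j \<in> pos_exponents \<A>" and k: "k \<in> vir_indices \<A> s"
  interpret commuting_flows \<A> s t V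
    by unfold_locales (use setting s_nonzero times_finite V_neg in auto)
  note commute = flows_commute[OF j k, of "t_flow j" "\<beta>_flow k" "Vt j" "V\<beta> k", unfolded dressed_heis_def]
  show "has_flow_derivative (t_flow j) (\<lambda>p. B_elt \<A> s k (t p) (V p))
        (\<lambda>p. clie (- cnonneg \<A> s (exp_ad (V p) (heis_elt \<A> j)))
               (B_elt \<A> s k (t p) (V p) + vir_elt \<A> s k)) \<and>
      (\<exists>W. has_flow_derivative (t_flow j) (V\<beta> k) W \<and> has_flow_derivative (\<beta>_flow k) (Vt j) W)"
    by (intro conjI commute) (use j k t_flow \<beta>_flow Vt V\<beta> t_eq \<beta>_eq in blast)+
qed

end
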